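(* Let $f\in X_0'$ and let $(h_j)_j\subset\mathcal{H}$ be a sequence. Then there exist a subsequence (not relabelled) and $h\in\mathcal{H}$ such that $h_j\rightharpoonup h$ weakly-$\ast$ in $L^\infty(\mathbb{R}^N\times\mathbb{R}^N)$ and, denoting by $u_j\in X_0$ the solution of $(P_{h_j})$ and by $u\in X_0$ the solution of $(P_h)$, all with the same right-hand side $f$, $u_j\to u$ strongly in $X_0$ as $j\to\infty$.
   Context: Let $\Omega\subset\mathbb{R}^N$ be a bounded open smooth domain and let $1<p<\infty$. Let $k$ be a radial and positive function in $L^1(\mathbb{R}^N)$ (written $k(|z|)$, $z\in\mathbb{R}^N$) such that $\int_{\mathbb{R}^N\setminus B(0,\epsilon)}\frac{k(|z|)}{|z|^p}\,dz<\infty$ for every $\epsilon>0$, where $B(0,\epsilon)$ is the open ball of radius $\epsilon$ centred at $0$, and $k(|z|)\ge \frac{c_0}{|z|^{N+(s-1)p}}$ for all $z\in\mathbb{R}^N\setminus\{0\}$, where $c_0>0$ and $s\in(0,1)$ are given constants. Put $B(w,w)=\int_{\mathbb{R}^N}\int_{\mathbb{R}^N}k(|x'-x|)\frac{|w(x')-w(x)|^p}{|x'-x|^p}\,dx'dx$, $X=\{w\in L^p(\mathbb{R}^N): B(w,w)<\infty\}$ and $X_0=\{w\in X: w=0\text{ a.e. in }\mathbb{R}^N\setminus\Omega\}$, normed by $\|w\|_{X_0}=B(w,w)^{1/p}$ (equivalent on $X_0$ to $\|w\|_{L^p(\mathbb{R}^N)}+B(w,w)^{1/p}$). $X_0'$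 is its dual and $\langle\cdot,\cdot\rangle$ the duality pairing between $X_0'$ and $X_0$. All functions are real-valued. Fix constants $0<h_{\min}<h_{\max}$; $\mathcal{H}$ is the set of $h\in L^\infty(\mathbb{R}^N\times\mathbb{R}^N)$ with $h(x',x)=h(x,x')\in[h_{\min},h_{\max}]$ for a.e. $(x',x)$. For $h\in\mathcal{H}$ and $u,v\in X_0$, $$B_h(u,v)=\int_{\mathbb{R}^N}\int_{\mathbb{R}^N}h(x',x)\,k(|x'-x|)\,\frac{|u(x')-u(x)|^{p-2}(u(x')-u(x))(v(x')-v(x))}{|x'-x|^p}\,dx'dx .$$ Given $f\in X_0'$, the solution of problem $(P_h)$ is the unique $u\in X_0$ such that $B_h(u,v)=\langle f,v\rangle$ for all $v\in X_0$.
   Formalization: The kernel k is assumed only locally integrable instead of in L^1(R^N), because the lower bound k(|z|) ≥ c_0/|z|^{N+(s-1)p} for all z ≠ 0 is not integrable at infinity, so no k in L^1(R^N) satisfies it; all other hypotheses are unchanged. *)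

theory Defs
  imports "HOL-Analysis.Analysis"
begin

text \<open>For open \<open>U\<close>, \<open>Ck_on n g U\<close> says that \<open>g\<close> is of class \<open>C\<close>-\<open>n\<close> on \<open>U\<close>.\<close>

primrec Ck_on :: "nat \<Rightarrow> ('a::real_normed_vector \<Rightarrow> real) \<Rightarrow> 'a set \<Rightarrow> bool" where
  "Ck_on 0 g U \<longleftrightarrow> continuous_on U g"
| "Ck_on (Suc n) g U \<longleftrightarrow>
     (\<forall>x\<in>U. g differentiable (at x)) \<and>
     (\<forall>v. Ck_on n (\<lambda>x. frechet_derivative g (at x) v) U)"

text \<open>Near each boundary point the set is the region above the graph of a smooth function over the
  hyperplane orthogonal to a unit vector \<open>e\<close>; a function on that hyperplane is represented by a
  function on the whole space that is constant in the direction \<open>e\<close>.\<close>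

definition smooth_boundary :: "'a::euclidean_space set \<Rightarrow> bool" where
  "smooth_boundary \<Omega> \<longleftrightarrow>
     (\<forall>a\<in>frontier \<Omega>. \<exists>r>0. \<exists>e g. norm e = 1 \<and> (\<forall>n. Ck_on n g UNIV) \<and>
        (\<forall>x t. g (x + t *\<^sub>R e) = g x) \<and>
        \<Omega> \<inter> ball a r = {x \<in> ball a r. g x < x \<bullet> e})"

definition smooth_bounded_domain :: "'a::euclidean_space set \<Rightarrow> bool" where
  "smooth_bounded_domain \<Omega> \<longleftrightarrow>
     open \<Omega> \<and> connected \<Omega> \<and> \<Omega> \<noteq> {} \<and> bounded \<Omega> \<and> smooth_boundary \<Omega>"

text \<open>The value of a kernel at the origin is irrelevant, as it may be singular there.
  Integrability is required on compact sets only: integrability on the whole space is incompatible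
  with the lower bound, because \<open>1 / norm z powr (N + (s - 1) * p)\<close> has infinite integral near
  infinity for \<open>s < 1\<close>. Results for globally integrable kernels are formally a special case.\<close>

definition locally_integrable :: "('a::euclidean_space \<Rightarrow> real) \<Rightarrow> bool" where
  "locally_integrable g \<longleftrightarrow> (\<forall>K. compact K \<longrightarrow> set_integrable lebesgue K g)"

definition radial :: "('a::real_normed_vector \<Rightarrow> real) \<Rightarrow> bool" where
  "radial k \<longleftrightarrow> (\<forall>z z'. norm z = norm z' \<longrightarrow> k z = k z')"

definition admissible_kernel :: "real \<Rightarrow> real \<Rightarrow> real \<Rightarrow> ('a::euclidean_space \<Rightarrow> real) \<Rightarrow> bool" where
  "admissible_kernel p s c0 k \<longleftrightarrow>
     radial k \<and> (\<forall>z. z \<noteq> 0 \<longrightarrow> 0 < k z) \<and> locally_integrable k \<and>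
     (\<forall>\<epsilon>>0. set_integrable lebesgue (- ball 0 \<epsilon>) (\<lambda>z. k z / norm z powr p)) \<and>
     (\<forall>z. z \<noteq> 0 \<longrightarrow> c0 / norm z powr (real DIM('a) + (s - 1) * p) \<le> k z)"

text \<open>Elements of the spaces below are functions rather than classes modulo equality almost everywhere.
  The energy takes values in the extended nonnegative reals; the diagonal, on which the quotient
  evaluates to 0, is a null set.\<close>

definition energy :: "('a::euclidean_space \<Rightarrow> real) \<Rightarrow> real \<Rightarrow> ('a \<Rightarrow> real) \<Rightarrow> ennreal" where
  "energy k p w =
     (\<integral>\<^sup>+ (x', x). ennreal (k (x' - x) * (\<bar>w x' - w x\<bar> powr p / norm (x' - x) powr p)) \<partial>lebesgue)"

definition Lp :: "real \<Rightarrow> ('a::euclidean_space \<Rightarrow> real) set" where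
  "Lp p = {w \<in> borel_measurable lebesgue. integrable lebesgue (\<lambda>x. \<bar>w x\<bar> powr p)}"

definition X :: "('a::euclidean_space \<Rightarrow> real) \<Rightarrow> real \<Rightarrow> ('a \<Rightarrow> real) set" where
  "X k p = {w \<in> Lp p. energy k p w < \<infinity>}"

definition X0 :: "'a::euclidean_space set \<Rightarrow> ('a \<Rightarrow> real) \<Rightarrow> real \<Rightarrow> ('a \<Rightarrow> real) set" where
  "X0 \<Omega> k p = {w \<in> X k p. AE x in lebesgue. x \<notin> \<Omega> \<longrightarrow> w x = 0}"

definition X0_norm :: "('a::euclidean_space \<Rightarrow> real) \<Rightarrow> real \<Rightarrow> ('a \<Rightarrow> real) \<Rightarrow> real" where
  "X0_norm k p w = enn2real (energy k p w) powr (1 / p)"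

text \<open>The boundedness condition makes such a functional respect equality almost everywhere.\<close>

definition X0_dual ::
    "'a::euclidean_space set \<Rightarrow> ('a \<Rightarrow> real) \<Rightarrow> real \<Rightarrow> (('a \<Rightarrow> real) \<Rightarrow> real) set" where
  "X0_dual \<Omega> k p = {f.
     (\<forall>u\<in>X0 \<Omega> k p. \<forall>v\<in>X0 \<Omega> k p. f (\<lambda>x. u x + v x) = f u + f v) \<and>
     (\<forall>c. \<forall>u\<in>X0 \<Omega> k p. f (\<lambda>x. c * u x) = c * f u) \<and>
     (\<exists>C. \<forall>u\<in>X0 \<Omega> k p. \<bar>f u\<bar> \<le> C * X0_norm k p u)}"

definition Linf :: "'b measure \<Rightarrow> ('b \<Rightarrow> real) set" where
  "Linf M = {h \<in> borel_measurable M. \<exists>C. AE z in M. \<bar>h z\<bar> \<le> C}"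

definition weak_star_Linf :: "'b measure \<Rightarrow> (nat \<Rightarrow> 'b \<Rightarrow> real) \<Rightarrow> ('b \<Rightarrow> real) \<Rightarrow> bool" where
  "weak_star_Linf M hs h \<longleftrightarrow>
     (\<forall>g. integrable M g \<longrightarrow> (\<lambda>j. \<integral>z. hs j z * g z \<partial>M) \<longlonglongrightarrow> (\<integral>z. h z * g z \<partial>M))"

definition coeffs_H :: "real \<Rightarrow> real \<Rightarrow> ('a::euclidean_space \<times> 'a \<Rightarrow> real) set" where
  "coeffs_H hmin hmax = {h \<in> Linf lebesgue.
     AE (x', x) in lebesgue. h (x', x) = h (x, x') \<and> h (x', x) \<in> {hmin..hmax}}"

definition B_form ::
    "('a::euclidean_space \<Rightarrow> real) \<Rightarrow> real \<Rightarrow> ('a \<times> 'a \<Rightarrow> real) \<Rightarrow> ('a \<Rightarrow> real) \<Rightarrow> ('a \<Rightarrow> real) \<Rightarrow> real"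
  where
  "B_form k p h u v =
     (\<integral>(x', x). h (x', x) * k (x' - x) *
        (\<bar>u x' - u x\<bar> powr (p - 2) * (u x' - u x) * (v x' - v x) / norm (x' - x) powr p) \<partial>lebesgue)"

definition weak_eq ::
    "'a::euclidean_space set \<Rightarrow> ('a \<Rightarrow> real) \<Rightarrow> real \<Rightarrow> ('a \<times> 'a \<Rightarrow> real) \<Rightarrow>
     (('a \<Rightarrow> real) \<Rightarrow> real) \<Rightarrow> ('a \<Rightarrow> real) \<Rightarrow> bool" where
  "weak_eq \<Omega> k p h f u \<longleftrightarrow> u \<in> X0 \<Omega> k p \<and> (\<forall>v\<in>X0 \<Omega> k p. B_form k p h u v = f v)"

text \<open>The solution is unique as an element of the space, that is, up to null sets.\<close>

definition is_solution ::
    "'a::euclidean_space set \<Rightarrow> ('a \<Rightarrow> real) \<Rightarrow> real \<Rightarrow> ('a \<times> 'a \<Rightarrow> real) \<Rightarrow>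
     (('a \<Rightarrow> real) \<Rightarrow> real) \<Rightarrow> ('a \<Rightarrow> real) \<Rightarrow> bool" where
  "is_solution \<Omega> k p h f u \<longleftrightarrow>
     weak_eq \<Omega> k p h f u \<and> (\<forall>v. weak_eq \<Omega> k p h f v \<longrightarrow> (AE x in lebesgue. v x = u x))"

end

theory Submission
  imports Defs "HOL-Complex_Analysis.Great_Picard"
begin

text \<open>The solution for the coefficient \<open>h\<close> is the minimiser over the energy space of the convex functional
  \<open>J h u = (\<integral> h * \<bar>quot u\<bar> powr p) / p - f u\<close>, where \<open>quot u\<close> is the difference quotient of \<open>u\<close> weighted by the
  kernel. Strict convexity of \<open>\<lambda>a. \<bar>a\<bar> powr p\<close> in the quantitative form \<open>powr_uniform_convexity\<close> makes \<open>J h\<close>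
  uniformly convex (\<open>uniform_convexity\<close>), with constants that are the same for all admissible coefficients.
  Hence minimising sequences are Cauchy, solutions exist and are unique (\<open>weak_solution_exists\<close>,
  \<open>is_solution_if_weak_eq\<close>), and a function that almost minimises \<open>J h\<close> is close to the solution.

  Bounded symmetric coefficients are weak-star sequentially compact (\<open>coeffs_H_weak_star_compact\<close>), so
  one may assume that the coefficients \<open>hs j\<close> converge weak-star to some \<open>h\<close>. Let \<open>us j\<close> and \<open>u\<close> be the
  solutions for \<open>hs j\<close> and \<open>h\<close>. By convexity and the equation for \<open>u\<close>,
  \<open>J (hs j) (us j) - J (hs j) u\<close> is at least
  \<open>B (hs j) u (us j - u) - B h u (us j - u)\<close>. Once this tends to \<open>0\<close>, \<open>u\<close> almost
  minimises \<open>J (hs j)\<close>, and \<open>us j\<close> converges to \<open>u\<close> in energy (\<open>solutions_converge\<close>).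

  In this difference both \<open>hs j - h\<close> and \<open>us j - u\<close> converge only weakly, and for local equations the
  conclusion fails for this reason. Here \<open>us\<close> has bounded energy, so a subsequence is Cauchy in the
  \<open>p\<close>-th mean (\<open>compact_embedding\<close>), and the form is almost continuous in that sense: away from the
  diagonal it involves values and no differences of its second argument, and near the diagonal the
  fixed function \<open>u\<close> has little energy (\<open>pairing_bound_le\<close>). So \<open>us j\<close> may be replaced by a fixed
  \<open>us N\<close>, for which the weak-star convergence of the coefficients applies
  (\<open>form_difference_tendsto_0\<close>).\<close>

section \<open>Convexity of the power function\<close>

text \<open>Up to the factor \<open>p\<close>, the derivative of \<open>\<lambda>a. \<bar>a\<bar> powr p\<close>.\<close>
definition signed_powr :: "real \<Rightarrow> real \<Rightarrow> real" where
  "signed_powr p a = \<bar>a\<bar> powr (p - 2) * a"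

lemma abs_signed_powr: "\<bar>signed_powr p a\<bar> = \<bar>a\<bar> powr (p - 1)"
proof (cases "a = 0")
  case False
  then have "\<bar>a\<bar> powr (p - 2) * \<bar>a\<bar> = \<bar>a\<bar> powr (p - 2) * \<bar>a\<bar> powr 1" by simp
  also have "\<dots> = \<bar>a\<bar> powr (p - 1)" by (simp only: powr_add[symmetric]) simp
  finally show ?thesis by (simp add: signed_powr_def abs_mult)
qed (simp add: signed_powr_def)

lemma signed_powr_mult_self: "signed_powr p a * a = \<bar>a\<bar> powr p"
proof (cases "a = 0")
  case False
  have "signed_powr p a * a = \<bar>a\<bar> powr (p - 2) * (\<bar>a\<bar> * \<bar>a\<bar>)"
    by (simp add: signed_powr_def)
  also have "\<bar>a\<bar> * \<bar>a\<bar> = \<bar>a\<bar> powr 2"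
    using False by (simp add: powr_numeral power2_eq_square)
  also have "\<bar>a\<bar> powr (p - 2) * \<bar>a\<bar> powr 2 = \<bar>a\<bar> powr p"
    by (simp only: powr_add[symmetric]) simp
  finally show ?thesis .
qed (simp add: signed_powr_def)

lemma signed_powr_eq: "signed_powr p a = sgn a * \<bar>a\<bar> powr (p - 1)"
  using abs_signed_powr[of p a]
  by (cases a "0::real" rule: linorder_cases) (auto simp: signed_powr_def abs_mult)

lemma signed_powr_strict_mono:
  assumes "1 < p" "a < b" shows "signed_powr p a < signed_powr p b"
proof -
  consider "0 \<le> a" | "b \<le> 0" | "a < 0" "0 < b" by linarith
  then show ?thesis
  proof cases
    case 1
    then have "a powr (p - 1) < b powr (p - 1)" using assms by (intro powr_less_mono2) auto
    then show ?thesis using 1 assms by (cases "a = 0") (auto simp: signed_powr_eq)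
  next
    case 2
    then have "(- b) powr (p - 1) < (- a) powr (p - 1)" using assms by (intro powr_less_mono2) auto
    then show ?thesis using 2 assms by (cases "b = 0") (auto simp: signed_powr_eq)
  next
    case 3
    then show ?thesis by (auto simp: signed_powr_eq intro: less_trans[of _ 0])
  qed
qed

lemma continuous_signed_powr:
  assumes "1 < p" shows "continuous_on UNIV (signed_powr p)"
proof -
  have "isCont (signed_powr p) a" for a
  proof (cases "a = 0")
    case True
    have "((\<lambda>x. \<bar>x\<bar> powr (p - 1)) \<longlongrightarrow> \<bar>0::real\<bar> powr (p - 1)) (at 0)"
      using assms by (intro tendsto_powr2 tendsto_intros) auto
    then have "((\<lambda>x. \<bar>signed_powr p x\<bar>) \<longlongrightarrow> 0) (at 0)"
      using assms by (simp add: abs_signed_powr)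
    then have "(signed_powr p \<longlongrightarrow> 0) (at 0)"
      by (simp add: tendsto_rabs_zero_iff)
    then show ?thesis using True by (simp add: isCont_def signed_powr_def)
  next
    case False
    then show ?thesis unfolding signed_powr_def by (intro continuous_intros) auto
  qed
  then show ?thesis by (simp add: continuous_on_eq_continuous_at)
qed

text \<open>The tangent line of the convex function \<open>\<lambda>a. \<bar>a\<bar> powr p\<close> lies below its graph. After expanding the product this is
  Young's inequality for \<open>\<bar>a\<bar> powr (p - 1)\<close> and \<open>\<bar>b\<bar>\<close> with the conjugate exponents \<open>p / (p - 1)\<close> and \<open>p\<close>.\<close>
lemma powr_tangent:
  assumes "1 < p"
  shows "\<bar>a\<bar> powr p + p * (signed_powr p a * (b - a)) \<le> \<bar>b\<bar> powr p"
proof -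
  define q where "q = p / (p - 1)"
  have q: "1 < q" "1 / q + 1 / p = 1" "(p - 1) * q = p" 
    using assms by (auto simp: q_def field_simps)
  have "signed_powr p a * b \<le> \<bar>a\<bar> powr (p - 1) * \<bar>b\<bar>"
    using abs_ge_self[of "signed_powr p a * b"] by (simp add: abs_mult abs_signed_powr)
  also have "\<dots> \<le> (\<bar>a\<bar> powr (p - 1)) powr q / q + \<bar>b\<bar> powr p / p"
    using Youngs_inequality[of q p "\<bar>a\<bar> powr (p - 1)" "\<bar>b\<bar>"] q assms by simp
  also have "(\<bar>a\<bar> powr (p - 1)) powr q = \<bar>a\<bar> powr p"
    by (simp add: powr_powr q)
  finally have "p * (signed_powr p a * b) \<le> p * (\<bar>a\<bar> powr p / q + \<bar>b\<bar> powr p / p)"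
    using assms by (intro mult_left_mono) auto
  also have "\<dots> = (p - 1) * \<bar>a\<bar> powr p + \<bar>b\<bar> powr p"
    using assms by (simp add: q_def field_simps)
  finally show ?thesis
    using signed_powr_mult_self[of p a] by (simp add: algebra_simps)
qed

text \<open>A crude Young inequality whose free parameter \<open>l\<close> moves the weight to either factor; below it does
  the work of Hoelder's inequality. One term on the right dominates according to whether
  \<open>\<bar>b\<bar> \<le> l * \<bar>a\<bar>\<close>.\<close>
lemma powr_Young_scaled:
  fixes a b :: real
  assumes "1 < p" "0 < l"
  shows "\<bar>a\<bar> powr (p - 1) * \<bar>b\<bar> \<le> l * \<bar>a\<bar> powr p + l powr (1 - p) * \<bar>b\<bar> powr p"
proof (cases "\<bar>b\<bar> \<le> l * \<bar>a\<bar>")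
  case True
  then have "\<bar>a\<bar> powr (p - 1) * \<bar>b\<bar> \<le> \<bar>a\<bar> powr (p - 1) * (l * \<bar>a\<bar>)"
    by (intro mult_left_mono) (auto simp: abs_mult)
  also have "\<dots> = l * \<bar>a\<bar> powr p"
    using signed_powr_mult_self[of p "\<bar>a\<bar>"] signed_powr_eq[of p "\<bar>a\<bar>"]
    by (cases "a = 0") (auto simp: algebra_simps)
  finally show ?thesis by (simp add: add_increasing2)
next
  case False
  then have b: "\<bar>a\<bar> \<le> \<bar>b\<bar> / l" "b \<noteq> 0" using assms by (auto simp: field_simps)
  then have "\<bar>a\<bar> powr (p - 1) * \<bar>b\<bar> \<le> (\<bar>b\<bar> / l) powr (p - 1) * \<bar>b\<bar>"
    using assms by (intro mult_right_mono powr_mono2) auto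
  also have "\<dots> = l powr (1 - p) * (\<bar>b\<bar> powr (p - 1) * \<bar>b\<bar> powr 1)"
    using assms b by (simp add: powr_divide powr_minus_divide[of l "p - 1", symmetric] field_simps)
      (simp add: powr_diff field_simps)
  also have "\<bar>b\<bar> powr (p - 1) * \<bar>b\<bar> powr 1 = \<bar>b\<bar> powr p"
    by (simp only: powr_add[symmetric]) simp
  finally show ?thesis using assms by (simp add: add_increasing)
qed

lemma powr_add_le:
  fixes a b :: real
  assumes "0 < p"
  shows "\<bar>a + b\<bar> powr p \<le> 2 powr p * (\<bar>a\<bar> powr p + \<bar>b\<bar> powr p)"
proof -
  have "\<bar>a + b\<bar> powr p \<le> (2 * max \<bar>a\<bar> \<bar>b\<bar>) powr p"
    using assms by (intro powr_mono2) auto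
  also have "\<dots> = 2 powr p * max \<bar>a\<bar> \<bar>b\<bar> powr p" by (simp add: powr_mult)
  also have "max \<bar>a\<bar> \<bar>b\<bar> powr p \<le> \<bar>a\<bar> powr p + \<bar>b\<bar> powr p"
    by (auto simp: max_def)
  finally show ?thesis by simp
qed

lemma powr_diff_le:
  fixes a b :: real
  assumes "0 < p"
  shows "\<bar>a - b\<bar> powr p \<le> 2 powr p * (\<bar>a\<bar> powr p + \<bar>b\<bar> powr p)"
  using powr_add_le[OF assms, of a "- b"] by simp

text \<open>The defect in midpoint convexity.\<close>
definition midpoint_gap :: "real \<Rightarrow> real \<Rightarrow> real \<Rightarrow> real" where
  "midpoint_gap p a b = (\<bar>a\<bar> powr p + \<bar>b\<bar> powr p) / 2 - \<bar>(a + b) / 2\<bar> powr p"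

lemma midpoint_gap_nonneg:
  assumes "1 < p" shows "0 \<le> midpoint_gap p a b"
proof -
  let ?m = "(a + b) / 2"
  have "\<bar>?m\<bar> powr p + p * (signed_powr p ?m * (a - ?m)) \<le> \<bar>a\<bar> powr p"
    "\<bar>?m\<bar> powr p + p * (signed_powr p ?m * (b - ?m)) \<le> \<bar>b\<bar> powr p"
    by (rule powr_tangent[OF assms(1)])+
  moreover have "p * (signed_powr p ?m * (a - ?m)) + p * (signed_powr p ?m * (b - ?m)) = 0"
    by (simp add: field_simps)
  ultimately show ?thesis by (simp add: midpoint_gap_def)
qed

text \<open>If the tangent at \<open>a\<close> touches the graph at \<open>b\<close>, it is also the tangent at \<open>b\<close>, which compares the
  slope at every point between them with the slope at \<open>a\<close> in the wrong direction for a strictly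
  increasing derivative.\<close>
lemma powr_tangent_eq:
  assumes p: "1 < p" and eq: "\<bar>b\<bar> powr p = \<bar>a\<bar> powr p + p * (signed_powr p a * (b - a))"
  shows "a = b"
proof (rule ccontr)
  assume "a \<noteq> b"
  have *: "0 \<le> p * ((signed_powr p t - signed_powr p a) * (t - b))" for t
    using powr_tangent[OF p, of a t] powr_tangent[OF p, of t b] eq
    by (simp add: algebra_simps)
  let ?t = "(a + b) / 2"
  have "(signed_powr p ?t - signed_powr p a) * (?t - b) < 0"
  proof (cases "a < b")
    case True
    then show ?thesis
      using signed_powr_strict_mono[OF p, of a ?t] by (intro mult_pos_neg) auto
  next
    case False
    then show ?thesis
      using signed_powr_strict_mono[OF p, of ?t a] \<open>a \<noteq> b\<close> by (intro mult_neg_pos) auto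
  qed
  then have "p * ((signed_powr p ?t - signed_powr p a) * (?t - b)) < 0"
    using p by (intro mult_pos_neg[of p]) auto
  then show False using *[of ?t] by linarith
qed

lemma midpoint_gap_eq_0:
  assumes "1 < p" "midpoint_gap p a b = 0" shows "a = b"
proof -
  let ?m = "(a + b) / 2"
  have "\<bar>?m\<bar> powr p + p * (signed_powr p ?m * (a - ?m)) \<le> \<bar>a\<bar> powr p"
    "\<bar>?m\<bar> powr p + p * (signed_powr p ?m * (b - ?m)) \<le> \<bar>b\<bar> powr p"
    by (rule powr_tangent[OF assms(1)])+
  moreover have "p * (signed_powr p ?m * (a - ?m)) + p * (signed_powr p ?m * (b - ?m)) = 0"
    by (simp add: field_simps)
  ultimately have "\<bar>a\<bar> powr p = \<bar>?m\<bar> powr p + p * (signed_powr p ?m * (a - ?m))"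
    using assms by (simp add: midpoint_gap_def)
  then have "?m = a" by (rule powr_tangent_eq[OF assms(1)])
  then show ?thesis by simp
qed

text \<open>Quantitative strict convexity for every \<open>1 < p\<close> at once, which replaces Clarkson's inequalities
  and their case distinction at \<open>p = 2\<close>. Both sides are homogeneous of degree \<open>p\<close>, so it suffices to
  look at \<open>\<bar>a\<bar> powr p + \<bar>b\<bar> powr p = 1\<close>; there the pairs with
  \<open>e \<le> \<bar>a - b\<bar> powr p\<close> form a compact set on which the gap is positive, hence bounded below.\<close>
lemma powr_uniform_convexity:
  assumes p: "1 < p" and e: "0 < e"
  obtains C where "0 \<le> C"
    "\<And>a b. \<bar>a - b\<bar> powr p \<le> e * (\<bar>a\<bar> powr p + \<bar>b\<bar> powr p) + C * midpoint_gap p a b"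
proof -
  define S where "S = {z::real\<times>real. \<bar>fst z\<bar> powr p + \<bar>snd z\<bar> powr p = 1 \<and> e \<le> \<bar>fst z - snd z\<bar> powr p}"
  have cont: "continuous_on A (\<lambda>z. \<bar>g z\<bar> powr p)" if "continuous_on A g"
    for g :: "real\<times>real \<Rightarrow> real" and A
    using p by (intro continuous_on_powr' continuous_intros that) auto
  have "S \<subseteq> {-1..1} \<times> {-1..1}"
  proof
    have le1: "\<bar>x\<bar> \<le> 1" if "\<bar>x\<bar> powr p \<le> 1" for x :: real
    proof (rule ccontr)
      assume "\<not> \<bar>x\<bar> \<le> 1"
      then have "1 powr p < \<bar>x\<bar> powr p" using p by (intro powr_less_mono2) auto
      then show False using that by simp
    qed
    fix z assume "z \<in> S"
    then have "\<bar>fst z\<bar> powr p \<le> 1" "\<bar>snd z\<bar> powr p \<le> 1"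
      unfolding S_def by (smt (verit) mem_Collect_eq powr_ge_zero)+
    then have "\<bar>fst z\<bar> \<le> 1" "\<bar>snd z\<bar> \<le> 1" by (auto intro: le1)
    then show "z \<in> {-1..1} \<times> {-1..1}" by (auto simp: mem_Times_iff abs_le_iff)
  qed
  then have "bounded S"
    by (rule bounded_subset[rotated]) (intro bounded_Times bounded_closed_interval)
  moreover have "closed S"
    unfolding S_def
    by (intro closed_Collect_conj closed_Collect_eq closed_Collect_le
        continuous_intros cont[unfolded o_def])
  ultimately have "compact S" by (simp add: compact_eq_bounded_closed)
  moreover have "continuous_on S (\<lambda>z. midpoint_gap p (fst z) (snd z))"
    unfolding midpoint_gap_def by (intro continuous_intros cont) auto
  moreover have pos: "0 < midpoint_gap p (fst z) (snd z)" if "z \<in> S" for z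
    using midpoint_gap_eq_0[OF p, of "fst z" "snd z"] midpoint_gap_nonneg[OF p, of "fst z" "snd z"]
      that e by (force simp: S_def less_le)
  ultimately obtain d where d: "0 < d" "\<And>z. z \<in> S \<Longrightarrow> d \<le> midpoint_gap p (fst z) (snd z)"
  proof (cases "S = {}")
    case False
    then obtain z where z: "z \<in> S" "\<forall>y\<in>S. midpoint_gap p (fst z) (snd z) \<le> midpoint_gap p (fst y) (snd y)"
      using continuous_attains_inf[OF \<open>compact S\<close> False \<open>continuous_on S _\<close>] by auto
    then show ?thesis using that[of "midpoint_gap p (fst z) (snd z)"] pos[of z] by auto
  qed (auto intro: that[of 1])
  show thesis
  proof (rule that[of "2 powr p / d"])
    show "0 \<le> 2 powr p / d" using d by simp
    fix a b :: real
    define w where "w = \<bar>a\<bar> powr p + \<bar>b\<bar> powr p"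
    define t where "t = w powr (1 / p)"
    show "\<bar>a - b\<bar> powr p \<le> e * (\<bar>a\<bar> powr p + \<bar>b\<bar> powr p) + 2 powr p / d * midpoint_gap p a b"
    proof (cases "\<bar>a - b\<bar> powr p \<le> e * w")
      case True
      then show ?thesis
        using midpoint_gap_nonneg[OF p, of a b] d by (simp add: w_def add_increasing2)
    next
      case False
      have "w \<noteq> 0"
      proof
        assume "w = 0"
        then have "\<bar>a\<bar> powr p = 0 \<and> \<bar>b\<bar> powr p = 0"
          unfolding w_def by (smt (verit) powr_ge_zero)
        then show False using False \<open>w = 0\<close> by simp
      qed
      then have w: "0 < w" by (simp add: w_def less_le)
      then have t: "0 < t" "t powr p = w" using p by (auto simp: t_def powr_powr)
      have scale: "\<bar>x / t\<bar> powr p = \<bar>x\<bar> powr p / w" for x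
        using t by (simp add: powr_divide)
      have "\<bar>a / t\<bar> powr p + \<bar>b / t\<bar> powr p = 1"
        unfolding scale using w by (simp add: w_def add_divide_distrib[symmetric])
      moreover have "e \<le> \<bar>a / t - b / t\<bar> powr p"
        unfolding diff_divide_distrib[symmetric] scale using False w by (simp add: field_simps)
      ultimately have "(a / t, b / t) \<in> S" by (simp add: S_def)
      then have "d \<le> midpoint_gap p (a / t) (b / t)" using d by force
      also have "\<dots> = midpoint_gap p a b / w"
      proof -
        have "(a / t + b / t) / 2 = ((a + b) / 2) / t" by (simp add: add_divide_distrib)
        then show ?thesis
          by (simp only: midpoint_gap_def scale)
            (simp only: diff_divide_distrib add_divide_distrib divide_divide_eq_left mult.commute)
      qed
      finally have "d * w \<le> midpoint_gap p a b" using w by (simp add: field_simps)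
      moreover have "\<bar>a - b\<bar> powr p \<le> 2 powr p / d * (d * w)"
        using powr_diff_le[of p a b] p d by (simp add: w_def)
      moreover have "2 powr p / d * (d * w) \<le> 2 powr p / d * midpoint_gap p a b"
        using \<open>d * w \<le> _\<close> d by (intro mult_left_mono) auto
      ultimately show ?thesis using e w by (simp add: w_def add_increasing)
    qed
  qed
qed

section \<open>Lebesgue measure on pairs\<close>

lemma borel_measurable_fst [measurable]: "fst \<in> borel_measurable borel"
  and borel_measurable_snd [measurable]: "snd \<in> borel_measurable borel"
  by (intro borel_measurable_continuous_onI continuous_intros)+

text \<open>Lebesgue measurable functions may be composed with maps under which preimages of null sets are
  null. This is applied to the projections, to the difference and to the swap of a pair.\<close>
lemma lebesgue_null_preimage:
  fixes T :: "'b::euclidean_space \<Rightarrow> 'c::euclidean_space"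
  assumes T: "T \<in> borel_measurable borel"
    and null: "\<And>N. N \<in> null_sets lborel \<Longrightarrow> AE z in lborel. T z \<notin> N"
  shows "T \<in> lebesgue \<rightarrow>\<^sub>M lebesgue"
    and "(AE x in lebesgue. P x) \<Longrightarrow> (AE z in lebesgue. P (T z))"
proof -
  show "T \<in> lebesgue \<rightarrow>\<^sub>M lebesgue"
  proof (rule completion.measurable_completion2)
    show "T \<in> lebesgue \<rightarrow>\<^sub>M lborel" using T by (intro measurable_completion) simp
    show "null_sets lborel \<subseteq> null_sets (distr lebesgue lborel T)"
    proof
      fix N :: "'c set" assume N: "N \<in> null_sets lborel"
      then have [measurable]: "N \<in> sets borel" by auto
      have "AE z in lebesgue. T z \<notin> N" using null[OF N] by (rule AE_completion)
      then have "AE x in distr lebesgue lborel T. x \<notin> N"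
        using \<open>T \<in> lebesgue \<rightarrow>\<^sub>M lborel\<close> by (subst AE_distr_iff) auto
      then show "N \<in> null_sets (distr lebesgue lborel T)"
        using N by (subst AE_iff_null_sets) auto
    qed
  qed
  assume "AE x in lebesgue. P x"
  then have "AE x in lborel. P x" by (simp add: AE_completion_iff)
  then obtain N where "N \<in> null_sets lborel" "{x. \<not> P x} \<subseteq> N"
    unfolding eventually_ae_filter by auto
  then show "AE z in lebesgue. P (T z)"
    using AE_completion[OF null[of N]] by (auto elim!: eventually_mono)
qed

lemma AE_lborel_pairI:
  fixes P :: "'a::euclidean_space \<times> 'b::euclidean_space \<Rightarrow> bool"
  assumes P: "Measurable.pred borel P" and ae: "\<And>x. AE y in lborel. P (x, y)"
  shows "AE z in lborel. P z"
proof -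
  have "{z \<in> space (lborel \<Otimes>\<^sub>M lborel). P z} \<in> sets (lborel \<Otimes>\<^sub>M lborel)"
    using P by (simp only: lborel_prod) (simp add: pred_def)
  then have "AE z in lborel \<Otimes>\<^sub>M lborel. P z"
    by (rule lborel_pair.AE_pair_measure) (simp add: ae)
  then show ?thesis unfolding lborel_prod .
qed

lemma AE_lborel_pairI':
  fixes P :: "'a::euclidean_space \<times> 'b::euclidean_space \<Rightarrow> bool"
  assumes P: "Measurable.pred borel P" and ae: "\<And>y. AE x in lborel. P (x, y)"
  shows "AE z in lborel. P z"
proof -
  have P': "{z \<in> space (lborel \<Otimes>\<^sub>M lborel). P z} \<in> sets (lborel \<Otimes>\<^sub>M lborel)"
    using P by (simp only: lborel_prod) (simp add: pred_def)
  have "AE x in lborel. AE y in lborel. P (x, y)"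
    using P' ae by (subst lborel_pair.AE_commute) (auto simp: split_beta')
  then have "AE z in lborel \<Otimes>\<^sub>M lborel. P z"
    using P' by (intro lborel_pair.AE_pair_measure)
  then show ?thesis unfolding lborel_prod .
qed

lemma AE_fst_notin_null:
  assumes "N \<in> null_sets lborel"
  shows "AE z in lborel. fst (z :: 'a::euclidean_space \<times> 'b::euclidean_space) \<notin> N"
proof (rule AE_lborel_pairI')
  have [measurable]: "N \<in> sets borel" using assms by auto
  show "Measurable.pred borel (\<lambda>z :: 'a \<times> 'b. fst z \<notin> N)" by measurable
qed (use AE_not_in[OF assms] in auto)

lemma AE_snd_notin_null:
  assumes "N \<in> null_sets lborel"
  shows "AE z in lborel. snd (z :: 'a::euclidean_space \<times> 'b::euclidean_space) \<notin> N"
proof (rule AE_lborel_pairI)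
  have [measurable]: "N \<in> sets borel" using assms by auto
  show "Measurable.pred borel (\<lambda>z :: 'a \<times> 'b. snd z \<notin> N)" by measurable
qed (use AE_not_in[OF assms] in auto)

lemma AE_lborel_translate:
  fixes N :: "'a::euclidean_space set"
  assumes "N \<in> null_sets lborel"
  shows "AE x in lborel. x - y \<notin> N"
proof -
  have [measurable]: "N \<in> sets borel" using assms by auto
  have "AE x in distr lborel borel ((+) (- y)). x \<notin> N"
    using assms by (subst lborel_distr_plus) (rule AE_not_in)
  then show ?thesis by (subst (asm) AE_distr_iff) auto
qed

lemma AE_diff_notin_null:
  assumes "N \<in> null_sets lborel"
  shows "AE z in lborel. fst z - snd (z :: 'a::euclidean_space \<times> 'a) \<notin> N"
proof (rule AE_lborel_pairI')
  have [measurable]: "N \<in> sets borel" using assms by auto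
  show "Measurable.pred borel (\<lambda>z :: 'a \<times> 'a. fst z - snd z \<notin> N)" by measurable
qed (use AE_lborel_translate[OF assms] in auto)

lemma measurable_fst_lebesgue [measurable]:
  "(fst :: 'a::euclidean_space \<times> 'b::euclidean_space \<Rightarrow> _) \<in> lebesgue \<rightarrow>\<^sub>M lebesgue"
  by (rule lebesgue_null_preimage(1)) (measurable, rule AE_fst_notin_null)

lemma AE_fst:
  "AE x in lebesgue. P x \<Longrightarrow> AE z in lebesgue. P (fst (z :: 'a::euclidean_space \<times> 'b::euclidean_space))"
  by (rule lebesgue_null_preimage(2)) (measurable, rule AE_fst_notin_null)

lemma measurable_snd_lebesgue [measurable]:
  "(snd :: 'a::euclidean_space \<times> 'b::euclidean_space \<Rightarrow> _) \<in> lebesgue \<rightarrow>\<^sub>M lebesgue"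
  by (rule lebesgue_null_preimage(1)) (measurable, rule AE_snd_notin_null)

lemma AE_snd:
  "AE x in lebesgue. P x \<Longrightarrow> AE z in lebesgue. P (snd (z :: 'a::euclidean_space \<times> 'b::euclidean_space))"
  by (rule lebesgue_null_preimage(2)) (measurable, rule AE_snd_notin_null)

lemma measurable_diff_lebesgue [measurable]:
  "(\<lambda>z :: 'a::euclidean_space \<times> 'a. fst z - snd z) \<in> lebesgue \<rightarrow>\<^sub>M lebesgue"
  by (rule lebesgue_null_preimage(1)) (measurable, rule AE_diff_notin_null)

lemma AE_diff:
  "AE x in lebesgue. P x \<Longrightarrow> AE z in lebesgue. P (fst z - snd (z :: 'a::euclidean_space \<times> 'a))"
  by (rule lebesgue_null_preimage(2)) (measurable, rule AE_diff_notin_null)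

text \<open>Tonelli's theorem. The completed measure on pairs is not a product measure, so integrands are first
  replaced by Borel versions.\<close>
lemma nn_integral_lebesgue_pair:
  fixes F :: "'a::euclidean_space \<times> 'b::euclidean_space \<Rightarrow> ennreal"
  assumes "F \<in> borel_measurable borel"
  shows "(\<integral>\<^sup>+ z. F z \<partial>lebesgue) = (\<integral>\<^sup>+ x. \<integral>\<^sup>+ y. F (x, y) \<partial>lborel \<partial>lborel)"
    and "(\<integral>\<^sup>+ z. F z \<partial>lebesgue) = (\<integral>\<^sup>+ y. \<integral>\<^sup>+ x. F (x, y) \<partial>lborel \<partial>lborel)"
proof -
  have F: "F \<in> borel_measurable (lborel \<Otimes>\<^sub>M lborel)" using assms by (simp add: lborel_prod)
  show "(\<integral>\<^sup>+ z. F z \<partial>lebesgue) = (\<integral>\<^sup>+ x. \<integral>\<^sup>+ y. F (x, y) \<partial>lborel \<partial>lborel)"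
    using lborel.nn_integral_fst[OF F] by (simp add: nn_integral_completion lborel_prod)
  show "(\<integral>\<^sup>+ z. F z \<partial>lebesgue) = (\<integral>\<^sup>+ y. \<integral>\<^sup>+ x. F (x, y) \<partial>lborel \<partial>lborel)"
    using lborel_pair.nn_integral_snd[OF F] by (simp add: nn_integral_completion lborel_prod)
qed

lemma nn_integral_lebesgue_tensor:
  fixes f :: "'a::euclidean_space \<Rightarrow> ennreal" and g :: "'b::euclidean_space \<Rightarrow> ennreal"
  assumes "f \<in> borel_measurable lebesgue" "g \<in> borel_measurable lebesgue"
  shows "(\<integral>\<^sup>+z. f (fst z) * g (snd z) \<partial>lebesgue) = (\<integral>\<^sup>+x. f x \<partial>lebesgue) * (\<integral>\<^sup>+y. g y \<partial>lebesgue)"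
proof -
  obtain f' g' where [measurable]: "f' \<in> borel_measurable borel" "g' \<in> borel_measurable borel"
    and ae: "AE x in lborel. f x = f' x" "AE x in lborel. g x = g' x"
    using assms[THEN completion_ex_borel_measurable] by auto
  have "(\<integral>\<^sup>+z. f (fst z) * g (snd z) \<partial>lebesgue) = (\<integral>\<^sup>+z. f' (fst z) * g' (snd z) \<partial>lebesgue)"
    by (rule nn_integral_cong_AE)
      (use AE_fst[OF AE_completion[OF ae(1)]] AE_snd[OF AE_completion[OF ae(2)]] in eventually_elim, simp)
  also have "\<dots> = (\<integral>\<^sup>+x. f' x \<partial>lborel) * (\<integral>\<^sup>+y. g' y \<partial>lborel)"
    by (simp add: nn_integral_lebesgue_pair(1) nn_integral_cmult nn_integral_multc)
  also have "\<dots> = (\<integral>\<^sup>+x. f x \<partial>lebesgue) * (\<integral>\<^sup>+y. g y \<partial>lebesgue)"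
    using ae by (simp add: nn_integral_completion cong: nn_integral_cong_AE)
  finally show ?thesis .
qed

lemma nn_integral_lebesgue_convolution:
  fixes f g :: "'a::euclidean_space \<Rightarrow> ennreal"
  assumes "f \<in> borel_measurable lebesgue" "g \<in> borel_measurable lebesgue"
  shows "(\<integral>\<^sup>+z. g (fst z - snd z) * f (snd z) \<partial>lebesgue) = (\<integral>\<^sup>+x. g x \<partial>lebesgue) * (\<integral>\<^sup>+y. f y \<partial>lebesgue)"
proof -
  obtain f' g' where [measurable]: "f' \<in> borel_measurable borel" "g' \<in> borel_measurable borel"
    and ae: "AE x in lborel. f x = f' x" "AE x in lborel. g x = g' x"
    using assms[THEN completion_ex_borel_measurable] by auto
  have shift: "(\<integral>\<^sup>+x. g' (x - y) \<partial>lborel) = (\<integral>\<^sup>+x. g' x \<partial>lborel)" for y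
  proof -
    have "(\<integral>\<^sup>+x. g' x \<partial>lborel) = (\<integral>\<^sup>+x. g' x \<partial>distr lborel borel ((+) (- y)))"
      by (simp only: lborel_distr_plus)
    also have "\<dots> = (\<integral>\<^sup>+x. g' (x - y) \<partial>lborel)" by (subst nn_integral_distr) auto
    finally show ?thesis ..
  qed
  have "(\<integral>\<^sup>+z. g (fst z - snd z) * f (snd z) \<partial>lebesgue) = (\<integral>\<^sup>+z. g' (fst z - snd z) * f' (snd z) \<partial>lebesgue)"
    by (rule nn_integral_cong_AE)
      (use AE_diff[OF AE_completion[OF ae(2)]] AE_snd[OF AE_completion[OF ae(1)]] in eventually_elim, simp)
  also have "\<dots> = (\<integral>\<^sup>+x. g' x \<partial>lborel) * (\<integral>\<^sup>+y. f' y \<partial>lborel)"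
    by (simp add: nn_integral_lebesgue_pair(2) nn_integral_cmult nn_integral_multc shift)
  also have "\<dots> = (\<integral>\<^sup>+x. g x \<partial>lebesgue) * (\<integral>\<^sup>+y. f y \<partial>lebesgue)"
    using ae by (simp add: nn_integral_completion cong: nn_integral_cong_AE)
  finally show ?thesis .
qed

section \<open>Weak-star compactness of the coefficients\<close>

lemma AE_le_0_if_set_integrals_le_0:
  fixes g :: "'b \<Rightarrow> real"
  assumes g: "integrable M g" and le: "\<And>A. A \<in> sets M \<Longrightarrow> (\<integral>x. indicator A x * g x \<partial>M) \<le> 0"
  shows "AE x in M. g x \<le> 0"
proof -
  define A where "A = {x \<in> space M. 0 < g x}"
  have [measurable]: "A \<in> sets M" using g unfolding A_def by measurable
  have int: "integrable M (\<lambda>x. indicator A x * g x)"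
    using integrable_mult_indicator[OF \<open>A \<in> sets M\<close> g] by simp
  have nn: "AE x in M. 0 \<le> indicator A x * g x" by (auto simp: A_def indicator_def)
  then have "(\<integral>x. indicator A x * g x \<partial>M) = 0"
    using le[of A] by (intro antisym integral_nonneg_AE) auto
  then have "AE x in M. indicator A x * g x = 0"
    using integral_nonneg_eq_0_iff_AE[OF int nn] by simp
  moreover have "AE x in M. x \<in> space M" by simp
  ultimately show ?thesis
    by eventually_elim (force simp: A_def indicator_def split: if_splits)
qed

text \<open>A diagonal argument gives a subsequence along which the integrals over the sets of the countable
  generator converge. The densities have a common bound \<open>b\<close>, so Tannery's theorem passes countable
  disjoint unions to the limit; hence the integrals converge over every measurable set, the limit is
  a measure with values between \<open>a\<close> and \<open>b\<close> times \<open>M\<close>, and the Radon-Nikodym theorem gives its density.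
  Indicators suffice, because all functionals involved are equicontinuous on integrable functions.\<close>
lemma weak_star_compact_finite_measure:
  fixes M :: "'b measure" and hs :: "nat \<Rightarrow> 'b \<Rightarrow> real"
  assumes "finite_measure M"
    and G: "countable G" "Int_stable G" "G \<subseteq> Pow (space M)" "sets M = sigma_sets (space M) G"
    and hs: "\<And>j. hs j \<in> borel_measurable M" "\<And>j x. hs j x \<in> {a..b}" and a: "0 \<le> a"
  obtains r h where "strict_mono (r :: nat \<Rightarrow> nat)" "h \<in> borel_measurable M"
    "AE x in M. h x \<in> {a..b}" "weak_star_Linf M (\<lambda>j. hs (r j)) h"
proof -
  interpret finite_measure M by fact
  note hs(1)[measurable]
  have ab: "a \<le> b" using hs(2)[of 0 undefined] by simp
  have hs_abs: "\<bar>hs j x\<bar> \<le> b" for j x using hs(2)[of j x] a by auto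
  have int_mult: "integrable M (\<lambda>x. hs j x * g x)" if "integrable M g" for j and g :: "'b \<Rightarrow> real"
    by (rule Bochner_Integration.integrable_bound[OF integrable_mult_right[OF that, of b]])
      (use that hs_abs a ab in \<open>auto simp: abs_mult intro!: AE_I2 mult_mono\<close>)
  have int_mult_le: "\<bar>\<integral>x. hs j x * g x \<partial>M\<bar> \<le> b * (\<integral>x. \<bar>g x\<bar> \<partial>M)"
    if "integrable M g" for j and g :: "'b \<Rightarrow> real"
  proof -
    have "\<bar>\<integral>x. hs j x * g x \<partial>M\<bar> \<le> (\<integral>x. \<bar>hs j x * g x\<bar> \<partial>M)"
      by (rule integral_abs_bound)
    also have "\<dots> \<le> (\<integral>x. b * \<bar>g x\<bar> \<partial>M)"
      using integrable_abs[OF int_mult[OF that]] that hs_abs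
      by (intro integral_mono) (auto simp: abs_mult intro!: mult_right_mono)
    finally show ?thesis by simp
  qed
  define I where "I j A = (\<integral>x. hs j x * indicator A x \<partial>M)" for j A
  have ind: "integrable M (indicator A :: 'b \<Rightarrow> real)" if "A \<in> sets M" for A
    using that by (simp add: less_top[symmetric])
  have I_bounds: "a * measure M A \<le> I j A" "I j A \<le> b * measure M A" if "A \<in> sets M" for j A
  proof -
    have "(\<integral>x. a * indicator A x \<partial>M) \<le> I j A" "I j A \<le> (\<integral>x. b * indicator A x \<partial>M)"
      unfolding I_def using hs(2) ind[OF that] int_mult[OF ind[OF that]]
      by (intro integral_mono; force intro: mult_right_mono)+
    then show "a * measure M A \<le> I j A" "I j A \<le> b * measure M A" using that by auto
  qed
  have I_abs: "\<bar>I j A\<bar> \<le> b * measure M A" if "A \<in> sets M" for j A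
    using I_bounds[OF that, of j] a by (smt (verit) measure_nonneg mult_nonneg_nonneg)
  obtain r :: "nat \<Rightarrow> nat" where r: "strict_mono r"
    and conv: "\<And>A. A \<in> insert (space M) G \<Longrightarrow> \<exists>l. (\<lambda>n. I (r n) A) \<longlonglongrightarrow> l"
  proof (rule function_convergent_subsequence[of "insert (space M) G" I "b * measure M (space M)"])
    show "countable (insert (space M) G)" using G by simp
    fix n A assume "A \<in> insert (space M) G"
    then have "A \<in> sets M" using G(4) by (auto intro: sigma_sets.Basic)
    have "\<bar>I n A\<bar> \<le> b * measure M A" by (rule I_abs) fact
    also have "\<dots> \<le> b * measure M (space M)"
      using a ab \<open>A \<in> sets M\<close> by (intro mult_left_mono bounded_measure) auto
    finally show "norm (I n A) \<le> b * measure M (space M)" by simp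
  qed auto
  have I_Union: "(\<lambda>i. I j (A i)) sums I j (\<Union>i. A i)"
    if "disjoint_family A" "range A \<subseteq> sets M" for j and A :: "nat \<Rightarrow> 'b set"
  proof -
    have A: "A i \<in> sets M" for i using that by auto
    define N where "N = density M (\<lambda>x. ennreal (hs j x))"
    have N_eq: "emeasure N B = ennreal (I j B)" if "B \<in> sets M" for B
    proof -
      have "emeasure N B = (\<integral>\<^sup>+x. ennreal (hs j x * indicator B x) \<partial>M)"
        unfolding N_def using that
        by (subst emeasure_density) (auto intro!: nn_integral_cong simp: indicator_def)
      also have "\<dots> = ennreal (I j B)"
        unfolding I_def using int_mult[OF ind[OF that]] hs(2)[of j] a
        by (intro nn_integral_eq_integral) (auto simp: indicator_def intro!: AE_I2 order_trans[OF a])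
      finally show ?thesis .
    qed
    have "0 \<le> I j B" if "B \<in> sets M" for B
      using I_bounds(1)[OF that, of j] a by (meson measure_nonneg mult_nonneg_nonneg order_trans)
    then have "I j B = measure N B" if "B \<in> sets M" for B
      using that by (simp add: measure_def N_eq)
    moreover have "emeasure N (\<Union>i. A i) \<noteq> \<infinity>" using A by (subst N_eq) auto
    moreover have "(\<lambda>i. measure N (A i)) sums measure N (\<Union>i. A i)"
      using that \<open>emeasure N _ \<noteq> \<infinity>\<close> by (intro measure_UNION) (auto simp: N_def)
    moreover have "(\<Union>i. A i) \<in> sets M" using A by auto
    ultimately show ?thesis using A by simp
  qed
  have lim_Union: "(\<lambda>j. I (r j) (\<Union>i. A i)) \<longlonglongrightarrow> (\<Sum>i. l i)" "summable l"
    if A: "disjoint_family A" "range A \<subseteq> sets M" and l: "\<And>i. (\<lambda>j. I (r j) (A i)) \<longlonglongrightarrow> l i" for A l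
  proof -
    have meas: "A i \<in> sets M" for i using A by auto
    have "(\<lambda>i. measure M (A i)) sums measure M (\<Union>i. A i)"
      using A by (intro measure_UNION) auto
    then have sm: "summable (\<lambda>i. b * measure M (A i))"
      by (intro summable_mult) (auto simp: sums_iff)
    have ev: "eventually (\<lambda>(k, n). norm (I (r n) (A k)) \<le> b * measure M (A k)) (at_top \<times>\<^sub>F sequentially)"
      using I_abs meas by (intro always_eventually) auto
    have *: "summable (\<lambda>i. norm (l i)) \<and> (\<lambda>j. \<Sum>i. I (r j) (A i)) \<longlonglongrightarrow> (\<Sum>i. l i)"
      using tannerys_theorem[of "\<lambda>k n. I (r n) (A k)" l sequentially, OF l ev sm] by simp
    then show "summable l" using summable_norm_cancel by blast
    show "(\<lambda>j. I (r j) (\<Union>i. A i)) \<longlonglongrightarrow> (\<Sum>i. l i)"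
      using * I_Union[OF A] by (simp add: sums_iff)
  qed
  have I_compl: "I j (space M - A) = I j (space M) - I j A" if A: "A \<in> sets M" for j A
  proof -
    have "I j (space M) - I j A = (\<integral>x. hs j x * indicator (space M) x - hs j x * indicator A x \<partial>M)"
      unfolding I_def by (subst Bochner_Integration.integral_diff) (use A int_mult ind in auto)
    also have "\<dots> = I j (space M - A)"
      unfolding I_def by (intro Bochner_Integration.integral_cong) (auto simp: indicator_def)
    finally show ?thesis ..
  qed
  have conv_all: "\<exists>l. (\<lambda>n. I (r n) A) \<longlonglongrightarrow> l" if "A \<in> sets M" for A
    using that unfolding G(4)
  proof (induction rule: sigma_sets_induct_disjoint[OF G(2,3), consumes 1, case_names basic empty compl union])
    case (basic A) then show ?case using conv by auto
  next
    case empty then show ?case by (auto simp: I_def intro: exI[of _ 0])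
  next
    case (compl A)
    then obtain l l' where "(\<lambda>n. I (r n) A) \<longlonglongrightarrow> l" "(\<lambda>n. I (r n) (space M)) \<longlonglongrightarrow> l'"
      using conv[of "space M"] by auto
    moreover have "A \<in> sets M" using compl G(4) by simp
    ultimately show ?case
      by (intro exI[of _ "l' - l"]) (simp add: I_compl tendsto_diff)
  next
    case (union A)
    then obtain l where "\<And>i. (\<lambda>n. I (r n) (A i)) \<longlonglongrightarrow> l i" by metis
    then show ?case using lim_Union(1)[of A l] union G(4) by auto
  qed
  define \<nu> where "\<nu> A = lim (\<lambda>n. I (r n) A)" for A
  have \<nu>: "(\<lambda>n. I (r n) A) \<longlonglongrightarrow> \<nu> A" if "A \<in> sets M" for A
    using conv_all[OF that] unfolding \<nu>_def by (auto simp: limI)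
  have \<nu>_bounds: "a * measure M A \<le> \<nu> A" "\<nu> A \<le> b * measure M A" if "A \<in> sets M" for A
    using I_bounds[OF that] \<nu>[OF that] by (auto intro: LIMSEQ_le_const LIMSEQ_le_const2)
  have \<nu>_nonneg: "0 \<le> \<nu> A" if "A \<in> sets M" for A
    using \<nu>_bounds(1)[OF that] a by (meson measure_nonneg mult_nonneg_nonneg order_trans)
  define N where "N = measure_of (space M) (sets M) (\<lambda>A. ennreal (\<nu> A))"
  have N: "emeasure N A = ennreal (\<nu> A)" if "A \<in> sets M" for A
    unfolding N_def
  proof (rule emeasure_measure_of_sigma)
    show "sigma_algebra (space M) (sets M)" by (rule sets.sigma_algebra_axioms)
    show "positive (sets M) (\<lambda>A. ennreal (\<nu> A))"
      using \<nu>_bounds(2)[of "{}"] by (auto simp: positive_def ennreal_neg)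
    show "countably_additive (sets M) (\<lambda>A. ennreal (\<nu> A))"
      unfolding countably_additive_def
    proof (intro allI impI)
      fix A :: "nat \<Rightarrow> 'b set" assume A: "range A \<subseteq> sets M" "disjoint_family A" "(\<Union>i. A i) \<in> sets M"
      then have *: "(\<lambda>j. I (r j) (\<Union>i. A i)) \<longlonglongrightarrow> (\<Sum>i. \<nu> (A i))" "summable (\<lambda>i. \<nu> (A i))"
        using lim_Union[of A "\<lambda>i. \<nu> (A i)"] \<nu> by auto
      then have "\<nu> (\<Union>i. A i) = (\<Sum>i. \<nu> (A i))" using \<nu>[OF A(3)] LIMSEQ_unique by blast
      then show "(\<Sum>i. ennreal (\<nu> (A i))) = ennreal (\<nu> (\<Union>i. A i))"
        using A \<nu>_nonneg * by (simp add: suminf_ennreal2 image_subset_iff)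
    qed
  qed fact
  have "absolutely_continuous M N"
    unfolding absolutely_continuous_def
  proof
    fix A assume "A \<in> null_sets M"
    then have A: "A \<in> sets M" "measure M A = 0" by (auto simp: measure_def)
    then have "\<nu> A = 0" using \<nu>_bounds[OF A(1)] by simp
    then show "A \<in> null_sets N" using A N[of A] by (auto simp: null_sets_def N_def)
  qed
  then obtain f where f: "f \<in> borel_measurable M" "density M f = N"
    using Radon_Nikodym[of N] by (auto simp: N_def)
  define h where "h x = enn2real (f x)" for x
  have h[measurable]: "h \<in> borel_measurable M" using f(1) unfolding h_def[abs_def] by measurable
  have N_f: "(\<integral>\<^sup>+x. f x * indicator A x \<partial>M) = ennreal (\<nu> A)" if "A \<in> sets M" for A
    using emeasure_density[OF f(1) that] f(2) N[OF that] by simp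
  have "(\<integral>\<^sup>+x. f x \<partial>M) = ennreal (\<nu> (space M))"
    using N_f[of "space M"] by (simp cong: nn_integral_cong)
  then have "AE x in M. f x \<noteq> \<infinity>" using f(1) by (intro nn_integral_PInf_AE) auto
  then have fh: "AE x in M. f x = ennreal (h x)"
    by eventually_elim (simp add: h_def less_top)
  have h_ind: "integrable M (\<lambda>x. h x * indicator A x)" "(\<integral>x. h x * indicator A x \<partial>M) = \<nu> A"
    if "A \<in> sets M" for A
  proof -
    have "(\<integral>\<^sup>+x. ennreal (h x * indicator A x) \<partial>M) = (\<integral>\<^sup>+x. f x * indicator A x \<partial>M)"
      by (rule nn_integral_cong_AE) (use fh in eventually_elim, auto simp: indicator_def)
    also have "\<dots> = ennreal (\<nu> A)" by (rule N_f[OF that])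
    finally have *: "(\<integral>\<^sup>+x. ennreal (h x * indicator A x) \<partial>M) = ennreal (\<nu> A)" .
    have **: "0 \<le> h x * indicator A x" for x by (simp add: h_def)
    show "integrable M (\<lambda>x. h x * indicator A x)"
      using * ** that by (intro integrableI_nonneg) auto
    show "(\<integral>x. h x * indicator A x \<partial>M) = \<nu> A"
      using * ** that \<nu>_nonneg[OF that] by (subst integral_eq_nn_integral) auto
  qed
  have h_int: "integrable M h"
    using h_ind(1)[of "space M"] by (simp cong: Bochner_Integration.integrable_cong)
  have "AE x in M. h x - b \<le> 0"
  proof (rule AE_le_0_if_set_integrals_le_0)
    show "(\<integral>x. indicator A x * (h x - b) \<partial>M) \<le> 0" if A: "A \<in> sets M" for A
    proof -
      have "(\<integral>x. indicator A x * (h x - b) \<partial>M) = (\<integral>x. h x * indicator A x - b * indicator A x \<partial>M)"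
        by (simp add: algebra_simps)
      also have "\<dots> = \<nu> A - b * measure M A"
        using h_ind[OF A] A by (subst Bochner_Integration.integral_diff) (auto intro!: ind)
      finally show ?thesis using \<nu>_bounds(2)[OF A] by simp
    qed
  qed (use h_int in auto)
  moreover have "AE x in M. a - h x \<le> 0"
  proof (rule AE_le_0_if_set_integrals_le_0)
    show "(\<integral>x. indicator A x * (a - h x) \<partial>M) \<le> 0" if A: "A \<in> sets M" for A
    proof -
      have "(\<integral>x. indicator A x * (a - h x) \<partial>M) = (\<integral>x. a * indicator A x - h x * indicator A x \<partial>M)"
        by (simp add: algebra_simps)
      also have "\<dots> = a * measure M A - \<nu> A"
        using h_ind[OF A] A by (subst Bochner_Integration.integral_diff) (auto intro!: ind)
      finally show ?thesis using \<nu>_bounds(1)[OF A] by simp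
    qed
  qed (use h_int in auto)
  ultimately have h_ab: "AE x in M. h x \<in> {a..b}" by eventually_elim auto
  from h_ab have h_abs: "AE x in M. \<bar>h x\<bar> \<le> b" by eventually_elim (use a in auto)
  have int_h_mult: "integrable M (\<lambda>x. h x * g x)" if "integrable M g" for g :: "'b \<Rightarrow> real"
    by (rule Bochner_Integration.integrable_bound[OF integrable_mult_right[OF that, of b]])
      (use that h_abs a ab in \<open>auto simp: abs_mult intro!: mult_mono elim!: eventually_mono\<close>)
  have h_mult_le: "\<bar>\<integral>x. h x * g x \<partial>M\<bar> \<le> b * (\<integral>x. \<bar>g x\<bar> \<partial>M)"
    if "integrable M g" for g :: "'b \<Rightarrow> real"
  proof -
    have "\<bar>\<integral>x. h x * g x \<partial>M\<bar> \<le> (\<integral>x. \<bar>h x * g x\<bar> \<partial>M)"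
      by (rule integral_abs_bound)
    also have "\<dots> \<le> (\<integral>x. b * \<bar>g x\<bar> \<partial>M)"
      using integrable_abs[OF int_h_mult[OF that]] that h_abs
      by (intro integral_mono_AE) (auto simp: abs_mult intro!: mult_right_mono elim!: eventually_mono)
    finally show ?thesis by simp
  qed
  have "(\<lambda>j. \<integral>x. hs (r j) x * g x \<partial>M) \<longlonglongrightarrow> (\<integral>x. h x * g x \<partial>M)" if "integrable M g" for g
    using that
  proof (induction rule: integrable_induct)
    case (base A c)
    have "(\<lambda>j. I (r j) A * c) \<longlonglongrightarrow> \<nu> A * c" by (intro tendsto_intros \<nu> base)
    then show ?case using h_ind[OF base(1)] base(1) unfolding I_def
      by (simp add: mult.assoc[symmetric])
  next
    case (add f g)
    then show ?case
      by (simp add: distrib_left int_mult int_h_mult Bochner_Integration.integral_add tendsto_add)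
  next
    case (lim g s)
    have "(\<lambda>i. \<integral>x. \<bar>s i x - g x\<bar> \<partial>M) \<longlonglongrightarrow> (\<integral>x. 0 \<partial>M)"
    proof (rule integral_dominated_convergence[where w = "\<lambda>x. 3 * \<bar>g x\<bar>"])
      show "AE x in M. (\<lambda>i. \<bar>s i x - g x\<bar>) \<longlonglongrightarrow> 0"
      proof (rule AE_I2)
        fix x assume "x \<in> space M"
        then have "(\<lambda>i. \<bar>s i x - g x\<bar>) \<longlonglongrightarrow> \<bar>g x - g x\<bar>"
          using lim by (intro tendsto_intros) auto
        then show "(\<lambda>i. \<bar>s i x - g x\<bar>) \<longlonglongrightarrow> 0" by simp
      qed
      show "AE x in M. norm \<bar>s i x - g x\<bar> \<le> 3 * \<bar>g x\<bar>" for i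
        using lim.hyps(3) by (intro AE_I2) (smt (verit) real_norm_def)
    qed (use lim in auto)
    then have lim0: "(\<lambda>i. \<integral>x. \<bar>s i x - g x\<bar> \<partial>M) \<longlonglongrightarrow> 0" by simp
    show ?case
    proof (rule LIMSEQ_I)
      fix e :: real assume e: "0 < e"
      have "(\<lambda>i. b * (\<integral>x. \<bar>s i x - g x\<bar> \<partial>M)) \<longlonglongrightarrow> b * 0"
        by (intro tendsto_intros lim0)
      then have "eventually (\<lambda>i. b * (\<integral>x. \<bar>s i x - g x\<bar> \<partial>M) < e / 3) sequentially"
        using e by (intro order_tendstoD) auto
      then obtain i where i: "b * (\<integral>x. \<bar>s i x - g x\<bar> \<partial>M) < e / 3"
        by (auto dest: eventually_happens)
      have d: "integrable M (\<lambda>x. s i x - g x)" using lim by auto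
      have 1: "(\<integral>x. hs j x * s i x \<partial>M) - (\<integral>x. hs j x * g x \<partial>M) = (\<integral>x. hs j x * (s i x - g x) \<partial>M)" for j
        using int_mult lim by (simp add: right_diff_distrib Bochner_Integration.integral_diff)
      have 2: "(\<integral>x. h x * s i x \<partial>M) - (\<integral>x. h x * g x \<partial>M) = (\<integral>x. h x * (s i x - g x) \<partial>M)"
        using int_h_mult lim by (simp add: right_diff_distrib Bochner_Integration.integral_diff)
      obtain n0 where n0: "\<And>j. j \<ge> n0 \<Longrightarrow>
          norm ((\<integral>x. hs (r j) x * s i x \<partial>M) - (\<integral>x. h x * s i x \<partial>M)) < e / 3"
        using LIMSEQ_D[OF lim.IH[of i], of "e / 3"] e by auto
      show "\<exists>no. \<forall>j\<ge>no. norm ((\<integral>x. hs (r j) x * g x \<partial>M) - (\<integral>x. h x * g x \<partial>M)) < e"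
      proof (intro exI allI impI)
        fix j assume "n0 \<le> j"
        show "norm ((\<integral>x. hs (r j) x * g x \<partial>M) - (\<integral>x. h x * g x \<partial>M)) < e"
          using n0[OF \<open>n0 \<le> j\<close>] 1[of "r j"] 2 int_mult_le[OF d, of "r j"] h_mult_le[OF d] i
          unfolding real_norm_def by linarith
      qed
    qed
  qed
  then have "weak_star_Linf M (\<lambda>j. hs (r j)) h" by (simp add: weak_star_Linf_def)
  then show thesis using that[OF r h h_ab] by simp
qed

text \<open>Lebesgue measure has the same null sets as the finite measure with a positive integrable density
  \<open>\<rho>\<close>; a test function \<open>g\<close> for the former corresponds to \<open>g / \<rho>\<close> for the latter.\<close>
lemma weak_star_compact_lebesgue:
  fixes hs :: "nat \<Rightarrow> 'b::euclidean_space \<Rightarrow> real"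
  assumes hs: "\<And>j. hs j \<in> borel_measurable lebesgue" "\<And>j. AE x in lebesgue. hs j x \<in> {a..b}"
    and ab: "0 \<le> a" "a \<le> b"
  obtains r h where "strict_mono (r :: nat \<Rightarrow> nat)" "h \<in> borel_measurable borel"
    "AE x in lebesgue. h x \<in> {a..b}" "weak_star_Linf lebesgue (\<lambda>j. hs (r j)) h"
proof -
  have "\<forall>j. \<exists>g. g \<in> borel_measurable lborel \<and> (AE x in lborel. hs j x = g x)"
    using completion_ex_borel_measurable_real[OF hs(1)] by blast
  then obtain hb where hb: "\<And>j. hb j \<in> borel_measurable lborel" "\<And>j. AE x in lborel. hs j x = hb j x"
    by metis
  define hc where "hc j x = max a (min b (hb j x))" for j x
  have hc_meas[measurable]: "hc j \<in> borel_measurable borel" for j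
    using hb(1)[of j] unfolding hc_def by simp
  have hc_eq: "AE x in lborel. hs j x = hc j x" for j
  proof -
    have "AE x in lborel. hs j x \<in> {a..b}" using hs(2)[of j] by (simp add: AE_completion_iff)
    then show ?thesis using hb(2)[of j] by eventually_elim (auto simp: hc_def)
  qed
  obtain \<rho> :: "'b \<Rightarrow> real" where \<rho>: "\<rho> \<in> borel_measurable lborel" "\<And>x. 0 < \<rho> x" "integrable lborel \<rho>"
    using sigma_finite_measure.obtain_positive_integrable_function[OF sigma_finite_lborel] by metis
  define M where "M = density lborel (\<lambda>x. ennreal (\<rho> x))"
  have [measurable_cong]: "sets M = sets borel" by (simp add: M_def)
  have space: "space M = UNIV" by (simp add: M_def)
  have fin: "finite_measure M"
  proof
    have "emeasure M (space M) = (\<integral>\<^sup>+x. ennreal (\<rho> x) \<partial>lborel)"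
      unfolding space unfolding M_def using \<rho>(1) by (subst emeasure_density) auto
    also have "\<dots> < \<infinity>" using \<rho>(2,3) by (simp add: integrable_iff_bounded less_imp_le)
    finally show "emeasure M (space M) \<noteq> \<infinity>" by simp
  qed
  obtain B :: "'b set set" where B: "countable B" "topological_basis B"
    using ex_countable_basis by auto
  define G where "G = Inter ` {F. finite F \<and> F \<subseteq> B}"
  have "countable G"
    unfolding G_def using countable_Collect_finite_subset[OF B(1)] by simp
  moreover have "Int_stable G"
  proof (rule Int_stableI)
    fix U V assume "U \<in> G" "V \<in> G"
    then obtain F F' where "finite F" "F \<subseteq> B" "U = \<Inter>F" "finite F'" "F' \<subseteq> B" "V = \<Inter>F'"
      unfolding G_def by auto
    then show "U \<inter> V \<in> G" unfolding G_def by (intro image_eqI[of _ _ "F \<union> F'"]) auto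
  qed
  moreover have "topological_basis G"
  proof -
    have "B \<subseteq> G" unfolding G_def by (auto intro!: image_eqI[of _ Inter "{_}"])
    moreover have "open U" if "U \<in> G" for U
      using that topological_basis_open[OF B(2)] unfolding G_def by (auto intro!: open_Inter)
    ultimately show ?thesis using B(2) unfolding topological_basis_def by (meson subset_trans)
  qed
  then have "(borel :: 'b measure) = sigma UNIV G"
    by (rule borel_eq_countable_basis[OF \<open>countable G\<close>])
  then have "sets M = sets (sigma UNIV G)" using \<open>sets M = sets borel\<close> by (simp only:)
  then have "sets M = sigma_sets (space M) G" by (simp add: space)
  ultimately obtain r h where r: "strict_mono (r :: nat \<Rightarrow> nat)" "h \<in> borel_measurable M"
    and h: "AE x in M. h x \<in> {a..b}" "weak_star_Linf M (\<lambda>j. hc (r j)) h"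
    using weak_star_compact_finite_measure[OF fin, of G hc a b] ab
    by (auto simp: space hc_def measurable_cong_sets[OF \<open>sets M = sets borel\<close> refl])
  have hb: "h \<in> borel_measurable borel" using r(2) by simp
  note [measurable] = hb \<rho>(1)[simplified]
  have "AE x in lborel. h x \<in> {a..b}"
    using h(1) \<rho>(2) unfolding M_def by (subst (asm) AE_density) (auto elim!: eventually_mono)
  then have h_ab: "AE x in lebesgue. h x \<in> {a..b}" by (rule AE_completion)
  have "weak_star_Linf lebesgue (\<lambda>j. hs (r j)) h"
    unfolding weak_star_Linf_def
  proof (intro allI impI)
    fix g :: "'b \<Rightarrow> real" assume g: "integrable lebesgue g"
    then obtain g' where g'[measurable]: "g' \<in> borel_measurable borel" and gg': "AE x in lborel. g x = g' x"
      using completion_ex_borel_measurable_real[of g lborel] by auto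
    have g'l[measurable]: "g' \<in> borel_measurable lebesgue" by (rule measurable_completion) simp
    have g'_int: "integrable lborel g'"
    proof -
      have "integrable lebesgue g'"
        using g gg'[THEN AE_completion] by (subst integrable_cong_AE[where g = g]) (auto elim!: eventually_mono)
      then show ?thesis by (simp add: integrable_completion)
    qed
    have eq: "(\<integral>x. u x * g x \<partial>lebesgue) = (\<integral>x. u' x * (g' x / \<rho> x) \<partial>M)"
      if u: "u \<in> borel_measurable lebesgue" "AE x in lborel. u x = u' x" "u' \<in> borel_measurable borel" for u u'
    proof -
      note that(3)[measurable]
      have ul[measurable]: "u' \<in> borel_measurable lebesgue" by (rule measurable_completion) simp
      have "AE x in lebesgue. u x * g x = u' x * g' x"
        using gg'[THEN AE_completion] u(2)[THEN AE_completion] by eventually_elim simp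
      then have "(\<integral>x. u x * g x \<partial>lebesgue) = (\<integral>x. u' x * g' x \<partial>lebesgue)"
        using u(1) g by (intro integral_cong_AE) auto
      also have "\<dots> = (\<integral>x. u' x * g' x \<partial>lborel)" by (rule integral_completion) simp
      also have "\<dots> = (\<integral>x. \<rho> x *\<^sub>R (u' x * (g' x / \<rho> x)) \<partial>lborel)"
        using \<rho>(2) by (intro Bochner_Integration.integral_cong) (auto simp: less_imp_neq[symmetric])
      also have "\<dots> = (\<integral>x. u' x * (g' x / \<rho> x) \<partial>M)"
        unfolding M_def using \<rho>(2) by (subst integral_density) (auto simp: less_imp_le)
      finally show ?thesis .
    qed
    have "integrable M (\<lambda>x. g' x / \<rho> x)"
      unfolding M_def using \<rho>(2) g'_int
      by (subst integrable_density) (auto simp: less_imp_le less_imp_neq[symmetric])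
    then have "(\<lambda>j. \<integral>x. hc (r j) x * (g' x / \<rho> x) \<partial>M) \<longlonglongrightarrow> (\<integral>x. h x * (g' x / \<rho> x) \<partial>M)"
      by (rule h(2)[unfolded weak_star_Linf_def, rule_format])
    moreover have "h \<in> borel_measurable lebesgue" by (rule measurable_completion) simp
    ultimately show "(\<lambda>j. \<integral>x. hs (r j) x * g x \<partial>lebesgue) \<longlonglongrightarrow> (\<integral>x. h x * g x \<partial>lebesgue)"
      using eq[OF hs(1) hc_eq hc_meas] eq[of h h] hb by simp
  qed
  then show thesis using that r(1) hb h_ab by blast
qed

lemma nn_integral_lebesgue_swap:
  fixes F :: "'a::euclidean_space \<times> 'a \<Rightarrow> ennreal"
  assumes "F \<in> borel_measurable borel"
  shows "(\<integral>\<^sup>+z. F (prod.swap z) \<partial>lebesgue) = (\<integral>\<^sup>+z. F z \<partial>lebesgue)"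
proof -
  have [measurable]: "(\<lambda>z. prod.swap z) \<in> borel_measurable (borel :: ('a \<times> 'a) measure)"
    by (intro borel_measurable_continuous_onI continuous_intros)
  show ?thesis
    using nn_integral_lebesgue_pair(1)[of "\<lambda>z. F (prod.swap z)"] nn_integral_lebesgue_pair(2)[OF assms] assms
    by simp
qed

lemma borel_measurable_swap [measurable]:
  "prod.swap \<in> borel_measurable (borel :: ('a::euclidean_space \<times> 'a) measure)"
  by (intro borel_measurable_continuous_onI continuous_intros)

lemma distr_lborel_swap: "distr lborel borel prod.swap = (lborel :: ('a::euclidean_space \<times> 'a) measure)"
proof (rule measure_eqI)
  fix A assume "A \<in> sets (distr lborel borel (prod.swap :: 'a \<times> 'a \<Rightarrow> _))"
  then have [measurable]: "A \<in> sets borel" by simp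
  have "emeasure (distr lborel borel prod.swap) A = (\<integral>\<^sup>+z. indicator A z \<partial>distr lborel borel prod.swap)"
    by simp
  also have "\<dots> = (\<integral>\<^sup>+z. indicator A (prod.swap z) \<partial>lborel)"
    by (subst nn_integral_distr) auto
  also have "\<dots> = (\<integral>\<^sup>+z. indicator A z \<partial>lborel)"
    using nn_integral_lebesgue_swap[of "indicator A :: 'a \<times> 'a \<Rightarrow> ennreal"] by (simp add: nn_integral_completion)
  finally show "emeasure (distr lborel borel prod.swap) A = emeasure lborel A" by simp
qed simp

lemma AE_swap_notin_null:
  assumes "N \<in> null_sets lborel"
  shows "AE z in lborel. prod.swap (z :: 'a::euclidean_space \<times> 'a) \<notin> N"
proof -
  have [measurable]: "N \<in> sets borel" using assms by auto
  have "AE z in distr lborel borel (prod.swap :: 'a \<times> 'a \<Rightarrow> _). z \<notin> N"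
    unfolding distr_lborel_swap using assms by (rule AE_not_in)
  then show ?thesis by (subst (asm) AE_distr_iff) auto
qed

lemma measurable_swap_lebesgue [measurable]:
  "(prod.swap :: 'a::euclidean_space \<times> 'a \<Rightarrow> _) \<in> lebesgue \<rightarrow>\<^sub>M lebesgue"
  by (rule lebesgue_null_preimage(1)) (measurable, rule AE_swap_notin_null)

lemma AE_swap: "AE z in lebesgue. P z \<Longrightarrow> AE z in lebesgue. P (prod.swap (z :: 'a::euclidean_space \<times> 'a))"
  by (rule lebesgue_null_preimage(2)) (measurable, rule AE_swap_notin_null)

lemma distr_lebesgue_swap:
  "distr lebesgue lebesgue prod.swap = (lebesgue :: ('a::euclidean_space \<times> 'a) measure)"
proof -
  have "distr lebesgue lborel prod.swap = distr lborel lborel (prod.swap :: 'a \<times> 'a \<Rightarrow> _)"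
    by (rule distr_completion) simp
  also have "\<dots> = lborel" by (subst distr_lborel_swap[symmetric]) (rule distr_cong, auto)
  finally have *: "distr lebesgue lborel prod.swap = (lborel :: ('a \<times> 'a) measure)" .
  have "completion (distr lebesgue lborel prod.swap) = distr lebesgue lebesgue (prod.swap :: 'a \<times> 'a \<Rightarrow> _)"
    by (rule completion.completion_distr_eq) (simp_all add: * measurable_completion)
  then show ?thesis by (simp add: *)
qed

text \<open>The limit of symmetric functions may be symmetrised: testing with \<open>g \<circ> prod.swap\<close> instead of \<open>g\<close>
  shows that the reflected limit is a weak-star limit of the same sequence.\<close>
lemma coeffs_H_weak_star_compact:
  fixes hs :: "nat \<Rightarrow> 'a::euclidean_space \<times> 'a \<Rightarrow> real"
  assumes hs: "\<And>j. hs j \<in> coeffs_H a b" and ab: "0 < a" "a < b"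
  obtains r h where "strict_mono (r :: nat \<Rightarrow> nat)" "h \<in> coeffs_H a b"
    "weak_star_Linf lebesgue (\<lambda>j. hs (r j)) h"
proof -
  have hs': "hs j \<in> borel_measurable lebesgue" "AE z in lebesgue. hs j z \<in> {a..b}"
    "AE z in lebesgue. hs j (prod.swap z) = hs j z" for j
  proof -
    have *: "AE z in lebesgue. hs j z = hs j (prod.swap z) \<and> hs j z \<in> {a..b}"
      using hs[of j] by (simp add: coeffs_H_def split_beta' prod.swap_def)
    show "hs j \<in> borel_measurable lebesgue" using hs[of j] by (simp add: coeffs_H_def Linf_def)
    show "AE z in lebesgue. hs j z \<in> {a..b}" "AE z in lebesgue. hs j (prod.swap z) = hs j z"
      using * by (auto elim!: eventually_mono)
  qed
  obtain r h where r: "strict_mono (r :: nat \<Rightarrow> nat)" and h: "h \<in> borel_measurable borel"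
    "AE z in lebesgue. h z \<in> {a..b}" "weak_star_Linf lebesgue (\<lambda>j. hs (r j)) h"
    by (rule weak_star_compact_lebesgue[OF hs'(1,2) less_imp_le[OF ab(1)] less_imp_le[OF ab(2)]])
  have hm[measurable]: "h \<in> borel_measurable lebesgue" using h(1) by (intro measurable_completion) simp
  define h' where "h' z = (h z + h (prod.swap z)) / 2" for z
  have h'm[measurable]: "h' \<in> borel_measurable lebesgue" unfolding h'_def by measurable
  have h'_ab: "AE z in lebesgue. h' z \<in> {a..b}"
    using h(2) AE_swap[OF h(2)] by eventually_elim (auto simp: h'_def)
  have "h' \<in> coeffs_H a b"
    unfolding coeffs_H_def Linf_def
  proof (intro CollectI conjI exI[of _ b])
    show "AE z in lebesgue. \<bar>h' z\<bar> \<le> b" using h'_ab by eventually_elim (use ab in auto)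
    show "AE (x', x) in lebesgue. h' (x', x) = h' (x, x') \<and> h' (x', x) \<in> {a..b}"
      using h'_ab unfolding split_beta' by eventually_elim (auto simp: h'_def add.commute)
  qed fact
  moreover have "weak_star_Linf lebesgue (\<lambda>j. hs (r j)) h'"
    unfolding weak_star_Linf_def
  proof (intro allI impI)
    fix g :: "'a \<times> 'a \<Rightarrow> real" assume g: "integrable lebesgue g"
    then have gm[measurable]: "g \<in> borel_measurable lebesgue" by auto
    have gs: "integrable lebesgue (\<lambda>z. g (prod.swap z))"
      using integrable_distr_eq[of prod.swap lebesgue lebesgue g] g by (simp add: distr_lebesgue_swap)
    have swap: "(\<integral>z. u z * g (prod.swap z) \<partial>lebesgue) = (\<integral>z. u (prod.swap z) * g z \<partial>lebesgue)"
      if [measurable]: "u \<in> borel_measurable lebesgue" for u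
      using integral_distr[of prod.swap lebesgue lebesgue "\<lambda>z. u (prod.swap z) * g z"]
      by (simp add: distr_lebesgue_swap)
    have h_abs: "AE z in lebesgue. \<bar>h z\<bar> \<le> b" using h(2) by eventually_elim (use ab in auto)
    have "integrable lebesgue (\<lambda>z. u z * g z)"
      if "u \<in> borel_measurable lebesgue" "AE z in lebesgue. \<bar>u z\<bar> \<le> b" for u
    proof (rule Bochner_Integration.integrable_bound[OF integrable_mult_right[OF g, of b]])
      show "AE z in lebesgue. norm (u z * g z) \<le> norm (b * g z)"
        using that(2) by eventually_elim (use ab in \<open>auto simp: abs_mult intro!: mult_mono\<close>)
    qed (use that in auto)
    from this[of h] this[of "\<lambda>z. h (prod.swap z)"]
    have hmult: "integrable lebesgue (\<lambda>z. h z * g z)" "integrable lebesgue (\<lambda>z. h (prod.swap z) * g z)"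
      using h_abs AE_swap[OF h_abs] by auto
    have 1: "(\<lambda>j. \<integral>z. hs (r j) z * g z \<partial>lebesgue) \<longlonglongrightarrow> (\<integral>z. h z * g z \<partial>lebesgue)"
      using h(3) g by (simp add: weak_star_Linf_def)
    have "(\<lambda>j. \<integral>z. hs (r j) z * g (prod.swap z) \<partial>lebesgue) \<longlonglongrightarrow> (\<integral>z. h z * g (prod.swap z) \<partial>lebesgue)"
      using h(3) gs by (simp add: weak_star_Linf_def)
    moreover have "(\<integral>z. hs j z * g (prod.swap z) \<partial>lebesgue) = (\<integral>z. hs j z * g z \<partial>lebesgue)" for j
      unfolding swap[OF hs'(1)] using hs'(1,3)[of j]
      by (intro integral_cong_AE) (auto elim!: eventually_mono intro!: borel_measurable_times
            measurable_compose[OF measurable_swap_lebesgue])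
    ultimately have 2: "(\<lambda>j. \<integral>z. hs (r j) z * g z \<partial>lebesgue) \<longlonglongrightarrow> (\<integral>z. h (prod.swap z) * g z \<partial>lebesgue)"
      by (simp add: swap)
    have "(\<integral>z. h' z * g z \<partial>lebesgue) = ((\<integral>z. h z * g z \<partial>lebesgue) + (\<integral>z. h (prod.swap z) * g z \<partial>lebesgue)) / 2"
      using hmult by (simp add: h'_def add_divide_distrib distrib_right Bochner_Integration.integral_add)
    moreover have "(\<integral>z. h z * g z \<partial>lebesgue) = (\<integral>z. h (prod.swap z) * g z \<partial>lebesgue)"
      using LIMSEQ_unique[OF 1 2] .
    ultimately show "(\<lambda>j. \<integral>z. hs (r j) z * g z \<partial>lebesgue) \<longlonglongrightarrow> (\<integral>z. h' z * g z \<partial>lebesgue)"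
      using 1 by simp
  qed
  ultimately show thesis using that r by blast
qed

section \<open>The energy space\<close>

locale nonlocal_space =
  fixes \<Omega> :: "'a::euclidean_space set" and k :: "'a \<Rightarrow> real" and p s c0 :: real
  assumes open_domain: "open \<Omega>" and bounded_domain: "bounded \<Omega>"
    and p: "1 < p" and s: "0 < s" "s < 1" and c0: "0 < c0"
    and kernel: "admissible_kernel p s c0 k"
begin

definition weight :: "'a \<times> 'a \<Rightarrow> real" where
  "weight z = k (fst z - snd z) / norm (fst z - snd z) powr p"

text \<open>The difference quotient with the \<open>p\<close>-th root of the weight as a factor. It is linear in \<open>u\<close>, the energy
  is the integral of \<open>\<bar>quot u\<bar> powr p\<close> and the form is the integral of
  \<open>h * signed_powr p (quot u) * quot v\<close>, so \<open>quot\<close> embeds the space into the \<open>p\<close>-integrable functions.\<close>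
definition quot :: "('a \<Rightarrow> real) \<Rightarrow> 'a \<times> 'a \<Rightarrow> real" where
  "quot u z = weight z powr (1 / p) * (u (fst z) - u (snd z))"

definition En :: "('a \<Rightarrow> real) \<Rightarrow> real" where
  "En u = (\<integral>z. \<bar>quot u z\<bar> powr p \<partial>lebesgue)"

abbreviation V :: "('a \<Rightarrow> real) set" where "V \<equiv> X0 \<Omega> k p"

text \<open>Local integrability gives measurability on each ball.\<close>
lemma kernel_measurable [measurable]: "k \<in> borel_measurable lebesgue"
proof (rule borel_measurable_LIMSEQ_real)
  show "(\<lambda>n. indicator (cball 0 (real n)) x *\<^sub>R k x) \<longlonglongrightarrow> k x" for x
  proof (rule tendsto_eventually)
    obtain n0 :: nat where "norm x \<le> n0" using real_arch_simple by blast
    then show "eventually (\<lambda>n. indicator (cball 0 (real n)) x *\<^sub>R k x = k x) sequentially"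
      by (intro eventually_sequentiallyI[of n0]) (auto simp: indicator_def)
  qed
  show "(\<lambda>x. indicator (cball 0 (real n)) x *\<^sub>R k x) \<in> borel_measurable lebesgue" for n
    using kernel compact_cball
    by (intro borel_measurable_integrable)
      (auto simp: admissible_kernel_def locally_integrable_def set_integrable_def)
qed

lemma weight_nonneg: "0 \<le> weight z"
  using kernel by (cases "fst z - snd z = 0") (auto simp: weight_def admissible_kernel_def less_imp_le)

lemma norm_measurable_lebesgue [measurable]: "norm \<in> borel_measurable (lebesgue :: 'a measure)"
  by (intro measurable_completion) simp

lemma weight_measurable [measurable]: "weight \<in> borel_measurable lebesgue"
proof -
  have "(\<lambda>z. (\<lambda>x. k x / norm x powr p) (fst z - snd z :: 'a)) \<in> borel_measurable lebesgue"
    by (rule measurable_compose[OF measurable_diff_lebesgue]) measurable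
  then show ?thesis by (simp add: weight_def[abs_def])
qed

lemma quot_measurable [measurable]:
  assumes [measurable]: "u \<in> borel_measurable lebesgue"
  shows "quot u \<in> borel_measurable lebesgue"
  unfolding quot_def[abs_def] by measurable

lemma quot_powr: "\<bar>quot u z\<bar> powr p = weight z * \<bar>u (fst z) - u (snd z)\<bar> powr p"
  using weight_nonneg[of z] p by (simp add: quot_def abs_mult powr_mult powr_powr)

lemma quot_add: "quot (\<lambda>x. u x + v x) z = quot u z + quot v z"
  and quot_diff: "quot (\<lambda>x. u x - v x) z = quot u z - quot v z"
  and quot_cmult: "quot (\<lambda>x. c * u x) z = c * quot u z"
  by (simp_all add: quot_def algebra_simps)

lemma energy_eq: "energy k p u = (\<integral>\<^sup>+z. ennreal (\<bar>quot u z\<bar> powr p) \<partial>lebesgue)"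
  by (simp add: energy_def quot_powr weight_def split_beta')

lemma V_iff: "u \<in> V \<longleftrightarrow> u \<in> borel_measurable lebesgue \<and> integrable lebesgue (\<lambda>x. \<bar>u x\<bar> powr p) \<and>
    integrable lebesgue (\<lambda>z. \<bar>quot u z\<bar> powr p) \<and> (AE x in lebesgue. x \<notin> \<Omega> \<longrightarrow> u x = 0)"
proof -
  have "energy k p u < \<infinity> \<longleftrightarrow> integrable lebesgue (\<lambda>z. \<bar>quot u z\<bar> powr p)"
    if [measurable]: "u \<in> borel_measurable lebesgue"
    unfolding energy_eq integrable_iff_bounded by simp
  then show ?thesis by (auto simp: X0_def X_def Lp_def)
qed

lemma V_D:
  assumes "u \<in> V"
  shows V_measurable: "u \<in> borel_measurable lebesgue"
    and V_powr: "integrable lebesgue (\<lambda>x. \<bar>u x\<bar> powr p)"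
    and V_quot: "integrable lebesgue (\<lambda>z. \<bar>quot u z\<bar> powr p)"
    and V_zero: "AE x in lebesgue. x \<notin> \<Omega> \<longrightarrow> u x = 0"
  using assms by (auto simp: V_iff)

lemma V_add:
  assumes "u \<in> V" "v \<in> V" shows "(\<lambda>x. u x + v x) \<in> V"
proof -
  note V_measurable[OF assms(1), measurable] V_measurable[OF assms(2), measurable]
  have int: "integrable M (\<lambda>x. \<bar>f x + g x\<bar> powr p)"
    if "f \<in> borel_measurable M" "g \<in> borel_measurable M"
      and "integrable M (\<lambda>x. \<bar>f x\<bar> powr p)" "integrable M (\<lambda>x. \<bar>g x\<bar> powr p)"
    for f g :: "'c \<Rightarrow> real" and M
  proof (rule Bochner_Integration.integrable_bound)
    show "integrable M (\<lambda>x. 2 powr p * (\<bar>f x\<bar> powr p + \<bar>g x\<bar> powr p))" using that by auto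
    show "AE x in M. norm (\<bar>f x + g x\<bar> powr p) \<le> norm (2 powr p * (\<bar>f x\<bar> powr p + \<bar>g x\<bar> powr p))"
      using powr_add_le[of p] p by (intro AE_I2) (auto simp: abs_mult abs_of_nonneg add_nonneg_nonneg)
  qed (use that in measurable)
  show ?thesis
    unfolding V_iff quot_add
    using V_D(2-4)[OF assms(1)] V_D(2-4)[OF assms(2)] by (auto intro!: int elim!: eventually_elim2)
qed

lemma V_cmult:
  assumes "u \<in> V" shows "(\<lambda>x. c * u x) \<in> V"
  using V_D[OF assms] by (auto simp: V_iff quot_cmult abs_mult powr_mult elim!: eventually_mono)

lemma V_diff:
  assumes "u \<in> V" "v \<in> V" shows "(\<lambda>x. u x - v x) \<in> V"
  using V_add[OF assms(1) V_cmult[OF assms(2), of "-1"]] by simp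

lemma V_0: "(\<lambda>x. 0) \<in> V"
  using p by (simp add: V_iff quot_def)

lemma En_nonneg: "0 \<le> En u" by (simp add: En_def)

lemma energy_eq_En: "u \<in> V \<Longrightarrow> energy k p u = ennreal (En u)"
  unfolding energy_eq En_def by (intro nn_integral_eq_integral V_quot) auto

lemma X0_norm_eq: "u \<in> V \<Longrightarrow> X0_norm k p u = En u powr (1 / p)"
  by (simp add: X0_norm_def energy_eq_En En_nonneg)

lemma En_cmult: "En (\<lambda>x. c * u x) = \<bar>c\<bar> powr p * En u"
  by (simp add: En_def quot_cmult abs_mult powr_mult)

lemma En_add_le:
  assumes "u \<in> V" "v \<in> V" shows "En (\<lambda>x. u x + v x) \<le> 2 powr p * (En u + En v)"
proof -
  have "En (\<lambda>x. u x + v x) \<le> (\<integral>z. 2 powr p * (\<bar>quot u z\<bar> powr p + \<bar>quot v z\<bar> powr p) \<partial>lebesgue)"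
    unfolding En_def using powr_add_le[of p] p V_quot[OF assms(1)] V_quot[OF assms(2)] V_quot[OF V_add[OF assms]]
    by (intro integral_mono) (auto simp: quot_add)
  also have "\<dots> = 2 powr p * (En u + En v)"
    unfolding En_def using V_quot[OF assms(1)] V_quot[OF assms(2)] by simp
  finally show ?thesis .
qed

lemma En_diff_le:
  assumes "u \<in> V" "v \<in> V" shows "En (\<lambda>x. u x - v x) \<le> 2 powr p * (En u + En v)"
  using En_add_le[OF assms(1) V_cmult[OF assms(2), of "-1"]] En_cmult[of "-1" v] by simp

lemma V_AE_cong:
  assumes u: "u \<in> V" and v: "v \<in> borel_measurable lebesgue" and ae: "AE x in lebesgue. u x = v x"
  shows "v \<in> V" and "AE z in lebesgue. quot u z = quot v z"
proof -
  show q: "AE z in lebesgue. quot u z = quot v z"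
    using AE_fst[OF ae] AE_snd[OF ae] by eventually_elim (simp add: quot_def)
  show "v \<in> V"
    unfolding V_iff
  proof (intro conjI v)
    show "integrable lebesgue (\<lambda>x. \<bar>v x\<bar> powr p)"
      using V_D(1,2)[OF u] v ae by (subst integrable_cong_AE[where g = "\<lambda>x. \<bar>u x\<bar> powr p"]) (auto elim!: eventually_mono)
    show "integrable lebesgue (\<lambda>x. \<bar>quot v x\<bar> powr p)"
      using V_D(3)[OF u] quot_measurable[OF v] quot_measurable[OF V_measurable[OF u]] q
      by (subst integrable_cong_AE[where g = "\<lambda>x. \<bar>quot u x\<bar> powr p"]) (auto elim!: eventually_mono)
    show "AE x in lebesgue. x \<notin> \<Omega> \<longrightarrow> v x = 0"
      using V_zero[OF u] ae by eventually_elim auto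
  qed
qed

lemma B_form_eq:
  "B_form k p h u v = (\<integral>z. h z * (signed_powr p (quot u z) * quot v z) \<partial>lebesgue)"
proof -
  have "h z * k (fst z - snd z) * (\<bar>u (fst z) - u (snd z)\<bar> powr (p - 2) * (u (fst z) - u (snd z)) * (v (fst z) - v (snd z)) / norm (fst z - snd z) powr p) = h z * (signed_powr p (quot u z) * quot v z)" for z
  proof (cases "weight z = 0")
    case False
    then have w: "0 < weight z" using weight_nonneg[of z] by simp
    have "weight z powr ((p - 2) / p) * weight z powr (1 / p) * weight z powr (1 / p) = weight z powr ((p - 2) / p + 1 / p + 1 / p)"
      by (simp only: powr_add)
    also have "(p - 2) / p + 1 / p + 1 / p = 1" using p by (simp add: field_simps)
    finally have *: "weight z powr ((p - 2) / p) * weight z powr (1 / p) * weight z powr (1 / p) = weight z"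
      using w by simp
    have "signed_powr p (quot u z) * quot v z = (weight z powr ((p - 2) / p) * weight z powr (1 / p) * weight z powr (1 / p)) *
       (\<bar>u (fst z) - u (snd z)\<bar> powr (p - 2) * (u (fst z) - u (snd z)) * (v (fst z) - v (snd z)))"
      using w by (simp add: signed_powr_def quot_def abs_mult powr_mult powr_powr)
    then show ?thesis unfolding * by (simp add: weight_def)
  qed (auto simp: quot_def weight_def)
  then show ?thesis by (simp add: B_form_def split_beta')
qed

text \<open>This integral dominates \<open>B_form k p h u v\<close> up to the bound on the coefficient \<open>h\<close>.\<close>
definition pairing_bound :: "('a \<Rightarrow> real) \<Rightarrow> ('a \<Rightarrow> real) \<Rightarrow> real" where
  "pairing_bound u v = (\<integral>z. \<bar>quot u z\<bar> powr (p - 1) * \<bar>quot v z\<bar> \<partial>lebesgue)"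

lemma pairing_integrable:
  assumes "u \<in> V" "v \<in> V"
  shows "integrable lebesgue (\<lambda>z. \<bar>quot u z\<bar> powr (p - 1) * \<bar>quot v z\<bar>)"
proof (rule Bochner_Integration.integrable_bound)
  note V_measurable[OF assms(1), measurable] V_measurable[OF assms(2), measurable]
  show "integrable lebesgue (\<lambda>z. \<bar>quot u z\<bar> powr p + \<bar>quot v z\<bar> powr p)"
    using assms[THEN V_quot] by auto
  show "AE z in lebesgue. norm (\<bar>quot u z\<bar> powr (p - 1) * \<bar>quot v z\<bar>) \<le> norm (\<bar>quot u z\<bar> powr p + \<bar>quot v z\<bar> powr p)"
    using powr_Young_scaled[OF p, of 1] by (intro AE_I2) (auto simp: abs_mult add_nonneg_nonneg)
  show "(\<lambda>z. \<bar>quot u z\<bar> powr (p - 1) * \<bar>quot v z\<bar>) \<in> borel_measurable lebesgue" by measurable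
qed

lemma signed_powr_measurable [measurable]: "signed_powr p \<in> borel_measurable borel"
  unfolding signed_powr_def[abs_def] by measurable

lemma
  assumes u: "u \<in> V" and v: "v \<in> V" and h: "h \<in> borel_measurable lebesgue" "AE z in lebesgue. \<bar>h z\<bar> \<le> b"
  shows B_form_integrable: "integrable lebesgue (\<lambda>z. h z * (signed_powr p (quot u z) * quot v z))"
    and B_form_bound: "\<bar>B_form k p h u v\<bar> \<le> b * pairing_bound u v"
proof -
  note V_measurable[OF u, measurable] V_measurable[OF v, measurable] h(1)[measurable]
  have int: "integrable lebesgue (\<lambda>z. b * (\<bar>quot u z\<bar> powr (p - 1) * \<bar>quot v z\<bar>))"
    using pairing_integrable[OF u v] by simp
  have le: "AE z in lebesgue. norm (h z * (signed_powr p (quot u z) * quot v z)) \<le> b * (\<bar>quot u z\<bar> powr (p - 1) * \<bar>quot v z\<bar>)"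
    using h(2) by eventually_elim (auto simp: abs_mult abs_signed_powr intro!: mult_right_mono)
  show *: "integrable lebesgue (\<lambda>z. h z * (signed_powr p (quot u z) * quot v z))"
    by (rule Bochner_Integration.integrable_bound[OF int]) (measurable, use le in eventually_elim, simp)
  have "\<bar>B_form k p h u v\<bar> \<le> (\<integral>z. norm (h z * (signed_powr p (quot u z) * quot v z)) \<partial>lebesgue)"
    unfolding B_form_eq real_norm_def by (rule integral_abs_bound)
  also have "\<dots> \<le> (\<integral>z. b * (\<bar>quot u z\<bar> powr (p - 1) * \<bar>quot v z\<bar>) \<partial>lebesgue)"
    using integrable_norm[OF *] int le by (rule integral_mono_AE)
  finally show "\<bar>B_form k p h u v\<bar> \<le> b * pairing_bound u v" by (simp add: pairing_bound_def)
qed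

end

section \<open>Comparison of the energy with the \<open>p\<close>-th mean\<close>

context nonlocal_space
begin

definition Lpow :: "('a \<Rightarrow> real) \<Rightarrow> real" where
  "Lpow u = (\<integral>x. \<bar>u x\<bar> powr p \<partial>lebesgue)"

lemma Lpow_nonneg: "0 \<le> Lpow u" by (simp add: Lpow_def)

lemma nn_integral_Lpow: "u \<in> V \<Longrightarrow> (\<integral>\<^sup>+x. ennreal (\<bar>u x\<bar> powr p) \<partial>lebesgue) = ennreal (Lpow u)"
  unfolding Lpow_def by (intro nn_integral_eq_integral V_powr) auto

lemma nn_integral_En: "u \<in> V \<Longrightarrow> (\<integral>\<^sup>+z. ennreal (\<bar>quot u z\<bar> powr p) \<partial>lebesgue) = ennreal (En u)"
  using energy_eq_En energy_eq by simp

text \<open>The lower bound on the kernel enters through this inequality: at distance at most \<open>D\<close> the weight is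
  at least \<open>c0 / D powr (N + s * p)\<close>, where \<open>N\<close> is the dimension.\<close>
lemma difference_le_quot:
  assumes "norm (fst z - snd z) \<le> D"
  shows "\<bar>u (fst z) - u (snd z)\<bar> powr p \<le> D powr (real DIM('a) + s * p) / c0 * \<bar>quot u z\<bar> powr p"
proof (cases "fst z = snd z")
  case True
  then show ?thesis using p c0 by simp
next
  case False
  define n where "n = norm (fst z - snd z)"
  have n: "0 < n" "n \<le> D" using False assms by (auto simp: n_def)
  have ex: "0 \<le> (real DIM('a) + s * p)" using s p by simp
  have "c0 / n powr (real DIM('a) + (s - 1) * p) \<le> k (fst z - snd z)"
    using kernel False by (simp add: admissible_kernel_def n_def)
  then have "c0 / n powr (real DIM('a) + (s - 1) * p) / n powr p \<le> weight z"
    unfolding weight_def n_def[symmetric] by (intro divide_right_mono) auto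
  also have "c0 / n powr (real DIM('a) + (s - 1) * p) / n powr p = c0 / n powr (real DIM('a) + s * p)"
    by (simp add: powr_add[symmetric] algebra_simps)
  finally have "c0 / n powr (real DIM('a) + s * p) \<le> weight z" .
  moreover have "c0 / D powr (real DIM('a) + s * p) \<le> c0 / n powr (real DIM('a) + s * p)"
    using n c0 ex by (intro divide_left_mono powr_mono2) auto
  ultimately have "c0 / D powr (real DIM('a) + s * p) \<le> weight z" by linarith
  then have "1 \<le> D powr (real DIM('a) + s * p) / c0 * weight z"
    using n c0 by (simp add: field_simps)
  then have "1 * \<bar>u (fst z) - u (snd z)\<bar> powr p \<le> (D powr (real DIM('a) + s * p) / c0 * weight z) * \<bar>u (fst z) - u (snd z)\<bar> powr p"
    by (intro mult_right_mono) auto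
  then show ?thesis by (simp add: quot_powr)
qed

text \<open>A Poincare inequality. The functions vanish on a ball \<open>A\<close> outside the bounded domain, so for \<open>x\<close> in the
  domain and \<open>y\<close> in \<open>A\<close> the difference \<open>u x - u y\<close> is \<open>u x\<close>, at a bounded distance; integrate over
  both variables.\<close>
lemma Poincare:
  obtains C where "0 \<le> C" "\<And>u. u \<in> V \<Longrightarrow> Lpow u \<le> C * En u"
proof -
  obtain R where R: "0 < R" "\<Omega> \<subseteq> ball 0 R"
    using bounded_subset_ballD[OF bounded_domain, of 0] by auto
  obtain e :: 'a where e: "norm e = 1" using norm_Basis SOME_Basis by blast
  define A where "A = ball ((R + 1) *\<^sub>R e) 1"
  have A: "R \<le> norm y" "norm y \<le> R + 2" if "y \<in> A" for y
  proof -
    have "norm ((R + 1) *\<^sub>R e) = R + 1" using e R by simp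
    moreover have "norm ((R + 1) *\<^sub>R e - y) < 1" using that by (simp add: A_def dist_norm)
    moreover have "\<bar>norm ((R + 1) *\<^sub>R e) - norm y\<bar> \<le> norm ((R + 1) *\<^sub>R e - y)"
      by (rule norm_triangle_ineq3)
    ultimately show "R \<le> norm y" "norm y \<le> R + 2" by linarith+
  qed
  define D where "D = (2 * R + 2) powr (real DIM('a) + s * p) / c0"
  define a where "a = measure lebesgue A"
  have a: "0 < a" "emeasure lebesgue A = ennreal a"
    using content_ball_pos[of 1 "(R + 1) *\<^sub>R e"] emeasure_lborel_ball_finite[of "(R + 1) *\<^sub>R e" 1]
    by (auto simp: a_def A_def emeasure_eq_ennreal_measure)
  have D: "0 \<le> D" using c0 by (simp add: D_def)
  show thesis
  proof (rule that[of "D / a"])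
    show "0 \<le> D / a" using D a by simp
    fix u assume u: "u \<in> V"
    note V_measurable[OF u, measurable]
    have [measurable]: "A \<in> sets lebesgue" by (simp add: A_def)
    have "ennreal (Lpow u) * ennreal a = (\<integral>\<^sup>+z. ennreal (\<bar>u (fst z)\<bar> powr p) * indicator A (snd z) \<partial>lebesgue)"
      using nn_integral_Lpow[OF u] a(2)
      by (subst nn_integral_lebesgue_tensor) auto
    also have "\<dots> \<le> (\<integral>\<^sup>+z. ennreal (D * \<bar>quot u z\<bar> powr p) \<partial>lebesgue)"
    proof (rule nn_integral_mono_AE)
      show "AE z in lebesgue. ennreal (\<bar>u (fst z)\<bar> powr p) * indicator A (snd z) \<le> ennreal (D * \<bar>quot u z\<bar> powr p)"
        using AE_fst[OF V_zero[OF u]] AE_snd[OF V_zero[OF u]]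
      proof eventually_elim
        fix z :: "'a \<times> 'a"
        assume z: "fst z \<notin> \<Omega> \<longrightarrow> u (fst z) = 0" "snd z \<notin> \<Omega> \<longrightarrow> u (snd z) = 0"
        show "ennreal (\<bar>u (fst z)\<bar> powr p) * indicator A (snd z) \<le> ennreal (D * \<bar>quot u z\<bar> powr p)"
        proof (cases "fst z \<in> \<Omega> \<and> snd z \<in> A")
          case True
          then have n: "norm (fst z) < R" "R \<le> norm (snd z)" "norm (snd z) \<le> R + 2"
            using R A by auto
          then have "snd z \<notin> \<Omega>" using R by auto
          moreover have "norm (fst z - snd z) \<le> 2 * R + 2"
            using n norm_triangle_ineq4[of "fst z" "snd z"] by linarith
          ultimately show ?thesis
            using difference_le_quot[of z "2 * R + 2" u] z by (auto simp: D_def indicator_def intro!: ennreal_leI)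
        next
          case False
          then show ?thesis using z p by (auto simp: indicator_def)
        qed
      qed
    qed
    also have "\<dots> = ennreal D * ennreal (En u)"
      using D by (simp add: ennreal_mult nn_integral_cmult nn_integral_En[OF u])
    finally have "Lpow u * a \<le> D * En u"
      using D En_nonneg[of u] Lpow_nonneg[of u] a by (simp add: ennreal_mult[symmetric])
    then show "Lpow u \<le> D / a * En u" using a by (simp add: field_simps)
  qed
qed

text \<open>Away from the diagonal the weight is integrable in one variable, so the triangle inequality suffices.
  The two summands are exchanged by the swap because the kernel is radial.\<close>
lemma far_energy_le:
  assumes d: "0 < d"
  obtains C where "0 \<le> C"
    "\<And>u. u \<in> V \<Longrightarrow> (\<integral>z. indicator {z. d \<le> norm (fst z - snd z)} z * \<bar>quot u z\<bar> powr p \<partial>lebesgue) \<le> C * Lpow u"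
proof -
  define g where "g x = indicator (- ball 0 d) x * (k x / norm x powr p)" for x :: 'a
  have g_int: "integrable lebesgue g"
    using kernel d by (simp add: admissible_kernel_def set_integrable_def g_def[abs_def])
  have g_nonneg: "0 \<le> g x" for x
    using weight_nonneg[of "(x, 0)"] by (simp add: g_def weight_def indicator_def)
  have g_weight: "g (fst z - snd z) = indicator {z. d \<le> norm (fst z - snd z)} z * weight z" for z
    by (auto simp: g_def weight_def indicator_def)
  define G where "G = (\<integral>x. g x \<partial>lebesgue)"
  have G: "0 \<le> G" "(\<integral>\<^sup>+x. ennreal (g x) \<partial>lebesgue) = ennreal G"
    using g_int g_nonneg by (auto simp: G_def intro!: nn_integral_eq_integral)
  have g_swap: "g (fst z - snd z) = g (snd z - fst z)" for z :: "'a \<times> 'a"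
  proof -
    have "norm (fst z - snd z) = norm (snd z - fst z)" by (rule norm_minus_commute)
    moreover have "k (fst z - snd z) = k (snd z - fst z)"
      using kernel norm_minus_commute unfolding admissible_kernel_def radial_def by blast
    ultimately show ?thesis by (simp add: g_def indicator_def)
  qed
  show thesis
  proof (rule that[of "2 powr p * (2 * G)"])
    show "0 \<le> 2 powr p * (2 * G)" using G by simp
    fix u assume u: "u \<in> V"
    note V_measurable[OF u, measurable]
    let ?f = "\<lambda>z. indicator {z. d \<le> norm (fst z - snd z)} z * \<bar>quot u z\<bar> powr p"
    have [measurable]: "g \<in> borel_measurable lebesgue" using g_int by auto
    have f_eq: "?f z = g (fst z - snd z) * \<bar>u (fst z) - u (snd z)\<bar> powr p" for z
      by (simp add: g_weight quot_powr)
    have gd: "(\<lambda>z. g (fst z - snd z)) \<in> borel_measurable lebesgue"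
      by (rule measurable_compose[OF measurable_diff_lebesgue]) measurable
    note gd[measurable]
    have second: "(\<integral>\<^sup>+z. ennreal (g (fst z - snd z)) * ennreal (\<bar>u (snd z)\<bar> powr p) \<partial>lebesgue) = ennreal G * ennreal (Lpow u)"
      using G nn_integral_Lpow[OF u] by (subst nn_integral_lebesgue_convolution) auto
    have "(\<integral>\<^sup>+z. ennreal (g (fst z - snd z)) * ennreal (\<bar>u (fst z)\<bar> powr p) \<partial>lebesgue) =
      (\<integral>\<^sup>+z. ennreal (g (fst z - snd z)) * ennreal (\<bar>u (fst z)\<bar> powr p) \<partial>distr lebesgue lebesgue prod.swap)"
      by (simp only: distr_lebesgue_swap)
    also have "\<dots> = (\<integral>\<^sup>+z. ennreal (g (snd z - fst z)) * ennreal (\<bar>u (snd z)\<bar> powr p) \<partial>lebesgue)"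
      by (subst nn_integral_distr) auto
    also have "\<dots> = (\<integral>\<^sup>+z. ennreal (g (fst z - snd z)) * ennreal (\<bar>u (snd z)\<bar> powr p) \<partial>lebesgue)"
      by (intro nn_integral_cong) (metis g_swap)
    finally have first: "(\<integral>\<^sup>+z. ennreal (g (fst z - snd z)) * ennreal (\<bar>u (fst z)\<bar> powr p) \<partial>lebesgue) = ennreal G * ennreal (Lpow u)"
      using second by simp
    have "(\<integral>\<^sup>+z. ennreal (?f z) \<partial>lebesgue) \<le>
      (\<integral>\<^sup>+z. ennreal (2 powr p) * (ennreal (g (fst z - snd z)) * ennreal (\<bar>u (fst z)\<bar> powr p)
           + ennreal (g (fst z - snd z)) * ennreal (\<bar>u (snd z)\<bar> powr p)) \<partial>lebesgue)"
    proof (rule nn_integral_mono)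
      fix z :: "'a \<times> 'a"
      have "?f z \<le> g (fst z - snd z) * (2 powr p * (\<bar>u (fst z)\<bar> powr p + \<bar>u (snd z)\<bar> powr p))"
        unfolding f_eq using p g_nonneg by (intro mult_left_mono powr_diff_le) auto
      also have "\<dots> = 2 powr p * (g (fst z - snd z) * \<bar>u (fst z)\<bar> powr p + g (fst z - snd z) * \<bar>u (snd z)\<bar> powr p)"
        by (simp add: algebra_simps)
      finally have "ennreal (?f z) \<le> ennreal \<dots>" by (rule ennreal_leI)
      then show "ennreal (?f z) \<le> ennreal (2 powr p) * (ennreal (g (fst z - snd z)) * ennreal (\<bar>u (fst z)\<bar> powr p)
           + ennreal (g (fst z - snd z)) * ennreal (\<bar>u (snd z)\<bar> powr p))"
        using g_nonneg by (simp add: ennreal_mult ennreal_plus)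
    qed
    also have "\<dots> = ennreal (2 powr p) * (ennreal G * ennreal (Lpow u) + ennreal G * ennreal (Lpow u))"
      by (simp add: nn_integral_cmult nn_integral_add first second)
    also have "\<dots> = ennreal (2 powr p * (2 * G) * Lpow u)"
      using G Lpow_nonneg[of u] by (simp add: ennreal_mult[symmetric] ennreal_plus[symmetric] algebra_simps del: ennreal_plus)
    finally have le: "(\<integral>\<^sup>+z. ennreal (?f z) \<partial>lebesgue) \<le> ennreal (2 powr p * (2 * G) * Lpow u)" .
    have "?f \<in> borel_measurable lebesgue" unfolding f_eq by measurable
    then show "(\<integral>z. ?f z \<partial>lebesgue) \<le> 2 powr p * (2 * G) * Lpow u"
      using le G Lpow_nonneg[of u] by (intro integral_real_bounded) auto
  qed
qed

text \<open>The pairing with a fixed \<open>u\<close> is continuous in the \<open>p\<close>-th mean on sets of bounded energy. Near the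
  diagonal the energy of \<open>u\<close> is small, so the scaled Young inequality leaves only a small multiple of
  the energy of \<open>v\<close>; away from the diagonal the energy of \<open>v\<close> is at most a multiple of its \<open>p\<close>-th mean.\<close>
lemma pairing_bound_le:
  assumes u: "u \<in> V" and e: "0 < e"
  obtains C where "0 \<le> C" "\<And>v. v \<in> V \<Longrightarrow> pairing_bound u v \<le> e * (1 + En v) + C * Lpow v"
proof -
  note V_measurable[OF u, measurable]
  define F where "F d = {z :: 'a \<times> 'a. d \<le> norm (fst z - snd z)}" for d :: real
  have F[measurable]: "F d \<in> sets lebesgue" for d
  proof -
    have "closed (F d)" unfolding F_def by (intro closed_Collect_le continuous_intros)
    then show ?thesis by auto
  qed
  \<comment> \<open>The scale for the region near the diagonal, where the factor of \<open>En v\<close> is to be \<open>e\<close>.\<close>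
  define l where "l = e powr (1 / (1 - p))"
  have l: "0 < l" "l powr (1 - p) = e" using e p by (auto simp: l_def powr_powr)
  define N where "N d = (\<integral>z. indicator (- F d) z * \<bar>quot u z\<bar> powr p \<partial>lebesgue)" for d
  have N_int: "integrable lebesgue (\<lambda>z. indicator A z * \<bar>quot v z\<bar> powr p)"
    if "v \<in> V" "A \<in> sets lebesgue" for A v
    using integrable_mult_indicator[OF that(2) V_quot[OF that(1)]] by simp
  have "(\<lambda>n. N (1 / real (Suc n))) \<longlonglongrightarrow> (\<integral>z. 0 \<partial>(lebesgue :: ('a \<times> 'a) measure))"
    unfolding N_def
  proof (rule integral_dominated_convergence[where w = "\<lambda>z. \<bar>quot u z\<bar> powr p"])
    show "AE z in lebesgue. (\<lambda>n. indicator (- F (1 / real (Suc n))) z * \<bar>quot u z\<bar> powr p) \<longlonglongrightarrow> 0"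
    proof (rule AE_I2)
      fix z :: "'a \<times> 'a"
      show "(\<lambda>n. indicator (- F (1 / real (Suc n))) z * \<bar>quot u z\<bar> powr p) \<longlonglongrightarrow> 0"
      proof (cases "fst z = snd z")
        case False
        then obtain n0 where "1 / real (Suc n0) < norm (fst z - snd z)"
          using nat_approx_posE[of "norm (fst z - snd z)"] by auto
        then have "z \<in> F (1 / real (Suc n))" if "n0 \<le> n" for n
        proof -
          have "1 / real (Suc n) \<le> 1 / real (Suc n0)" using that by (intro frac_le) auto
          then show ?thesis using \<open>1 / real (Suc n0) < _\<close> by (simp add: F_def)
        qed
        then show ?thesis
          by (intro tendsto_eventually eventually_sequentiallyI[of n0]) auto
      qed (simp add: quot_def)
    qed
  qed (use V_quot[OF u] in \<open>auto simp: indicator_def\<close>)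
  then have "(\<lambda>n. N (1 / real (Suc n))) \<longlonglongrightarrow> 0" by simp
  then have "eventually (\<lambda>n. N (1 / real (Suc n)) < e / (2 * l)) sequentially"
    using e l by (intro order_tendstoD) auto
  then obtain n where n: "N (1 / real (Suc n)) < e / (2 * l)" by (auto dest: eventually_happens)
  define d where "d = 1 / real (Suc n)"
  have d: "0 < d" "N d < e / (2 * l)" using n by (auto simp: d_def)
  obtain C where C: "0 \<le> C"
    "\<And>u. u \<in> V \<Longrightarrow> (\<integral>z. indicator (F d) z * \<bar>quot u z\<bar> powr p \<partial>lebesgue) \<le> C * Lpow u"
    by (rule far_energy_le[OF d(1), folded F_def]) (rule that)
  \<comment> \<open>The scale for the far region, where the contribution of \<open>u\<close> is to be at most \<open>e / 2\<close>.\<close>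
  define l' where "l' = e / (2 * (En u + 1))"
  have l': "0 < l'" "l' * En u \<le> e / 2"
    using e En_nonneg[of u] by (auto simp: l'_def field_simps)
  show thesis
  proof (rule that[of "l' powr (1 - p) * C"])
    show "0 \<le> l' powr (1 - p) * C" using C by simp
    fix v assume v: "v \<in> V"
    note V_measurable[OF v, measurable]
    have "- F d \<in> sets lebesgue" using F[of d] by (metis Compl_in_sets_lebesgue)
    note int = N_int[OF u this] N_int[OF v F[of d]] V_quot[OF u] V_quot[OF v]
    let ?U = "\<lambda>z. \<bar>quot u z\<bar> powr p" and ?W = "\<lambda>z. \<bar>quot v z\<bar> powr p"
    have "pairing_bound u v \<le> (\<integral>z. l * (indicator (- F d) z * ?U z) + e * ?W z + l' * ?U z + l' powr (1 - p) * (indicator (F d) z * ?W z) \<partial>lebesgue)"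
      unfolding pairing_bound_def
    proof (rule integral_mono)
      fix z :: "'a \<times> 'a"
      show "\<bar>quot u z\<bar> powr (p - 1) * \<bar>quot v z\<bar> \<le> l * (indicator (- F d) z * ?U z) + e * ?W z + l' * ?U z + l' powr (1 - p) * (indicator (F d) z * ?W z)"
      proof (cases "z \<in> F d")
        case True
        moreover have "0 \<le> e * ?W z" using e by simp
        ultimately show ?thesis
          using powr_Young_scaled[OF p l'(1), of "quot u z" "quot v z"] by simp
      next
        case False
        then show ?thesis
          using powr_Young_scaled[OF p l(1), of "quot u z" "quot v z"] l l'
          by (simp add: add_increasing2)
      qed
    qed (use pairing_integrable[OF u v] int in \<open>auto intro!: Bochner_Integration.integrable_add integrable_mult_right\<close>)
    also have "\<dots> = l * N d + e * En v + l' * En u + l' powr (1 - p) * (\<integral>z. indicator (F d) z * ?W z \<partial>lebesgue)"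
      unfolding N_def En_def using int by simp
    also have "\<dots> \<le> e / 2 + e * En v + e / 2 + l' powr (1 - p) * (C * Lpow v)"
      using d l l' C(2)[OF v] by (intro add_mono mult_left_mono) (auto simp: field_simps)
    finally show "pairing_bound u v \<le> e * (1 + En v) + l' powr (1 - p) * C * Lpow v"
      by (simp add: algebra_simps)
  qed
qed

lemma pairing_bound_tendsto_0:
  assumes u: "u \<in> V" and v: "\<And>n. v n \<in> V" and bd: "\<And>n. En (v n) \<le> K"
    and lim: "(\<lambda>n. Lpow (v n)) \<longlonglongrightarrow> 0"
  shows "(\<lambda>n. pairing_bound u (v n)) \<longlonglongrightarrow> 0"
proof (rule LIMSEQ_I)
  fix e :: real assume e: "0 < e"
  have K: "0 \<le> K" using bd[of 0] En_nonneg[of "v 0"] by simp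
  define e' where "e' = e / (2 * (1 + K))"
  have e': "0 < e'" "e' * (1 + K) = e / 2" using e K by (auto simp: e'_def field_simps)
  obtain C where C: "0 \<le> C" "\<And>v. v \<in> V \<Longrightarrow> pairing_bound u v \<le> e' * (1 + En v) + C * Lpow v"
    using pairing_bound_le[OF u e'(1)] by metis
  have "(\<lambda>n. C * Lpow (v n)) \<longlonglongrightarrow> C * 0" by (intro tendsto_intros lim)
  then have "eventually (\<lambda>n. C * Lpow (v n) < e / 2) sequentially"
    using e by (intro order_tendstoD) auto
  then obtain n0 where n0: "\<And>n. n0 \<le> n \<Longrightarrow> C * Lpow (v n) < e / 2"
    by (auto simp: eventually_sequentially)
  show "\<exists>no. \<forall>n\<ge>no. norm (pairing_bound u (v n) - 0) < e"
  proof (intro exI allI impI)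
    fix n assume "n0 \<le> n"
    have "e' * (1 + En (v n)) \<le> e / 2"
      using bd[of n] e' by (metis add_left_mono less_imp_le mult_left_mono)
    then have "pairing_bound u (v n) < e"
      using C(2)[OF v, of n] n0[OF \<open>n0 \<le> n\<close>] by linarith
    moreover have "0 \<le> pairing_bound u (v n)" by (simp add: pairing_bound_def)
    ultimately show "norm (pairing_bound u (v n) - 0) < e" by simp
  qed
qed

end

section \<open>Completeness\<close>

lemma threshold_subsequence:
  fixes P :: "nat \<Rightarrow> nat \<Rightarrow> bool"
  assumes "\<And>n. \<exists>N. \<forall>m\<ge>N. P n m"
  obtains r where "strict_mono (r :: nat \<Rightarrow> nat)" "\<And>n m. r n \<le> m \<Longrightarrow> P n m"
proof -
  obtain g where g: "\<And>n m. g n \<le> m \<Longrightarrow> P n m" using assms by metis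
  define r where "r n = (\<Sum>i\<le>n. Suc (g i))" for n
  have "strict_mono r" by (rule strict_monoI_Suc) (simp add: r_def)
  moreover have "g n \<le> r n" for n by (cases n) (auto simp: r_def)
  then have "P n m" if "r n \<le> m" for n m by (rule g[OF order_trans[OF _ that]])
  ultimately show thesis by (rule that)
qed

lemma nn_integral_powr_Fatou:
  fixes f :: "nat \<Rightarrow> 'b \<Rightarrow> real"
  assumes "0 < p" and [measurable]: "\<And>n. f n \<in> borel_measurable M"
    and lim: "AE x in M. (\<lambda>n. f n x) \<longlonglongrightarrow> g x"
    and le: "\<And>n. (\<integral>\<^sup>+x. ennreal (\<bar>f n x\<bar> powr p) \<partial>M) \<le> C"
  shows "(\<integral>\<^sup>+x. ennreal (\<bar>g x\<bar> powr p) \<partial>M) \<le> C"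
proof -
  have "(\<integral>\<^sup>+x. ennreal (\<bar>g x\<bar> powr p) \<partial>M) = (\<integral>\<^sup>+x. liminf (\<lambda>n. ennreal (\<bar>f n x\<bar> powr p)) \<partial>M)"
  proof (rule nn_integral_cong_AE)
    show "AE x in M. ennreal (\<bar>g x\<bar> powr p) = liminf (\<lambda>n. ennreal (\<bar>f n x\<bar> powr p))"
      using lim
    proof eventually_elim
      fix x assume "(\<lambda>n. f n x) \<longlonglongrightarrow> g x"
      then have "(\<lambda>n. \<bar>f n x\<bar> powr p) \<longlonglongrightarrow> \<bar>g x\<bar> powr p"
        using \<open>0 < p\<close> by (intro tendsto_powr2 tendsto_intros) auto
      then have "(\<lambda>n. ennreal (\<bar>f n x\<bar> powr p)) \<longlonglongrightarrow> ennreal (\<bar>g x\<bar> powr p)" by (rule tendsto_ennrealI)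
      then show "ennreal (\<bar>g x\<bar> powr p) = liminf (\<lambda>n. ennreal (\<bar>f n x\<bar> powr p))"
        using lim_imp_Liminf[OF trivial_limit_sequentially] by metis
    qed
  qed
  also have "\<dots> \<le> liminf (\<lambda>n. \<integral>\<^sup>+x. ennreal (\<bar>f n x\<bar> powr p) \<partial>M)"
    by (rule nn_integral_liminf) measurable
  also have "\<dots> \<le> C"
    by (rule order_trans[OF Liminf_le_Limsup Limsup_bounded]) (auto simp: le)
  finally show ?thesis .
qed

text \<open>With \<open>l = (1/2) ^ n\<close>, the scaled Young inequality bounds an increment \<open>d\<close> by
  \<open>l + l powr (1 - p) * \<bar>d\<bar> powr p\<close>. The second term has integral at most \<open>(1/2) ^ n\<close>, so the increments
  are summable almost everywhere.\<close>
lemma AE_convergent_if_fast_Cauchy: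
  fixes f :: "nat \<Rightarrow> 'b \<Rightarrow> real"
  assumes p: "1 < p" and f[measurable]: "\<And>n. f n \<in> borel_measurable M"
    and le: "\<And>n. (\<integral>\<^sup>+x. ennreal (\<bar>f (Suc n) x - f n x\<bar> powr p) \<partial>M) \<le> ennreal (((1/2) ^ n) powr p)"
  shows "AE x in M. convergent (\<lambda>n. f n x)"
proof -
  define d where "d n x = f (Suc n) x - f n x" for n x
  define c where "c n = ((1/2::real) ^ n) powr (1 - p)" for n
  have [measurable]: "d n \<in> borel_measurable M" for n unfolding d_def[abs_def] by measurable
  have "(\<integral>\<^sup>+x. (\<Sum>n. ennreal (c n * \<bar>d n x\<bar> powr p)) \<partial>M) = (\<Sum>n. \<integral>\<^sup>+x. ennreal (c n * \<bar>d n x\<bar> powr p) \<partial>M)"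
    by (rule nn_integral_suminf) measurable
  also have "\<dots> \<le> (\<Sum>n. ennreal ((1/2) ^ n))"
  proof (rule suminf_le)
    fix n
    have "(\<integral>\<^sup>+x. ennreal (c n * \<bar>d n x\<bar> powr p) \<partial>M) = ennreal (c n) * (\<integral>\<^sup>+x. ennreal (\<bar>d n x\<bar> powr p) \<partial>M)"
      by (simp add: ennreal_mult nn_integral_cmult c_def)
    also have "\<dots> \<le> ennreal (c n) * ennreal (((1/2) ^ n) powr p)"
      using le[of n] by (intro mult_left_mono) (auto simp: d_def)
    also have "\<dots> = ennreal (c n * ((1/2) ^ n) powr p)" by (simp add: ennreal_mult c_def)
    also have "c n * ((1/2) ^ n) powr p = (1/2) ^ n" by (simp add: c_def powr_add[symmetric])
    finally show "(\<integral>\<^sup>+x. ennreal (c n * \<bar>d n x\<bar> powr p) \<partial>M) \<le> ennreal ((1/2) ^ n)" .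
  qed auto
  also have "\<dots> = ennreal (\<Sum>n. (1/2) ^ n)"
    by (rule suminf_ennreal2) (auto intro: summable_geometric)
  also have "\<dots> < \<infinity>" by simp
  finally have "AE x in M. (\<Sum>n. ennreal (c n * \<bar>d n x\<bar> powr p)) \<noteq> \<infinity>"
    by (intro nn_integral_PInf_AE) auto
  then show ?thesis
  proof eventually_elim
    fix x assume fin: "(\<Sum>n. ennreal (c n * \<bar>d n x\<bar> powr p)) \<noteq> \<infinity>"
    have "summable (\<lambda>n. c n * \<bar>d n x\<bar> powr p)"
      by (rule summable_suminf_not_top) (use fin in \<open>auto simp: c_def\<close>)
    moreover have "summable (\<lambda>n. (1/2::real) ^ n)" by (rule summable_geometric) simp
    ultimately have "summable (\<lambda>n. (1/2) ^ n + c n * \<bar>d n x\<bar> powr p)" by (intro summable_add)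
    moreover have "norm (d n x) \<le> (1/2) ^ n + c n * \<bar>d n x\<bar> powr p" for n
      using powr_Young_scaled[OF p, of "(1/2) ^ n" 1 "d n x"] by (simp add: c_def)
    ultimately have "summable (\<lambda>n. d n x)"
      by (rule summable_comparison_test'[where N = 0])
    then have "convergent (\<lambda>n. \<Sum>i<n. d i x)" by (simp add: summable_iff_convergent)
    moreover have "(\<Sum>i<n. d i x) = f n x - f 0 x" for n
      unfolding d_def by (rule sum_lessThan_telescope)
    ultimately have "convergent (\<lambda>n. f n x - f 0 x + f 0 x)"
      by (intro convergent_add convergent_const) simp
    then show "convergent (\<lambda>n. f n x)" by simp
  qed
qed

context nonlocal_space
begin

text \<open>By the Poincare inequality a Cauchy sequence has a fast subsequence in the \<open>p\<close>-th mean, which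
  converges almost everywhere, and then so do its difference quotients. Fatou's lemma bounds the energy
  of the limit and of its distance to the terms of the sequence.\<close>
lemma V_complete:
  assumes v: "\<And>n. v n \<in> V"
    and Cauchy: "\<And>e. 0 < e \<Longrightarrow> \<exists>N. \<forall>m\<ge>N. \<forall>n\<ge>N. En (\<lambda>x. v m x - v n x) < e"
  obtains u where "u \<in> V" "(\<lambda>n. En (\<lambda>x. v n x - u x)) \<longlonglongrightarrow> 0"
proof -
  obtain C where C: "0 \<le> C" "\<And>u. u \<in> V \<Longrightarrow> Lpow u \<le> C * En u" using Poincare by blast
  note vm = V_measurable[OF v] note vm[measurable]
  have vd: "(\<lambda>x. v m x - v n x) \<in> V" for m n by (intro V_diff v)
  have "\<exists>N. \<forall>m\<ge>N. \<forall>i\<ge>m. Lpow (\<lambda>x. v i x - v m x) \<le> ((1/2) ^ n) powr p" for n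
  proof -
    obtain N where N: "\<And>i m. N \<le> i \<Longrightarrow> N \<le> m \<Longrightarrow> En (\<lambda>x. v i x - v m x) < ((1/2) ^ n) powr p / (C + 1)"
      using Cauchy[of "((1/2) ^ n) powr p / (C + 1)"] C(1) by (auto simp: add_nonneg_pos)
    show ?thesis
    proof (intro exI allI impI)
      fix m i assume "N \<le> m" "m \<le> i"
      then have "(C + 1) * En (\<lambda>x. v i x - v m x) \<le> ((1/2) ^ n) powr p"
        using N[of i m] C(1) by (simp add: field_simps)
      moreover have "C * En (\<lambda>x. v i x - v m x) \<le> (C + 1) * En (\<lambda>x. v i x - v m x)"
        by (intro mult_right_mono En_nonneg) simp
      ultimately show "Lpow (\<lambda>x. v i x - v m x) \<le> ((1/2) ^ n) powr p"
        using C(2)[OF vd, of i m] by linarith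
    qed
  qed
  then obtain r where r: "strict_mono (r :: nat \<Rightarrow> nat)"
    and r_le: "\<And>n m. r n \<le> m \<Longrightarrow> \<forall>i\<ge>m. Lpow (\<lambda>x. v i x - v m x) \<le> ((1/2) ^ n) powr p"
    by (rule threshold_subsequence[of "\<lambda>n m. \<forall>i\<ge>m. Lpow (\<lambda>x. v i x - v m x) \<le> ((1/2) ^ n) powr p"])
      (rule that)
  have "AE x in lebesgue. convergent (\<lambda>n. v (r n) x)"
  proof (rule AE_convergent_if_fast_Cauchy[OF p vm])
    fix n
    have "Lpow (\<lambda>x. v (r (Suc n)) x - v (r n) x) \<le> ((1/2) ^ n) powr p"
      using r_le[of n "r n"] r by (simp add: strict_mono_less_eq)
    then show "(\<integral>\<^sup>+x. ennreal (\<bar>v (r (Suc n)) x - v (r n) x\<bar> powr p) \<partial>lebesgue) \<le> ennreal (((1/2) ^ n) powr p)"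
      unfolding nn_integral_Lpow[OF vd] by (rule ennreal_leI)
  qed
  define u where "u x = lim (\<lambda>n. v (r n) x)" for x
  have um[measurable]: "u \<in> borel_measurable lebesgue"
    unfolding u_def[abs_def] by (rule borel_measurable_lim_metric) measurable
  have lim: "AE x in lebesgue. (\<lambda>n. v (r n) x) \<longlonglongrightarrow> u x"
    using \<open>AE x in lebesgue. convergent _\<close> by eventually_elim (simp add: u_def convergent_LIMSEQ_iff)
  have qlim: "AE z in lebesgue. (\<lambda>n. quot (v (r n)) z) \<longlonglongrightarrow> quot u z"
    using AE_fst[OF lim] AE_snd[OF lim] by eventually_elim (auto simp: quot_def intro!: tendsto_intros)
  obtain N where N: "\<And>m n. N \<le> m \<Longrightarrow> N \<le> n \<Longrightarrow> En (\<lambda>x. v m x - v n x) < 1"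
    using Cauchy[of 1] by auto
  have rn: "n \<le> r n" for n using r by (rule seq_suble)
  define B where "B = 2 powr p * (1 + En (v N))"
  have B: "En (v (r (n + N))) \<le> B" for n
  proof -
    have "En (\<lambda>x. (v (r (n + N)) x - v N x) + v N x) \<le> 2 powr p * (En (\<lambda>x. v (r (n + N)) x - v N x) + En (v N))"
      by (rule En_add_le[OF vd v])
    also have "\<dots> \<le> B"
      unfolding B_def using N[of "r (n + N)" N] rn[of "n + N"] by (intro mult_left_mono add_mono) auto
    finally show ?thesis by simp
  qed
  have tail: "(\<lambda>n. g (n + m)) \<longlonglongrightarrow> l" if "g \<longlonglongrightarrow> l" for g :: "nat \<Rightarrow> real" and l m
    using that by (simp add: LIMSEQ_ignore_initial_segment)
  have "u \<in> V"
    unfolding V_iff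
  proof (intro conjI um)
    have "(\<integral>\<^sup>+x. ennreal (\<bar>u x\<bar> powr p) \<partial>lebesgue) \<le> ennreal (C * B)"
    proof (rule nn_integral_powr_Fatou[where f = "\<lambda>n. v (r (n + N))"])
      show "AE x in lebesgue. (\<lambda>n. v (r (n + N)) x) \<longlonglongrightarrow> u x"
        using lim by eventually_elim (rule tail)
      show "(\<integral>\<^sup>+x. ennreal (\<bar>v (r (n + N)) x\<bar> powr p) \<partial>lebesgue) \<le> ennreal (C * B)" for n
        unfolding nn_integral_Lpow[OF v]
        by (intro ennreal_leI order_trans[OF C(2)[OF v]] mult_left_mono B C)
    qed (use p in auto)
    then show "integrable lebesgue (\<lambda>x. \<bar>u x\<bar> powr p)"
      by (intro integrableI_bounded) (auto simp: le_less_trans)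
    have "(\<integral>\<^sup>+z. ennreal (\<bar>quot u z\<bar> powr p) \<partial>lebesgue) \<le> ennreal B"
    proof (rule nn_integral_powr_Fatou[where f = "\<lambda>n. quot (v (r (n + N)))"])
      show "AE z in lebesgue. (\<lambda>n. quot (v (r (n + N))) z) \<longlonglongrightarrow> quot u z"
        using qlim by eventually_elim (rule tail)
      show "(\<integral>\<^sup>+z. ennreal (\<bar>quot (v (r (n + N))) z\<bar> powr p) \<partial>lebesgue) \<le> ennreal B" for n
        unfolding nn_integral_En[OF v] by (intro ennreal_leI B)
    qed (use p in auto)
    then show "integrable lebesgue (\<lambda>z. \<bar>quot u z\<bar> powr p)"
      by (intro integrableI_bounded) (auto simp: le_less_trans)
    have "AE x in lebesgue. \<forall>n. x \<notin> \<Omega> \<longrightarrow> v (r n) x = 0"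
      unfolding AE_all_countable using V_zero[OF v] by blast
    then show "AE x in lebesgue. x \<notin> \<Omega> \<longrightarrow> u x = 0"
      using lim by eventually_elim (auto simp: LIMSEQ_const_iff)
  qed
  moreover have "(\<lambda>n. En (\<lambda>x. v n x - u x)) \<longlonglongrightarrow> 0"
  proof (rule LIMSEQ_I)
    fix e :: real assume e: "0 < e"
    obtain M where M: "\<And>m n. M \<le> m \<Longrightarrow> M \<le> n \<Longrightarrow> En (\<lambda>x. v m x - v n x) < e / 2"
      using Cauchy[of "e / 2"] e by auto
    show "\<exists>no. \<forall>n\<ge>no. norm (En (\<lambda>x. v n x - u x) - 0) < e"
    proof (intro exI allI impI)
      fix n assume n: "M \<le> n"
      have "(\<integral>\<^sup>+z. ennreal (\<bar>quot (\<lambda>x. v n x - u x) z\<bar> powr p) \<partial>lebesgue) \<le> ennreal (e / 2)"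
      proof (rule nn_integral_powr_Fatou[where f = "\<lambda>i. quot (\<lambda>x. v n x - v (r (i + M)) x)"])
        show "AE z in lebesgue. (\<lambda>i. quot (\<lambda>x. v n x - v (r (i + M)) x) z) \<longlonglongrightarrow> quot (\<lambda>x. v n x - u x) z"
          using qlim unfolding quot_diff by eventually_elim (intro tendsto_intros tail)
        show "(\<integral>\<^sup>+z. ennreal (\<bar>quot (\<lambda>x. v n x - v (r (i + M)) x) z\<bar> powr p) \<partial>lebesgue) \<le> ennreal (e / 2)" for i
          unfolding nn_integral_En[OF vd] using M[OF n, of "r (i + M)"] rn[of "i + M"]
          by (intro ennreal_leI) auto
      qed (use p in auto)
      then have "En (\<lambda>x. v n x - u x) \<le> e / 2"
        unfolding nn_integral_En[OF V_diff[OF v \<open>u \<in> V\<close>]] using e by simp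
      then show "norm (En (\<lambda>x. v n x - u x) - 0) < e" using e En_nonneg by simp
    qed
  qed
  ultimately show thesis by (rule that)
qed

end

section \<open>Compactness in the \<open>p\<close>-th mean\<close>

text \<open>Jensen's inequality for the mean over \<open>A\<close>: integrate the tangent line at the mean.\<close>
lemma powr_mean_le:
  fixes g :: "'b \<Rightarrow> real"
  assumes p: "1 < p" and A: "A \<in> sets M" "emeasure M A < \<infinity>" "0 < measure M A"
    and g: "integrable M (\<lambda>x. indicator A x * g x)" "integrable M (\<lambda>x. indicator A x * \<bar>g x\<bar> powr p)"
  shows "measure M A * \<bar>(\<integral>x. indicator A x * g x \<partial>M) / measure M A\<bar> powr p
    \<le> (\<integral>x. indicator A x * \<bar>g x\<bar> powr p \<partial>M)"
proof -
  define m where "m = measure M A"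
  define c where "c = (\<integral>x. indicator A x * g x \<partial>M) / m"
  have ind: "integrable M (indicator A :: 'b \<Rightarrow> real)" using A by simp
  have AM: "measure M (A \<inter> space M) = m"
    using A sets.sets_into_space[OF A(1)] by (simp add: m_def Int_absorb2)
  have eq: "indicator A x * (\<bar>c\<bar> powr p + p * (signed_powr p c * (g x - c))) =
      (\<bar>c\<bar> powr p - p * signed_powr p c * c) * indicator A x + p * signed_powr p c * (indicator A x * g x)" for x
    by (simp add: algebra_simps)
  have "(\<integral>x. indicator A x * (\<bar>c\<bar> powr p + p * (signed_powr p c * (g x - c))) \<partial>M) \<le> (\<integral>x. indicator A x * \<bar>g x\<bar> powr p \<partial>M)"
    unfolding eq
  proof (rule integral_mono)
    show "(\<bar>c\<bar> powr p - p * signed_powr p c * c) * indicator A x + p * signed_powr p c * (indicator A x * g x) \<le> indicator A x * \<bar>g x\<bar> powr p" for x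
      unfolding eq[symmetric] by (intro mult_left_mono powr_tangent p) auto
  qed (use ind g in \<open>auto intro!: Bochner_Integration.integrable_add integrable_mult_right\<close>)
  also have "(\<integral>x. indicator A x * (\<bar>c\<bar> powr p + p * (signed_powr p c * (g x - c))) \<partial>M)
      = (\<bar>c\<bar> powr p - p * signed_powr p c * c) * m + p * signed_powr p c * (c * m)"
    unfolding eq using ind g A by (subst Bochner_Integration.integral_add) (auto simp: AM c_def m_def)
  also have "\<dots> = m * \<bar>c\<bar> powr p" by (simp add: algebra_simps)
  finally show ?thesis by (simp add: c_def m_def)
qed

context nonlocal_space
begin

lemma abs_le_1_plus_powr: "\<bar>a\<bar> \<le> 1 + \<bar>a\<bar> powr p" for a :: real
  using powr_Young_scaled[OF p, of 1 1 a] by simp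

lemma V_integrable_ball:
  assumes u: "u \<in> V"
  shows "integrable lebesgue (\<lambda>x. indicator (ball y r) x * u x)"
    and "integrable lebesgue (\<lambda>x. indicator (ball y r) x * \<bar>u x\<bar> powr p)"
proof -
  note V_measurable[OF u, measurable]
  have B: "ball y r \<in> sets lebesgue" "emeasure lebesgue (ball y r) < \<infinity>"
    using emeasure_bounded_finite[OF bounded_ball] by auto
  show p_int: "integrable lebesgue (\<lambda>x. indicator (ball y r) x * \<bar>u x\<bar> powr p)"
    using integrable_mult_indicator[OF B(1) V_powr[OF u]] by simp
  show "integrable lebesgue (\<lambda>x. indicator (ball y r) x * u x)"
  proof (rule Bochner_Integration.integrable_bound)
    show "integrable lebesgue (\<lambda>x. indicator (ball y r) x + indicator (ball y r) x * \<bar>u x\<bar> powr p :: real)"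
      using p_int B by (intro Bochner_Integration.integrable_add integrable_real_indicator)
    show "(\<lambda>x. indicator (ball y r) x * u x) \<in> borel_measurable lebesgue"
      using B(1) by measurable
    show "AE x in lebesgue. norm (indicator (ball y r) x * u x) \<le> norm (indicator (ball y r) x + indicator (ball y r) x * \<bar>u x\<bar> powr p :: real)"
      using abs_le_1_plus_powr by (intro AE_I2) (auto simp: indicator_def)
  qed
qed

lemma ball_deviation_le:
  fixes a :: real and y :: 'a
  assumes u: "u \<in> V" "u \<in> borel_measurable borel" and r: "0 < r"
  defines "m \<equiv> measure lebesgue (ball y r)"
  shows "ennreal (m * \<bar>a - (\<integral>x. indicator (ball y r) x * u x \<partial>lebesgue) / m\<bar> powr p)
    \<le> (\<integral>\<^sup>+x. indicator (ball y r) x * ennreal (\<bar>a - u x\<bar> powr p) \<partial>lborel)"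
proof -
  note V_measurable[OF u(1), measurable] 
  let ?B = "ball y r"
  have B[measurable]: "?B \<in> sets lebesgue" and fin: "emeasure lebesgue ?B < \<infinity>"
    using emeasure_bounded_finite[OF bounded_ball] by auto
  have m: "0 < m" using content_ball_pos[OF r, of y] by (simp add: m_def)
  have ind: "integrable lebesgue (indicator ?B :: 'a \<Rightarrow> real)" using B fin by (rule integrable_real_indicator)
  have 1: "integrable lebesgue (\<lambda>x. indicator ?B x * (a - u x))"
    using Bochner_Integration.integrable_diff[OF integrable_mult_right[OF ind, of a] V_integrable_ball(1)[OF u(1), of y r]]
    by (simp add: algebra_simps)
  have 2: "integrable lebesgue (\<lambda>x. indicator ?B x * \<bar>a - u x\<bar> powr p)"
  proof (rule Bochner_Integration.integrable_bound)
    show "integrable lebesgue (\<lambda>x. 2 powr p * \<bar>a\<bar> powr p * indicator ?B x + 2 powr p * (indicator ?B x * \<bar>u x\<bar> powr p))"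
      using ind V_integrable_ball(2)[OF u(1), of y r] by (intro Bochner_Integration.integrable_add integrable_mult_right)
    show "(\<lambda>x. indicator ?B x * \<bar>a - u x\<bar> powr p) \<in> borel_measurable lebesgue" by measurable
    show "AE x in lebesgue. norm (indicator ?B x * \<bar>a - u x\<bar> powr p) \<le>
        norm (2 powr p * \<bar>a\<bar> powr p * indicator ?B x + 2 powr p * (indicator ?B x * \<bar>u x\<bar> powr p))"
      using powr_diff_le[of p a] p by (intro AE_I2) (auto simp: indicator_def distrib_left)
  qed
  have "(\<integral>x. indicator ?B x * (a - u x) \<partial>lebesgue) = (\<integral>x. a * indicator ?B x - indicator ?B x * u x \<partial>lebesgue)"
    by (simp add: algebra_simps)
  also have "\<dots> = a * m - (\<integral>x. indicator ?B x * u x \<partial>lebesgue)"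
    using ind V_integrable_ball(1)[OF u(1), of y r] B
    by (subst Bochner_Integration.integral_diff) (auto simp: m_def)
  finally have eq: "(\<integral>x. indicator ?B x * (a - u x) \<partial>lebesgue) / m = a - (\<integral>x. indicator ?B x * u x \<partial>lebesgue) / m"
    using m by (simp add: diff_divide_distrib)
  have "m * \<bar>a - (\<integral>x. indicator ?B x * u x \<partial>lebesgue) / m\<bar> powr p \<le> (\<integral>x. indicator ?B x * \<bar>a - u x\<bar> powr p \<partial>lebesgue)"
    using powr_mean_le[OF p B fin _ 1 2] m unfolding m_def[symmetric] eq by simp
  then have "ennreal (m * \<bar>a - (\<integral>x. indicator ?B x * u x \<partial>lebesgue) / m\<bar> powr p) \<le> ennreal (\<integral>x. indicator ?B x * \<bar>a - u x\<bar> powr p \<partial>lebesgue)"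
    by (rule ennreal_leI)
  also have "\<dots> = (\<integral>\<^sup>+x. ennreal (indicator ?B x * \<bar>a - u x\<bar> powr p) \<partial>lebesgue)"
    using 2 by (intro nn_integral_eq_integral[symmetric]) auto
  also have "\<dots> = (\<integral>\<^sup>+x. indicator ?B x * ennreal (\<bar>a - u x\<bar> powr p) \<partial>lborel)"
    unfolding nn_integral_completion by (intro nn_integral_cong) (auto simp: indicator_def)
  finally show ?thesis .
qed

text \<open>The covering balls are made disjoint, and on the piece inside a ball the function is replaced by its
  average over the whole ball, whose measure \<open>m\<close> is known. Jensen's inequality bounds the error by
  differences over distances below \<open>2 * r\<close>, hence by the energy.\<close>
lemma Lpow_le_ball_averages_borel:
  fixes y :: "nat \<Rightarrow> 'a"
  assumes u: "u \<in> V" "u \<in> borel_measurable borel" and r: "0 < r" and cover: "\<Omega> \<subseteq> (\<Union>i<n. ball (y i) r)"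
  defines "m \<equiv> measure lebesgue (ball (0::'a) r)"
  shows "Lpow u \<le> 2 powr p * ((2 * r) powr (real DIM('a) + s * p) / c0 / m * En u
     + (\<Sum>i<n. m * \<bar>(\<integral>x. indicator (ball (y i) r) x * u x \<partial>lebesgue) / m\<bar> powr p))"
proof -
  note u(2)[measurable]
  define B where "B i = (if i < n then ball (y i) r else {})" for i
  define A where "A = disjointed B"
  define c where "c i = (\<integral>x. indicator (ball (y i) r) x * u x \<partial>lebesgue) / m" for i
  define D where "D = (2 * r) powr (real DIM('a) + s * p) / c0"
  have D: "0 \<le> D" using c0 by (simp add: D_def)
  have m_eq: "measure lebesgue (ball z r) = m" for z :: 'a
    using content_ball_conv_unit_ball[of r z] content_ball_conv_unit_ball[of r "0::'a"] r by (simp add: m_def)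
  have m: "0 < m" using content_ball_pos[OF r, of "0::'a"] by (simp add: m_def)
  have [measurable]: "ball (y i) r \<in> sets borel" for i by simp
  have B_meas: "B i \<in> sets borel" for i by (simp add: B_def)
  have A_meas[measurable]: "A i \<in> sets borel" for i
    unfolding A_def using sets.range_disjointed_sets[of B borel] B_meas by auto
  have A_sub: "A i \<subseteq> ball (y i) r" if "i < n" for i
    using disjointed_subset[of B i] that by (simp add: A_def B_def)
  have "(\<Union>i\<in>{0..<n}. A i) = (\<Union>i\<in>{0..<n}. B i)" unfolding A_def by (rule finite_UN_disjointed_eq)
  then have A_cover: "\<Omega> \<subseteq> (\<Union>i<n. A i)" using cover by (auto simp: B_def atLeast0LessThan)
  have disj: "disjoint_family_on A {..<n}"
    using disjoint_family_disjointed[of B] unfolding A_def by (rule disjoint_family_on_mono[rotated]) simp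
  have sum_ind: "(\<Sum>i<n. indicator (A i) x :: ennreal) = indicator (\<Union>i<n. A i) x" for x
    by (rule indicator_UN_disjoint[symmetric]) (use disj in auto)
  define I where "I i = (\<integral>\<^sup>+x. indicator (A i) x * ennreal (\<bar>u x - c i\<bar> powr p) \<partial>lborel)" for i
  have dev: "(\<Sum>i<n. ennreal m * I i) \<le> ennreal D * ennreal (En u)"
  proof -
    have "(\<Sum>i<n. ennreal m * I i) \<le> (\<Sum>i<n. \<integral>\<^sup>+x. \<integral>\<^sup>+x'. indicator (A i) x * indicator (ball (y i) r) x' * ennreal (\<bar>u x - u x'\<bar> powr p) \<partial>lborel \<partial>lborel)"
    proof (rule sum_mono)
      fix i
      have "ennreal m * I i = (\<integral>\<^sup>+x. indicator (A i) x * ennreal (m * \<bar>u x - c i\<bar> powr p) \<partial>lborel)"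
        unfolding I_def using m
        by (subst nn_integral_cmult[symmetric]) (auto intro!: nn_integral_cong simp: ennreal_mult mult_ac)
      also have "\<dots> \<le> (\<integral>\<^sup>+x. indicator (A i) x * (\<integral>\<^sup>+x'. indicator (ball (y i) r) x' * ennreal (\<bar>u x - u x'\<bar> powr p) \<partial>lborel) \<partial>lborel)"
        using ball_deviation_le[OF u r, of "y i"] unfolding m_eq c_def[symmetric]
        by (intro nn_integral_mono mult_left_mono) auto
      also have "\<dots> = (\<integral>\<^sup>+x. \<integral>\<^sup>+x'. indicator (A i) x * indicator (ball (y i) r) x' * ennreal (\<bar>u x - u x'\<bar> powr p) \<partial>lborel \<partial>lborel)"
        by (subst nn_integral_cmult[symmetric]) (auto simp: mult_ac)
      finally show "ennreal m * I i \<le> \<dots>" .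
    qed
    also have "\<dots> = (\<Sum>i<n. \<integral>\<^sup>+z. indicator (A i) (fst z) * indicator (ball (y i) r) (snd z) * ennreal (\<bar>u (fst z) - u (snd z)\<bar> powr p) \<partial>lebesgue)"
      by (subst nn_integral_lebesgue_pair(1)) auto
    also have "\<dots> = (\<integral>\<^sup>+z. (\<Sum>i<n. indicator (A i) (fst z) * indicator (ball (y i) r) (snd z) * ennreal (\<bar>u (fst z) - u (snd z)\<bar> powr p)) \<partial>lebesgue)"
      unfolding nn_integral_completion by (subst nn_integral_sum) auto
    also have "\<dots> \<le> (\<integral>\<^sup>+z. ennreal D * ennreal (\<bar>quot u z\<bar> powr p) \<partial>lebesgue)"
    proof (rule nn_integral_mono)
      fix z :: "'a \<times> 'a"
      have "(\<Sum>i<n. indicator (A i) (fst z) * indicator (ball (y i) r) (snd z) * ennreal (\<bar>u (fst z) - u (snd z)\<bar> powr p))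
         \<le> (\<Sum>i<n. indicator (A i) (fst z) * (ennreal D * ennreal (\<bar>quot u z\<bar> powr p)))"
      proof (rule sum_mono)
        fix i assume "i \<in> {..<n}"
        show "indicator (A i) (fst z) * indicator (ball (y i) r) (snd z) * ennreal (\<bar>u (fst z) - u (snd z)\<bar> powr p)
         \<le> indicator (A i) (fst z) * (ennreal D * ennreal (\<bar>quot u z\<bar> powr p))"
        proof (cases "fst z \<in> A i \<and> snd z \<in> ball (y i) r")
          case True
          then have "dist (y i) (fst z) < r" "dist (y i) (snd z) < r" using A_sub[of i] \<open>i \<in> _\<close> subsetD[of "A i" "ball (y i) r" "fst z"] by auto
          then have "dist (fst z) (snd z) \<le> 2 * r" using dist_triangle3[of "fst z" "snd z" "y i"] by linarith
          then show ?thesis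
            using True difference_le_quot[of z "2 * r" u] D
            by (simp add: dist_norm D_def ennreal_mult[symmetric] ennreal_leI)
        qed (auto simp: indicator_def)
      qed
      also have "\<dots> = indicator (\<Union>i<n. A i) (fst z) * (ennreal D * ennreal (\<bar>quot u z\<bar> powr p))"
        by (simp only: sum_distrib_right[symmetric] sum_ind)
      also have "\<dots> \<le> ennreal D * ennreal (\<bar>quot u z\<bar> powr p)" by (auto simp: indicator_def)
      finally show "(\<Sum>i<n. indicator (A i) (fst z) * indicator (ball (y i) r) (snd z) * ennreal (\<bar>u (fst z) - u (snd z)\<bar> powr p)) \<le> \<dots>" .
    qed
    also have "\<dots> = ennreal D * ennreal (En u)"
      using V_measurable[OF u(1)] by (subst nn_integral_cmult) (auto simp: nn_integral_En[OF u(1)])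
    finally show ?thesis .
  qed
  have "ennreal (Lpow u) = (\<integral>\<^sup>+x. ennreal (\<bar>u x\<bar> powr p) \<partial>lborel)"
    using nn_integral_Lpow[OF u(1)] by (simp add: nn_integral_completion)
  also have "\<dots> \<le> (\<integral>\<^sup>+x. (\<Sum>i<n. indicator (A i) x * (ennreal (2 powr p) * (ennreal (\<bar>u x - c i\<bar> powr p) + ennreal (\<bar>c i\<bar> powr p)))) \<partial>lborel)"
  proof (rule nn_integral_mono_AE)
    have "AE x in lborel. x \<notin> \<Omega> \<longrightarrow> u x = 0" using V_zero[OF u(1)] by (simp add: AE_completion_iff)
    then show "AE x in lborel. ennreal (\<bar>u x\<bar> powr p) \<le> (\<Sum>i<n. indicator (A i) x * (ennreal (2 powr p) * (ennreal (\<bar>u x - c i\<bar> powr p) + ennreal (\<bar>c i\<bar> powr p))))"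
    proof eventually_elim
      fix x assume x: "x \<notin> \<Omega> \<longrightarrow> u x = 0"
      show "ennreal (\<bar>u x\<bar> powr p) \<le> (\<Sum>i<n. indicator (A i) x * (ennreal (2 powr p) * (ennreal (\<bar>u x - c i\<bar> powr p) + ennreal (\<bar>c i\<bar> powr p))))"
      proof (cases "x \<in> \<Omega>")
        case False then show ?thesis using x p by simp
      next
        case True
        then have "x \<in> (\<Union>i<n. A i)" using A_cover by blast
        then have "1 = (\<Sum>i<n. indicator (A i) x :: ennreal)"
          unfolding sum_ind by (rule indicator_simps(1)[symmetric])
        then have "ennreal (\<bar>u x\<bar> powr p) = (\<Sum>i<n. indicator (A i) x * ennreal (\<bar>u x\<bar> powr p))"
          by (metis mult_1 sum_distrib_right)
        also have "\<dots> \<le> (\<Sum>i<n. indicator (A i) x * (ennreal (2 powr p) * (ennreal (\<bar>u x - c i\<bar> powr p) + ennreal (\<bar>c i\<bar> powr p))))"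
        proof (intro sum_mono mult_left_mono)
          fix i
          have "\<bar>u x\<bar> powr p \<le> 2 powr p * (\<bar>u x - c i\<bar> powr p + \<bar>c i\<bar> powr p)"
            using powr_add_le[of p "u x - c i" "c i"] p by simp
          then show "ennreal (\<bar>u x\<bar> powr p) \<le> ennreal (2 powr p) * (ennreal (\<bar>u x - c i\<bar> powr p) + ennreal (\<bar>c i\<bar> powr p))"
            by (simp add: ennreal_mult[symmetric] ennreal_plus[symmetric] ennreal_leI del: ennreal_plus)
        qed auto
        finally show ?thesis .
      qed
    qed
  qed
  also have "\<dots> = (\<integral>\<^sup>+x. ennreal (2 powr p) * (\<Sum>i<n. indicator (A i) x * ennreal (\<bar>u x - c i\<bar> powr p) + ennreal (\<bar>c i\<bar> powr p) * indicator (A i) x) \<partial>lborel)"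
    by (simp add: sum_distrib_left distrib_left mult_ac)
  also have "\<dots> = ennreal (2 powr p) * (\<Sum>i<n. I i + ennreal (\<bar>c i\<bar> powr p) * emeasure lborel (A i))"
    unfolding I_def by (subst nn_integral_cmult) (auto simp: nn_integral_sum nn_integral_add nn_integral_cmult_indicator)
  also have "\<dots> \<le> ennreal (2 powr p) * (\<Sum>i<n. I i + ennreal (\<bar>c i\<bar> powr p) * ennreal m)"
  proof (intro mult_left_mono sum_mono add_left_mono)
    fix i assume "i \<in> {..<n}"
    then have "emeasure lborel (A i) \<le> emeasure lborel (ball (y i) r)" using A_sub by (intro emeasure_mono) auto
    also have "\<dots> = ennreal m"
      using m_eq[of "y i"] emeasure_lborel_ball_finite[of "y i" r] by (simp add: emeasure_eq_ennreal_measure)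
    finally show "emeasure lborel (A i) \<le> ennreal m" .
  qed auto
  also have "(\<Sum>i<n. I i) \<le> ennreal (D / m * En u)"
  proof -
    have "(\<Sum>i<n. I i) = ennreal (1 / m) * (\<Sum>i<n. ennreal m * I i)"
      using m by (simp add: sum_distrib_left mult.assoc[symmetric] ennreal_mult[symmetric])
    also have "\<dots> \<le> ennreal (1 / m) * (ennreal D * ennreal (En u))" by (intro mult_left_mono dev) simp
    also have "\<dots> = ennreal (D / m * En u)" using m D En_nonneg[of u] by (simp add: ennreal_mult[symmetric])
    finally show ?thesis .
  qed
  then have "ennreal (2 powr p) * (\<Sum>i<n. I i + ennreal (\<bar>c i\<bar> powr p) * ennreal m)
      \<le> ennreal (2 powr p) * (ennreal (D / m * En u) + (\<Sum>i<n. ennreal (\<bar>c i\<bar> powr p) * ennreal m))"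
    unfolding sum.distrib by (intro mult_left_mono add_right_mono) auto
  also have "\<dots> = ennreal (2 powr p * (D / m * En u + (\<Sum>i<n. m * \<bar>c i\<bar> powr p)))"
    using m D En_nonneg[of u]
    by (simp add: ennreal_mult[symmetric] sum_ennreal ennreal_plus[symmetric] sum_nonneg mult.commute del: ennreal_plus)
  finally have "Lpow u \<le> 2 powr p * (D / m * En u + (\<Sum>i<n. m * \<bar>c i\<bar> powr p))"
    using m D En_nonneg[of u] by (subst (asm) ennreal_le_iff) (auto intro!: mult_nonneg_nonneg add_nonneg_nonneg sum_nonneg)
  then show ?thesis by (simp add: D_def c_def)
qed

text \<open>The factor of the energy in the previous estimate behaves like
  \<open>r powr (N + s * p) / r powr N = r powr (s * p)\<close>, where \<open>N\<close> is the dimension, and so is at most \<open>e\<close>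
  for small \<open>r\<close>. What remains are finitely many linear functionals.\<close>
lemma Lpow_le_ball_averages:
  assumes e: "0 < e"
  shows "\<exists>r n y K. 0 \<le> K \<and> (\<forall>u\<in>V. Lpow u \<le> e * En u +
        K * (\<Sum>i<(n::nat). \<bar>\<integral>x. indicator (ball (y i :: 'a) r) x * u x \<partial>lebesgue\<bar> powr p))"
proof -
  define \<omega> where "\<omega> = measure lebesgue (ball (0::'a) 1)"
  have \<omega>: "0 < \<omega>" using content_ball_pos[of 1 "0::'a"] by (simp add: \<omega>_def)
  define c1 where "c1 = 2 powr p * 2 powr (real DIM('a) + s * p) / (c0 * \<omega>)"
  have c1: "0 < c1" using c0 \<omega> by (simp add: c1_def)
  define r where "r = (e / c1) powr (1 / (s * p))"
  have r: "0 < r" using e c1 by (simp add: r_def)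
  have sp: "0 < s * p" using s p by simp
  have rsp: "r powr (s * p) = e / c1" using e c1 s p by (simp add: r_def powr_powr)
  define m where "m = measure lebesgue (ball (0::'a) r)"
  have m: "m = r ^ DIM('a) * \<omega>" "0 < m"
    using content_ball_conv_unit_ball[of r "0::'a"] r \<omega> by (auto simp: m_def \<omega>_def)
  have D: "2 powr p * ((2 * r) powr (real DIM('a) + s * p) / c0 / m) = e"
  proof -
    have "(2 * r) powr (real DIM('a) + s * p) = 2 powr (real DIM('a) + s * p) * (r ^ DIM('a) * r powr (s * p))"
      using r by (simp add: powr_mult powr_add powr_realpow)
    then have "2 powr p * ((2 * r) powr (real DIM('a) + s * p) / c0 / m) = c1 * r powr (s * p)"
      using r \<omega> c0 by (simp add: m(1) c1_def field_simps)
    then show ?thesis using rsp c1 by simp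
  qed
  have "compact (closure \<Omega>)" using bounded_domain by (simp add: compact_closure)
  then obtain F where F: "finite F" "closure \<Omega> \<subseteq> (\<Union>x\<in>F. ball x r)"
    using r unfolding compact_eq_totally_bounded by blast
  obtain n and y :: "nat \<Rightarrow> 'a" where y: "F = y ` {i. i < n}"
    using finite_imp_nat_seg_image_inj_on[OF F(1)] by metis
  have cover: "\<Omega> \<subseteq> (\<Union>i<n. ball (y i) r)" using F(2) closure_subset[of \<Omega>] unfolding y by auto
  define K where "K = 2 powr p * (m / m powr p)"
  show ?thesis
  proof (rule exI[of _ r], rule exI[of _ n], rule exI[of _ y], rule exI[of _ K], intro conjI ballI)
    show "0 \<le> K" using m by (simp add: K_def)
    fix u assume u: "u \<in> V"
    then obtain w where w[measurable]: "w \<in> borel_measurable borel" and ae: "AE x in lborel. u x = w x"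
      using completion_ex_borel_measurable_real[OF V_measurable[OF u]] by auto
    have wl[measurable]: "w \<in> borel_measurable lebesgue" by (rule measurable_completion) simp
    note um[measurable] = V_measurable[OF u]
    note ae' = AE_completion[OF ae]
    have wV: "w \<in> V" and q: "AE z in lebesgue. quot u z = quot w z"
      using V_AE_cong[OF u wl ae'] by auto
    have "Lpow u = Lpow w"
      unfolding Lpow_def
    proof (rule integral_cong_AE)
      show "AE x in lebesgue. \<bar>u x\<bar> powr p = \<bar>w x\<bar> powr p" using ae' by eventually_elim simp
    qed measurable
    moreover have "En u = En w"
      unfolding En_def
    proof (rule integral_cong_AE)
      show "AE z in lebesgue. \<bar>quot u z\<bar> powr p = \<bar>quot w z\<bar> powr p" using q by eventually_elim simp
    qed measurable
    moreover have "(\<integral>x. indicator (ball (y i) r) x * u x \<partial>lebesgue) = (\<integral>x. indicator (ball (y i) r) x * w x \<partial>lebesgue)" for i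
    proof (rule integral_cong_AE)
      show "AE x in lebesgue. indicator (ball (y i) r) x * u x = indicator (ball (y i) r) x * w x"
        using ae' by eventually_elim simp
    qed (use V_integrable_ball(1)[OF u] V_integrable_ball(1)[OF wV] in \<open>auto intro: borel_measurable_integrable\<close>)
    moreover have "Lpow w \<le> e * En w + K * (\<Sum>i<n. \<bar>\<integral>x. indicator (ball (y i) r) x * w x \<partial>lebesgue\<bar> powr p)"
    proof -
      have "Lpow w \<le> 2 powr p * ((2 * r) powr (real DIM('a) + s * p) / c0 / m * En w
         + (\<Sum>i<n. m * \<bar>(\<integral>x. indicator (ball (y i) r) x * w x \<partial>lebesgue) / m\<bar> powr p))"
        unfolding m_def by (rule Lpow_le_ball_averages_borel[OF wV w r cover])
      also have "\<dots> = 2 powr p * ((2 * r) powr (real DIM('a) + s * p) / c0 / m) * En w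
         + K * (\<Sum>i<n. \<bar>\<integral>x. indicator (ball (y i) r) x * w x \<partial>lebesgue\<bar> powr p)"
        using m(2) by (simp add: K_def distrib_left sum_distrib_left powr_divide mult_ac)
      finally show ?thesis unfolding D .
    qed
    ultimately show "Lpow u \<le> e * En u + K * (\<Sum>i<n. \<bar>\<integral>x. indicator (ball (y i) r) x * u x \<partial>lebesgue\<bar> powr p)"
      by simp
  qed
qed

lemma ball_integral_bound:
  obtains C where "0 \<le> C" "\<And>u y r. u \<in> V \<Longrightarrow> \<bar>\<integral>x. indicator (ball y r) x * u x \<partial>lebesgue\<bar> \<le> C * (1 + En u)"
proof -
  obtain C where C: "0 \<le> C" "\<And>u. u \<in> V \<Longrightarrow> Lpow u \<le> C * En u" using Poincare by blast
  have \<Omega>: "\<Omega> \<in> sets lebesgue" "emeasure lebesgue \<Omega> < \<infinity>"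
    using open_domain emeasure_bounded_finite[OF bounded_domain] by auto
  define m where "m = measure lebesgue \<Omega>"
  show thesis
  proof (rule that[of "m + C"])
    show "0 \<le> m + C" using C by (simp add: m_def)
    fix u y r assume u: "u \<in> V"
    have "\<bar>\<integral>x. indicator (ball y r) x * u x \<partial>lebesgue\<bar> \<le> (\<integral>x. \<bar>indicator (ball y r) x * u x\<bar> \<partial>lebesgue)"
      by (rule integral_abs_bound)
    also have "\<dots> \<le> (\<integral>x. indicator \<Omega> x + \<bar>u x\<bar> powr p \<partial>lebesgue)"
    proof (rule integral_mono_AE)
      show "AE x in lebesgue. \<bar>indicator (ball y r) x * u x\<bar> \<le> indicator \<Omega> x + \<bar>u x\<bar> powr p"
        using V_zero[OF u] by eventually_elim (use abs_le_1_plus_powr in \<open>auto simp: indicator_def\<close>)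
      show "integrable lebesgue (\<lambda>x. \<bar>indicator (ball y r) x * u x\<bar>)"
        using V_integrable_ball(1)[OF u, of y r] by (rule integrable_abs)
      show "integrable lebesgue (\<lambda>x. indicator \<Omega> x + \<bar>u x\<bar> powr p)"
        using \<Omega> V_powr[OF u] by (intro Bochner_Integration.integrable_add integrable_real_indicator)
    qed
    also have "\<dots> = m + Lpow u"
      using \<Omega> V_powr[OF u] unfolding Lpow_def m_def
      by (subst Bochner_Integration.integral_add) (auto intro!: integrable_real_indicator)
    also have "\<dots> \<le> (m + C) * (1 + En u)"
    proof -
      have "(m + C) * (1 + En u) = m + m * En u + C + C * En u" by (simp add: algebra_simps)
      moreover have "0 \<le> m * En u" by (simp add: m_def En_nonneg)
      ultimately show ?thesis using C(1) C(2)[OF u] by linarith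
    qed
    finally show "\<bar>\<integral>x. indicator (ball y r) x * u x \<partial>lebesgue\<bar> \<le> (m + C) * (1 + En u)" .
  qed
qed

text \<open>The compact embedding. Countably many ball averages suffice for all the precisions \<open>1 / (l + 1)\<close>, and
  a diagonal sequence makes all of them converge.\<close>
lemma compact_embedding:
  fixes v :: "nat \<Rightarrow> 'a \<Rightarrow> real"
  assumes v: "\<And>j. v j \<in> V" and bd: "\<And>j. En (v j) \<le> M"
  obtains r where "strict_mono (r :: nat \<Rightarrow> nat)"
    "\<And>e. 0 < e \<Longrightarrow> \<exists>N. \<forall>i\<ge>N. \<forall>j\<ge>N. Lpow (\<lambda>x. v (r i) x - v (r j) x) < e"
proof -
  have M: "0 \<le> M" using bd[of 0] En_nonneg[of "v 0"] by simp
  define avg where "avg B u = (\<integral>x. indicator B x * u x \<partial>lebesgue)" for B :: "'a set" and u :: "'a \<Rightarrow> real"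
  define balls where "balls l F K \<longleftrightarrow> finite F \<and> F \<subseteq> {ball y r | y r. True} \<and> 0 \<le> K \<and>
      (\<forall>u\<in>V. Lpow u \<le> 1 / real (Suc l) * En u + K * (\<Sum>B\<in>F. \<bar>avg B u\<bar> powr p))" for l F K
  have "\<exists>F K. balls l F K" for l
  proof -
    have "\<exists>r n y K. 0 \<le> K \<and> (\<forall>u\<in>V. Lpow u \<le> 1 / real (Suc l) * En u + K * (\<Sum>i<(n::nat). \<bar>avg (ball (y i :: 'a) r) u\<bar> powr p))"
      unfolding avg_def by (rule Lpow_le_ball_averages) simp
    then obtain r n y K where K: "0 \<le> K"
      "\<And>u. u \<in> V \<Longrightarrow> Lpow u \<le> 1 / real (Suc l) * En u + K * (\<Sum>i<(n::nat). \<bar>avg (ball (y i :: 'a) r) u\<bar> powr p)"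
      by blast
    let ?F = "(\<lambda>i. ball (y i) r) ` {..<n}"
    have "(\<Sum>i<n. \<bar>avg (ball (y i) r) u\<bar> powr p) \<le> (\<Sum>i<n. \<Sum>B\<in>?F. \<bar>avg B u\<bar> powr p)" for u
      by (intro sum_mono member_le_sum) auto
    then have "K * (\<Sum>i<n. \<bar>avg (ball (y i) r) u\<bar> powr p) \<le> K * real n * (\<Sum>B\<in>?F. \<bar>avg B u\<bar> powr p)" for u
      using K(1) mult_left_mono[of _ _ K] by (simp add: mult.assoc)
    then have "Lpow u \<le> 1 / real (Suc l) * En u + K * real n * (\<Sum>B\<in>?F. \<bar>avg B u\<bar> powr p)" if "u \<in> V" for u
      using K(2)[OF that] by (meson add_left_mono order_trans)
    then have "balls l ?F (K * real n)" using K(1) unfolding balls_def by auto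
    then show ?thesis by blast
  qed
  then obtain F K where "\<And>l. balls l (F l) (K l)" by metis
  then have F: "\<And>l. finite (F l)" "\<And>l. F l \<subseteq> {ball y r | y r. True}" and K: "\<And>l. 0 \<le> K l"
    and le: "\<And>l u. u \<in> V \<Longrightarrow> Lpow u \<le> 1 / real (Suc l) * En u + K l * (\<Sum>B\<in>F l. \<bar>avg B u\<bar> powr p)"
    unfolding balls_def by blast+
  obtain C where C: "0 \<le> C" "\<And>u y r. u \<in> V \<Longrightarrow> \<bar>avg (ball y r) u\<bar> \<le> C * (1 + En u)"
    using ball_integral_bound unfolding avg_def by blast
  obtain r :: "nat \<Rightarrow> nat" where r: "strict_mono r"
    and conv: "\<And>B. B \<in> (\<Union>l. F l) \<Longrightarrow> \<exists>L. (\<lambda>j. avg B (v (r j))) \<longlonglongrightarrow> L"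
  proof (rule function_convergent_subsequence[of "\<Union>l. F l" "\<lambda>j B. avg B (v j)" "C * (1 + M)"])
    show "countable (\<Union>l. F l)" using F(1) by (intro countable_UN) (auto intro: countable_finite)
    fix j B assume "B \<in> (\<Union>l. F l)"
    then obtain y \<rho> where "B = ball y \<rho>" using F(2) by blast
    then have "\<bar>avg B (v j)\<bar> \<le> C * (1 + En (v j))" using C(2)[OF v] by simp
    also have "\<dots> \<le> C * (1 + M)" using C(1) bd[of j] by (intro mult_left_mono) auto
    finally show "norm (avg B (v j)) \<le> C * (1 + M)" by simp
  qed auto
  then obtain L where L: "\<And>B l. B \<in> F l \<Longrightarrow> (\<lambda>j. avg B (v (r j))) \<longlonglongrightarrow> L B" by (metis UN_I UNIV_I)
  show thesis
  proof (rule that[OF r])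
    fix e :: real assume e: "0 < e"
    define E where "E = 2 powr p * (2 * M)"
    have E: "0 \<le> E" using M by (simp add: E_def)
    obtain l where l: "1 / real (Suc l) < e / (2 * (E + 1))"
      using nat_approx_posE[of "e / (2 * (E + 1))"] e E by auto
    define S where "S j = (\<Sum>B\<in>F l. \<bar>avg B (v (r j)) - L B\<bar> powr p)" for j
    have "S \<longlonglongrightarrow> (\<Sum>B\<in>F l. 0)"
      unfolding S_def[abs_def]
    proof (rule tendsto_sum)
      fix B assume "B \<in> F l"
      then have "(\<lambda>j. \<bar>avg B (v (r j)) - L B\<bar> powr p) \<longlonglongrightarrow> \<bar>L B - L B\<bar> powr p"
        using p by (intro tendsto_powr2 tendsto_intros L) auto
      then show "(\<lambda>j. \<bar>avg B (v (r j)) - L B\<bar> powr p) \<longlonglongrightarrow> 0" using p by simp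
    qed
    then have "(\<lambda>j. K l * (2 powr p * S j)) \<longlonglongrightarrow> K l * (2 powr p * 0)" by (intro tendsto_intros) simp
    then have "eventually (\<lambda>j. K l * (2 powr p * S j) < e / 4) sequentially"
      using e by (intro order_tendstoD) auto
    then obtain N where N: "\<And>j. N \<le> j \<Longrightarrow> K l * (2 powr p * S j) < e / 4"
      by (auto simp: eventually_sequentially)
    show "\<exists>N. \<forall>i\<ge>N. \<forall>j\<ge>N. Lpow (\<lambda>x. v (r i) x - v (r j) x) < e"
    proof (intro exI allI impI)
      fix i j assume ij: "N \<le> i" "N \<le> j"
      let ?d = "\<lambda>x. v (r i) x - v (r j) x"
      have "En ?d \<le> E"
        using En_diff_le[OF v v, of "r i" "r j"] bd[of "r i"] bd[of "r j"]
        unfolding E_def by (smt (verit, best) mult_left_mono powr_ge_zero)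
      then have "1 / real (Suc l) * En ?d \<le> e / (2 * (E + 1)) * E"
        using l E e En_nonneg by (intro mult_mono) auto
      also have "\<dots> \<le> e / 2" using E e by (simp add: field_simps)
      finally have 1: "1 / real (Suc l) * En ?d \<le> e / 2" .
      have "(\<Sum>B\<in>F l. \<bar>avg B ?d\<bar> powr p) \<le> (\<Sum>B\<in>F l. 2 powr p * (\<bar>avg B (v (r i)) - L B\<bar> powr p + \<bar>avg B (v (r j)) - L B\<bar> powr p))"
      proof (rule sum_mono)
        fix B assume "B \<in> F l"
        then obtain y \<rho> where B: "B = ball y \<rho>" using F(2) by blast
        have "avg B ?d = avg B (v (r i)) - avg B (v (r j))"
          unfolding avg_def B using V_integrable_ball(1)[OF v]
          by (simp add: right_diff_distrib Bochner_Integration.integral_diff)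
        also have "\<dots> = (avg B (v (r i)) - L B) - (avg B (v (r j)) - L B)" by simp
        finally show "\<bar>avg B ?d\<bar> powr p \<le> 2 powr p * (\<bar>avg B (v (r i)) - L B\<bar> powr p + \<bar>avg B (v (r j)) - L B\<bar> powr p)"
          using powr_diff_le[of p "avg B (v (r i)) - L B" "avg B (v (r j)) - L B"] p by simp
      qed
      also have "\<dots> = 2 powr p * S i + 2 powr p * S j"
        by (simp add: S_def sum_distrib_left[symmetric] sum.distrib distrib_left)
      finally have "K l * (\<Sum>B\<in>F l. \<bar>avg B ?d\<bar> powr p) \<le> K l * (2 powr p * S i) + K l * (2 powr p * S j)"
        using K[of l] by (metis distrib_left mult_left_mono)
      then show "Lpow ?d < e"
        using le[OF V_diff[OF v v], of "r i" "r j" l] 1 N[OF ij(1)] N[OF ij(2)] by linarith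
    qed
  qed
qed

end

section \<open>Energy minimisation\<close>

locale nonlocal_problem = nonlocal_space +
  fixes f :: "('a \<Rightarrow> real) \<Rightarrow> real" and hmin hmax :: real
  assumes f: "f \<in> X0_dual \<Omega> k p" and hmin: "0 < hmin" and hmin_hmax: "hmin < hmax"
begin

abbreviation H :: "('a \<times> 'a \<Rightarrow> real) set" where "H \<equiv> coeffs_H hmin hmax"

definition Eh :: "('a \<times> 'a \<Rightarrow> real) \<Rightarrow> ('a \<Rightarrow> real) \<Rightarrow> real" where
  "Eh h u = (\<integral>z. h z * \<bar>quot u z\<bar> powr p \<partial>lebesgue)"

definition J :: "('a \<times> 'a \<Rightarrow> real) \<Rightarrow> ('a \<Rightarrow> real) \<Rightarrow> real" where
  "J h u = Eh h u / p - f u"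

abbreviation B :: "('a \<times> 'a \<Rightarrow> real) \<Rightarrow> ('a \<Rightarrow> real) \<Rightarrow> ('a \<Rightarrow> real) \<Rightarrow> real" where
  "B \<equiv> B_form k p"

lemma H_D:
  assumes "h \<in> H"
  shows H_measurable: "h \<in> borel_measurable lebesgue"
    and H_range: "AE z in lebesgue. h z \<in> {hmin..hmax}"
    and H_abs: "AE z in lebesgue. \<bar>h z\<bar> \<le> hmax"
proof -
  show "h \<in> borel_measurable lebesgue" using assms by (simp add: coeffs_H_def Linf_def)
  have "AE z in lebesgue. h z = h (snd z, fst z) \<and> h z \<in> {hmin..hmax}"
    using assms by (simp add: coeffs_H_def split_beta')
  then show *: "AE z in lebesgue. h z \<in> {hmin..hmax}" by eventually_elim auto
  show "AE z in lebesgue. \<bar>h z\<bar> \<le> hmax" using * by eventually_elim (use hmin in auto)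
qed

lemma H_mult_integrable:
  assumes h: "h \<in> H" and g: "integrable lebesgue g"
  shows "integrable lebesgue (\<lambda>z. h z * g z)"
proof (rule Bochner_Integration.integrable_bound[OF integrable_mult_right[OF g, of hmax]])
  show "(\<lambda>z. h z * g z) \<in> borel_measurable lebesgue" using H_measurable[OF h] g by auto
  show "AE z in lebesgue. norm (h z * g z) \<le> norm (hmax * g z)"
    using H_abs[OF h] by eventually_elim (auto simp: abs_mult intro!: mult_right_mono)
qed

lemma H_mult_bounds:
  assumes h: "h \<in> H" and g: "integrable lebesgue g" "\<And>z. 0 \<le> g z"
  shows "hmin * (\<integral>z. g z \<partial>lebesgue) \<le> (\<integral>z. h z * g z \<partial>lebesgue)"
proof -
  have "(\<integral>z. hmin * g z \<partial>lebesgue) \<le> (\<integral>z. h z * g z \<partial>lebesgue)"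
  proof (rule integral_mono_AE)
    show "AE z in lebesgue. hmin * g z \<le> h z * g z"
      using H_range[OF h] by eventually_elim (auto intro!: mult_right_mono g)
  qed (use g H_mult_integrable[OF h g(1)] in auto)
  then show ?thesis by simp
qed

lemma f_add: "u \<in> V \<Longrightarrow> v \<in> V \<Longrightarrow> f (\<lambda>x. u x + v x) = f u + f v"
  and f_cmult: "u \<in> V \<Longrightarrow> f (\<lambda>x. c * u x) = c * f u"
  using f unfolding X0_dual_def by blast+

lemma f_diff: "u \<in> V \<Longrightarrow> v \<in> V \<Longrightarrow> f (\<lambda>x. u x - v x) = f u - f v"
  using f_add[of u "\<lambda>x. -1 * v x"] f_cmult[of v "-1"] V_cmult[of v "-1"] by simp

lemma f_bound:
  obtains C where "0 \<le> C" "\<And>u. u \<in> V \<Longrightarrow> \<bar>f u\<bar> \<le> C * En u powr (1 / p)"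
proof -
  obtain C where C: "\<And>u. u \<in> V \<Longrightarrow> \<bar>f u\<bar> \<le> C * X0_norm k p u"
    using f unfolding X0_dual_def by blast
  show thesis
  proof (rule that[of "max C 0"])
    fix u assume u: "u \<in> V"
    have "C * En u powr (1 / p) \<le> max C 0 * En u powr (1 / p)" by (intro mult_right_mono) auto
    then show "\<bar>f u\<bar> \<le> max C 0 * En u powr (1 / p)" using C[OF u] by (simp add: X0_norm_eq[OF u])
  qed simp
qed

lemma f_tendsto_0:
  assumes v: "\<And>n. v n \<in> V" and lim: "(\<lambda>n. En (v n)) \<longlonglongrightarrow> 0"
  shows "(\<lambda>n. f (v n)) \<longlonglongrightarrow> 0"
proof -
  obtain C where C: "0 \<le> C" "\<And>u. u \<in> V \<Longrightarrow> \<bar>f u\<bar> \<le> C * En u powr (1 / p)" by (rule f_bound) (rule that)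
  have "(\<lambda>n. En (v n) powr (1 / p)) \<longlonglongrightarrow> 0 powr (1 / p)"
    using lim p by (intro tendsto_powr2 tendsto_intros) (auto simp: En_nonneg)
  then have "(\<lambda>n. En (v n) powr (1 / p)) \<longlonglongrightarrow> 0" using p by simp
  from tendsto_mult_right_zero[OF this, of C] show ?thesis
    by (rule Lim_null_comparison[rotated]) (use C(2)[OF v] in simp)
qed

lemma Lpow_tendsto_0:
  assumes v: "\<And>n. v n \<in> V" and lim: "(\<lambda>n. En (v n)) \<longlonglongrightarrow> 0"
  shows "(\<lambda>n. Lpow (v n)) \<longlonglongrightarrow> 0"
proof -
  obtain C where C: "0 \<le> C" "\<And>u. u \<in> V \<Longrightarrow> Lpow u \<le> C * En u" by (rule Poincare) (rule that)
  from tendsto_mult_right_zero[OF lim, of C] show ?thesis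
    by (rule Lim_null_comparison[rotated]) (use C(2)[OF v] in \<open>simp add: Lpow_nonneg\<close>)
qed

lemma B_tendsto_0:
  assumes h: "h \<in> H" and u: "u \<in> V" and v: "\<And>n. v n \<in> V" and lim: "(\<lambda>n. En (v n)) \<longlonglongrightarrow> 0"
  shows "(\<lambda>n. B h u (v n)) \<longlonglongrightarrow> 0"
proof -
  obtain K where "\<And>n. norm (En (v n)) \<le> K"
    using convergent_imp_Bseq[OF convergentI[OF lim]] by (auto simp: Bseq_def)
  then have K: "En (v n) \<le> K" for n by (simp add: abs_le_iff)
  have "(\<lambda>n. pairing_bound u (v n)) \<longlonglongrightarrow> 0"
    by (intro pairing_bound_tendsto_0[OF u v K] Lpow_tendsto_0 v lim)
  from tendsto_mult_right_zero[OF this, of hmax] show ?thesis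
    by (rule Lim_null_comparison[rotated])
      (use B_form_bound[OF u v H_measurable[OF h] H_abs[OF h]] in simp)
qed

lemma B_integrable:
  assumes "h \<in> H" "u \<in> V" "v \<in> V"
  shows "integrable lebesgue (\<lambda>z. h z * (signed_powr p (quot u z) * quot v z))"
  using B_form_integrable assms H_measurable H_abs by blast

lemma B_cmult: "B h u (\<lambda>x. c * v x) = c * B h u v"
proof -
  have "B h u (\<lambda>x. c * v x) = (\<integral>z. c * (h z * (signed_powr p (quot u z) * quot v z)) \<partial>lebesgue)"
    by (simp add: B_form_eq quot_cmult mult_ac)
  then show ?thesis by (simp add: B_form_eq)
qed

lemma B_diff:
  assumes "h \<in> H" "u \<in> V" "v \<in> V" "w \<in> V"
  shows "B h u (\<lambda>x. v x - w x) = B h u v - B h u w"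
  using B_integrable[OF assms(1,2,3)] B_integrable[OF assms(1,2,4)]
  by (simp add: B_form_eq quot_diff right_diff_distrib Bochner_Integration.integral_diff)

text \<open>Convexity of \<open>J h\<close>; its derivative at \<open>u\<close> is \<open>\<lambda>v. B h u v - f v\<close>.\<close>
lemma J_tangent:
  assumes h: "h \<in> H" and u: "u \<in> V" and v: "v \<in> V"
  shows "J h u + B h u (\<lambda>x. v x - u x) - f (\<lambda>x. v x - u x) \<le> J h v"
proof -
  note vu = V_diff[OF v u]
  have "Eh h u + p * B h u (\<lambda>x. v x - u x) =
      (\<integral>z. h z * \<bar>quot u z\<bar> powr p + p * (h z * (signed_powr p (quot u z) * quot (\<lambda>x. v x - u x) z)) \<partial>lebesgue)"
    using H_mult_integrable[OF h V_quot[OF u]] B_integrable[OF h u vu]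
    by (simp add: Eh_def B_form_eq Bochner_Integration.integral_add)
  also have "\<dots> \<le> Eh h v"
    unfolding Eh_def
  proof (rule integral_mono_AE)
    show "AE z in lebesgue. h z * \<bar>quot u z\<bar> powr p + p * (h z * (signed_powr p (quot u z) * quot (\<lambda>x. v x - u x) z))
        \<le> h z * \<bar>quot v z\<bar> powr p"
      using H_range[OF h]
    proof eventually_elim
      fix z assume "h z \<in> {hmin..hmax}"
      then have "h z * (\<bar>quot u z\<bar> powr p + p * (signed_powr p (quot u z) * (quot v z - quot u z))) \<le> h z * \<bar>quot v z\<bar> powr p"
        using hmin by (intro mult_left_mono powr_tangent p) auto
      then show "h z * \<bar>quot u z\<bar> powr p + p * (h z * (signed_powr p (quot u z) * quot (\<lambda>x. v x - u x) z))
        \<le> h z * \<bar>quot v z\<bar> powr p"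
        by (simp add: quot_diff algebra_simps)
    qed
  qed (use H_mult_integrable[OF h V_quot[OF u]] H_mult_integrable[OF h V_quot[OF v]] B_integrable[OF h u vu] in auto)
  finally have "(Eh h u + p * B h u (\<lambda>x. v x - u x)) / p \<le> Eh h v / p"
    using p by (intro divide_right_mono) auto
  then show ?thesis using p by (simp add: J_def add_divide_distrib f_diff[OF v u])
qed

lemma weak_eq_minimizes:
  assumes h: "h \<in> H" and u: "weak_eq \<Omega> k p h f u" and v: "v \<in> V"
  shows "J h u \<le> J h v"
proof -
  have "u \<in> V" "B h u (\<lambda>x. v x - u x) = f (\<lambda>x. v x - u x)"
    using u V_diff[OF v] by (auto simp: weak_eq_def)
  then show ?thesis using J_tangent[OF h \<open>u \<in> V\<close> v] by simp
qed

lemma V_midpoint: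
  assumes "u \<in> V" "v \<in> V" shows "(\<lambda>x. (u x + v x) / 2) \<in> V"
  using V_cmult[OF V_add[OF assms], of "1/2"] by simp

text \<open>The pointwise inequality is integrated; the constant does not depend on the coefficient because
  \<open>hmin * midpoint_gap\<close> is a lower bound for \<open>h * midpoint_gap\<close>.\<close>
lemma uniform_convexity:
  assumes e: "0 < e"
  obtains C where "0 \<le> C"
    "\<And>h u v. h \<in> H \<Longrightarrow> u \<in> V \<Longrightarrow> v \<in> V \<Longrightarrow>
      En (\<lambda>x. u x - v x) \<le> e * (En u + En v) + C * ((J h u + J h v) / 2 - J h (\<lambda>x. (u x + v x) / 2))"
proof -
  obtain C where C: "0 \<le> C"
    "\<And>a b. \<bar>a - b\<bar> powr p \<le> e * (\<bar>a\<bar> powr p + \<bar>b\<bar> powr p) + C * midpoint_gap p a b"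
    by (rule powr_uniform_convexity[OF p e]) (rule that)
  show thesis
  proof (rule that[of "C / hmin * p"])
    show "0 \<le> C / hmin * p" using C hmin p by simp
    fix h u v assume h: "h \<in> H" and u: "u \<in> V" and v: "v \<in> V"
    let ?m = "\<lambda>x. (u x + v x) / 2"
    let ?g = "\<lambda>z. midpoint_gap p (quot u z) (quot v z)"
    note m = V_midpoint[OF u v]
    note int = V_quot[OF u] V_quot[OF v] V_quot[OF m]
    note hint = int[THEN H_mult_integrable[OF h]]
    have qm: "quot ?m z = (quot u z + quot v z) / 2" for z
      using quot_cmult[of "1/2" "\<lambda>x. u x + v x" z] quot_add[of u v z] by simp
    have g_eq: "?g z = (\<bar>quot u z\<bar> powr p + \<bar>quot v z\<bar> powr p) / 2 - \<bar>quot ?m z\<bar> powr p" for z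
      by (simp add: midpoint_gap_def qm)
    have g_int: "integrable lebesgue ?g" unfolding g_eq using int by auto
    have "(\<integral>z. h z * ?g z \<partial>lebesgue) = (\<integral>z. (h z * \<bar>quot u z\<bar> powr p) / 2 + (h z * \<bar>quot v z\<bar> powr p) / 2 - h z * \<bar>quot ?m z\<bar> powr p \<partial>lebesgue)"
      unfolding g_eq by (simp add: algebra_simps add_divide_distrib)
    also have "\<dots> = Eh h u / 2 + Eh h v / 2 - Eh h ?m"
      unfolding Eh_def using hint by simp
    also have "\<dots> = p * ((J h u + J h v) / 2 - J h ?m)"
    proof -
      have "f ?m = (f u + f v) / 2" using f_cmult[OF V_add[OF u v], of "1/2"] f_add[OF u v] by simp
      then show ?thesis using p by (simp add: J_def field_simps)
    qed
    finally have hg: "(\<integral>z. h z * ?g z \<partial>lebesgue) = p * ((J h u + J h v) / 2 - J h ?m)" .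
    have "hmin * (\<integral>z. ?g z \<partial>lebesgue) \<le> (\<integral>z. h z * ?g z \<partial>lebesgue)"
      by (rule H_mult_bounds[OF h g_int midpoint_gap_nonneg[OF p]])
    then have "(\<integral>z. ?g z \<partial>lebesgue) \<le> p * ((J h u + J h v) / 2 - J h ?m) / hmin"
      unfolding hg using hmin by (simp add: field_simps)
    then have gap: "C * (\<integral>z. ?g z \<partial>lebesgue) \<le> C * (p * ((J h u + J h v) / 2 - J h ?m) / hmin)"
      using C(1) by (rule mult_left_mono)
    have "En (\<lambda>x. u x - v x) \<le> (\<integral>z. e * (\<bar>quot u z\<bar> powr p + \<bar>quot v z\<bar> powr p) + C * ?g z \<partial>lebesgue)"
      unfolding En_def
      by (rule integral_mono) (use V_quot[OF V_diff[OF u v]] int g_int C(2) in \<open>auto simp: quot_diff\<close>)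
    also have "\<dots> = e * (En u + En v) + C * (\<integral>z. ?g z \<partial>lebesgue)"
      unfolding En_def using int g_int by simp
    finally show "En (\<lambda>x. u x - v x) \<le> e * (En u + En v) + C / hmin * p * ((J h u + J h v) / 2 - J h ?m)"
      using gap by (simp add: mult_ac)
  qed
qed

text \<open>Coercivity, uniformly in the coefficient: the linear term grows like the \<open>p\<close>-th root of the energy, and
  the scaled Young inequality absorbs it into half of the energy term.\<close>
lemma En_le_J:
  obtains K where "\<And>h u. h \<in> H \<Longrightarrow> u \<in> V \<Longrightarrow> En u \<le> 2 * p / hmin * J h u + K"
proof -
  obtain C where C: "0 \<le> C" "\<And>u. u \<in> V \<Longrightarrow> \<bar>f u\<bar> \<le> C * En u powr (1 / p)" by (rule f_bound) (rule that)
  \<comment> \<open>Chosen so that \<open>C * t\<close> is the product \<open>a powr (p - 1) * t\<close> of the scaled Young inequality.\<close>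
  define a where "a = C powr (1 / (p - 1))"
  define l where "l = (hmin / (2 * p)) powr (1 / (1 - p))"
  have a: "0 \<le> a" "a powr (p - 1) = C" using C(1) p by (auto simp: a_def powr_powr)
  have l: "0 < l" "l powr (1 - p) = hmin / (2 * p)" using hmin p by (auto simp: l_def powr_powr)
  show thesis
  proof (rule that[of "2 * p / hmin * (l * a powr p)"])
    fix h u assume h: "h \<in> H" and u: "u \<in> V"
    have "f u \<le> C * En u powr (1 / p)" using C(2)[OF u] by simp
    also have "\<dots> \<le> l * a powr p + hmin / (2 * p) * En u"
      using powr_Young_scaled[OF p l(1), of a "En u powr (1 / p)"] a p En_nonneg[of u] l(2)
      by (simp add: powr_powr)
    finally have "f u \<le> l * a powr p + hmin / (2 * p) * En u" .
    moreover have "hmin * En u \<le> Eh h u"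
      unfolding Eh_def En_def by (rule H_mult_bounds[OF h V_quot[OF u]]) simp
    then have "hmin * En u / p \<le> Eh h u / p" using p by (intro divide_right_mono) auto
    ultimately have "hmin / (2 * p) * En u \<le> J h u + l * a powr p"
      unfolding J_def using p by (simp add: field_simps)
    then have "2 * p / hmin * (hmin / (2 * p) * En u) \<le> 2 * p / hmin * (J h u + l * a powr p)"
      using p hmin by (intro mult_left_mono) auto
    then show "En u \<le> 2 * p / hmin * J h u + 2 * p / hmin * (l * a powr p)"
      using p hmin by (simp add: distrib_left)
  qed
qed

text \<open>Comparing \<open>u\<close> with \<open>u + t * v\<close> through the tangent at the latter point gives \<open>f v \<le> B h (u + t * v) v\<close>
  for \<open>t > 0\<close>; let \<open>t\<close> tend to \<open>0\<close> by dominated convergence and exchange \<open>v\<close> with \<open>- v\<close>.\<close>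
lemma minimizer_weak_eq:
  assumes h: "h \<in> H" and u: "u \<in> V" and min: "\<And>v. v \<in> V \<Longrightarrow> J h u \<le> J h v"
  shows "weak_eq \<Omega> k p h f u"
proof -
  have ge: "f v \<le> B h u v" if v: "v \<in> V" for v
  proof -
    define t where "t n = 1 / real (Suc n)" for n
    have t: "0 < t n" "t n \<le> 1" for n by (auto simp: t_def)
    have t0: "t \<longlonglongrightarrow> 0" unfolding t_def[abs_def] by (rule LIMSEQ_Suc[OF lim_1_over_n])
    define w where "w n x = u x + t n * v x" for n x
    have w: "w n \<in> V" for n unfolding w_def[abs_def] by (intro V_add V_cmult u v)
    have "f v \<le> B h (w n) v" for n
    proof -
      have eq: "(\<lambda>x. u x - w n x) = (\<lambda>x. - t n * v x)" by (simp add: w_def fun_eq_iff)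
      have "J h (w n) + B h (w n) (\<lambda>x. u x - w n x) - f (\<lambda>x. u x - w n x) \<le> J h u"
        by (rule J_tangent[OF h w u])
      then have "- t n * B h (w n) v + t n * f v \<le> 0"
        using min[OF w, of n] unfolding eq B_cmult f_cmult[OF v] by linarith
      then have "t n * f v \<le> t n * B h (w n) v" by linarith
      then show ?thesis using t(1)[of n] by simp
    qed
    moreover have "(\<lambda>n. B h (w n) v) \<longlonglongrightarrow> B h u v"
      unfolding B_form_eq
    proof (rule integral_dominated_convergence[where
          w = "\<lambda>z. hmax * (2 powr p * (\<bar>quot u z\<bar> powr p + \<bar>quot v z\<bar> powr p) + \<bar>quot v z\<bar> powr p)"])
      note [measurable] = H_measurable[OF h] V_measurable[OF u] V_measurable[OF v] V_measurable[OF w]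
      show "(\<lambda>z. h z * (signed_powr p (quot u z) * quot v z)) \<in> borel_measurable lebesgue" by measurable
      show "(\<lambda>z. h z * (signed_powr p (quot (w n) z) * quot v z)) \<in> borel_measurable lebesgue" for n by measurable
      show "integrable lebesgue (\<lambda>z. hmax * (2 powr p * (\<bar>quot u z\<bar> powr p + \<bar>quot v z\<bar> powr p) + \<bar>quot v z\<bar> powr p))"
        using V_quot[OF u] V_quot[OF v] by auto
      have qw: "quot (w n) z = quot u z + t n * quot v z" for n z
        by (simp add: w_def[abs_def] quot_def algebra_simps)
      show "AE z in lebesgue. (\<lambda>n. h z * (signed_powr p (quot (w n) z) * quot v z)) \<longlonglongrightarrow> h z * (signed_powr p (quot u z) * quot v z)"
      proof (rule AE_I2)
        fix z :: "'a \<times> 'a"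
        have "(\<lambda>n. quot (w n) z) \<longlonglongrightarrow> quot u z + 0 * quot v z"
          unfolding qw by (intro tendsto_intros t0)
        then have "(\<lambda>n. signed_powr p (quot (w n) z)) \<longlonglongrightarrow> signed_powr p (quot u z)"
          using continuous_signed_powr[OF p]
          by (auto simp: continuous_on_eq_continuous_at intro: isCont_tendsto_compose)
        then show "(\<lambda>n. h z * (signed_powr p (quot (w n) z) * quot v z)) \<longlonglongrightarrow> h z * (signed_powr p (quot u z) * quot v z)"
          by (intro tendsto_intros)
      qed
      show "AE z in lebesgue. norm (h z * (signed_powr p (quot (w n) z) * quot v z))
          \<le> hmax * (2 powr p * (\<bar>quot u z\<bar> powr p + \<bar>quot v z\<bar> powr p) + \<bar>quot v z\<bar> powr p)" for n
        using H_abs[OF h]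
      proof eventually_elim
        fix z assume hz: "\<bar>h z\<bar> \<le> hmax"
        have "\<bar>signed_powr p (quot (w n) z)\<bar> * \<bar>quot v z\<bar> \<le> \<bar>quot (w n) z\<bar> powr p + \<bar>quot v z\<bar> powr p"
          using powr_Young_scaled[OF p, of 1 "quot (w n) z" "quot v z"] by (simp add: abs_signed_powr)
        also have "\<bar>quot (w n) z\<bar> powr p \<le> 2 powr p * (\<bar>quot u z\<bar> powr p + \<bar>t n * quot v z\<bar> powr p)"
          unfolding qw using p by (intro powr_add_le) simp
        also have "\<bar>t n * quot v z\<bar> powr p \<le> \<bar>quot v z\<bar> powr p"
          using t[of n] p by (intro powr_mono2) (auto simp: abs_mult intro: mult_left_le_one_le)
        finally have "\<bar>signed_powr p (quot (w n) z)\<bar> * \<bar>quot v z\<bar> \<le> 2 powr p * (\<bar>quot u z\<bar> powr p + \<bar>quot v z\<bar> powr p) + \<bar>quot v z\<bar> powr p"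
          by simp
        then show "norm (h z * (signed_powr p (quot (w n) z) * quot v z))
          \<le> hmax * (2 powr p * (\<bar>quot u z\<bar> powr p + \<bar>quot v z\<bar> powr p) + \<bar>quot v z\<bar> powr p)"
          unfolding real_norm_def abs_mult using hz by (intro mult_mono) (auto intro: order_trans[OF abs_ge_zero])
      qed
    qed
    ultimately show ?thesis by (intro LIMSEQ_le_const) auto
  qed
  have "B h u v = f v" if v: "v \<in> V" for v
  proof (rule antisym)
    have "f (\<lambda>x. -1 * v x) \<le> B h u (\<lambda>x. -1 * v x)" by (rule ge[OF V_cmult[OF v]])
    then show "B h u v \<le> f v" unfolding B_cmult f_cmult[OF v] by simp
  qed (rule ge[OF v])
  then show ?thesis using u by (simp add: weak_eq_def)
qed

lemma AE_eq_if_En_0: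
  assumes u: "u \<in> V" and v: "v \<in> V" and 0: "En (\<lambda>x. v x - u x) = 0"
  shows "AE x in lebesgue. v x = u x"
proof -
  obtain C where "0 \<le> C" and C: "\<And>u. u \<in> V \<Longrightarrow> Lpow u \<le> C * En u" by (rule Poincare) (rule that)
  from C[OF V_diff[OF v u]] have "Lpow (\<lambda>x. v x - u x) = 0"
    using 0 Lpow_nonneg[of "\<lambda>x. v x - u x"] by simp
  then have "AE x in lebesgue. \<bar>v x - u x\<bar> powr p = 0"
    unfolding Lpow_def using V_powr[OF V_diff[OF v u]]
    by (subst (asm) integral_nonneg_eq_0_iff_AE) auto
  then show ?thesis by eventually_elim simp
qed

lemma nonpos_if_le_all_multiples:
  fixes a b :: real
  assumes "\<And>e. 0 < e \<Longrightarrow> a \<le> e * b" shows "a \<le> 0"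
proof (rule ccontr)
  assume "\<not> a \<le> 0"
  then have "0 < a" by simp
  have "a \<le> a / (2 * (\<bar>b\<bar> + 1)) * b" using \<open>0 < a\<close> by (intro assms) simp
  also have "\<dots> \<le> a / (2 * (\<bar>b\<bar> + 1)) * (\<bar>b\<bar> + 1)" using \<open>0 < a\<close> by (intro mult_left_mono) auto
  also have "\<dots> = a / 2" by (simp add: field_simps)
  finally show False using \<open>0 < a\<close> by simp
qed

text \<open>Two solutions are both minimisers, so the convexity defect at their midpoint is not positive.\<close>
lemma is_solution_if_weak_eq:
  assumes h: "h \<in> H" and u: "weak_eq \<Omega> k p h f u"
  shows "is_solution \<Omega> k p h f u"
  unfolding is_solution_def
proof (intro conjI allI impI u)
  fix v assume v: "weak_eq \<Omega> k p h f v"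
  have V: "u \<in> V" "v \<in> V" using u v by (auto simp: weak_eq_def)
  have "En (\<lambda>x. v x - u x) \<le> e * (En v + En u)" if "0 < e" for e
  proof -
    obtain C where C: "0 \<le> C" "\<And>h u v. h \<in> H \<Longrightarrow> u \<in> V \<Longrightarrow> v \<in> V \<Longrightarrow>
      En (\<lambda>x. u x - v x) \<le> e * (En u + En v) + C * ((J h u + J h v) / 2 - J h (\<lambda>x. (u x + v x) / 2))"
      by (rule uniform_convexity[OF \<open>0 < e\<close>]) (rule that)
    have "(J h v + J h u) / 2 - J h (\<lambda>x. (v x + u x) / 2) \<le> 0"
      using weak_eq_minimizes[OF h u V_midpoint[OF V(2,1)]] weak_eq_minimizes[OF h v V_midpoint[OF V(2,1)]] by simp
    then have "C * ((J h v + J h u) / 2 - J h (\<lambda>x. (v x + u x) / 2)) \<le> 0"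
      using C(1) by (simp add: mult_nonneg_nonpos)
    then show ?thesis using C(2)[OF h V(2,1)] by linarith
  qed
  then have "En (\<lambda>x. v x - u x) \<le> 0" by (rule nonpos_if_le_all_multiples)
  then show "AE x in lebesgue. v x = u x" using AE_eq_if_En_0[OF V] En_nonneg[of "\<lambda>x. v x - u x"] by simp
qed

text \<open>The direct method: by uniform convexity a minimising sequence is Cauchy in energy, and by the tangent
  inequality its limit is a minimiser.\<close>
lemma weak_solution_exists:
  assumes h: "h \<in> H"
  obtains u where "weak_eq \<Omega> k p h f u"
proof -
  obtain K where "\<And>h u. h \<in> H \<Longrightarrow> u \<in> V \<Longrightarrow> En u \<le> 2 * p / hmin * J h u + K"
    by (rule En_le_J) (rule that)
  note K = this[OF h]
  define m where "m = (INF v\<in>V. J h v)"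
  have ph: "0 < 2 * p / hmin" using p hmin by simp
  have "bdd_below (J h ` V)"
  proof (rule bdd_belowI2)
    fix v assume "v \<in> V"
    then have "0 \<le> 2 * p / hmin * J h v + K" using K[of v] En_nonneg[of v] by linarith
    then have "- K \<le> J h v * (2 * p / hmin)" by (simp add: mult.commute)
    then show "- K / (2 * p / hmin) \<le> J h v" by (simp only: pos_divide_le_eq[OF ph])
  qed
  then have m: "m \<le> J h v" if "v \<in> V" for v
    unfolding m_def using that by (rule cINF_lower)
  have "\<exists>v\<in>V. J h v < m + 1 / real (Suc n)" for n
  proof -
    have "Inf (J h ` V) < m + 1 / real (Suc n)" by (simp add: m_def)
    then show ?thesis using cInf_lessD[of "J h ` V"] V_0 by blast
  qed
  then obtain v where v: "\<And>n. v n \<in> V" "\<And>n. J h (v n) < m + 1 / real (Suc n)" by metis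
  define M where "M = 2 * p / hmin * (m + 1) + K"
  have M: "En (v n) \<le> M" for n
  proof -
    have "1 / real (Suc n) \<le> 1" by simp
    then have "J h (v n) \<le> m + 1" using v(2)[of n] by linarith
    then have "2 * p / hmin * J h (v n) \<le> 2 * p / hmin * (m + 1)" using ph by (intro mult_left_mono) auto
    then show ?thesis using K[OF v(1)[of n]] by (simp add: M_def)
  qed
  have M0: "0 \<le> M" using M[of 0] En_nonneg[of "v 0"] by simp
  have Cauchy: "\<exists>N. \<forall>i\<ge>N. \<forall>j\<ge>N. En (\<lambda>x. v i x - v j x) < e" if e: "0 < e" for e
  proof -
    define e' where "e' = e / (4 * (M + 1))"
    have e': "0 < e'" "e' * (M + M) \<le> e / 2" using e M0 by (auto simp: e'_def field_simps)
    obtain C where C: "0 \<le> C" "\<And>h u v. h \<in> H \<Longrightarrow> u \<in> V \<Longrightarrow> v \<in> V \<Longrightarrow>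
      En (\<lambda>x. u x - v x) \<le> e' * (En u + En v) + C * ((J h u + J h v) / 2 - J h (\<lambda>x. (u x + v x) / 2))"
      by (rule uniform_convexity[OF e'(1)]) (rule that)
    obtain N where N: "1 / real (Suc N) < e / (2 * (C + 1))"
      using nat_approx_posE[of "e / (2 * (C + 1))"] e C(1) by auto
    show ?thesis
    proof (intro exI allI impI)
      fix i j assume ij: "N \<le> i" "N \<le> j"
      have small: "J h (v l) < m + e / (2 * (C + 1))" if "N \<le> l" for l
      proof -
        have "1 / real (Suc l) \<le> 1 / real (Suc N)" using that by (intro frac_le) auto
        then show ?thesis using v(2)[of l] N by linarith
      qed
      have "(J h (v i) + J h (v j)) / 2 - J h (\<lambda>x. (v i x + v j x) / 2) \<le> e / (2 * (C + 1))"
      proof -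
        have "(a + b) / 2 - c \<le> d" if "a < m + d" "b < m + d" "m \<le> c" for a b c d
          using that unfolding add_divide_distrib by linarith
        then show ?thesis using small[OF ij(1)] small[OF ij(2)] m[OF V_midpoint[OF v(1) v(1)]] .
      qed
      then have "C * ((J h (v i) + J h (v j)) / 2 - J h (\<lambda>x. (v i x + v j x) / 2)) \<le> C * (e / (2 * (C + 1)))"
        using C(1) by (rule mult_left_mono)
      also have "\<dots> < e / 2" using C(1) e by (simp add: field_simps)
      finally have "C * ((J h (v i) + J h (v j)) / 2 - J h (\<lambda>x. (v i x + v j x) / 2)) < e / 2" .
      moreover have "e' * (En (v i) + En (v j)) \<le> e / 2"
        using M[of i] M[of j] e' by (smt (verit, best) mult_left_mono)
      ultimately show "En (\<lambda>x. v i x - v j x) < e" using C(2)[OF h v(1) v(1), of i j] by linarith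
    qed
  qed
  obtain u where u: "u \<in> V" "(\<lambda>n. En (\<lambda>x. v n x - u x)) \<longlonglongrightarrow> 0"
    by (rule V_complete[OF v(1) Cauchy]) (assumption, rule that)
  note vu = V_diff[OF v(1) u(1)]
  have "J h u \<le> m"
  proof (rule LIMSEQ_le_const)
    have "(\<lambda>n. (m + 1 / real (Suc n)) - B h u (\<lambda>x. v n x - u x) + f (\<lambda>x. v n x - u x)) \<longlonglongrightarrow> (m + 0) - 0 + 0"
      by (intro tendsto_intros B_tendsto_0[OF h u(1) vu u(2)] f_tendsto_0[OF vu u(2)]
          LIMSEQ_Suc[OF lim_1_over_n])
    then show "(\<lambda>n. (m + 1 / real (Suc n)) - B h u (\<lambda>x. v n x - u x) + f (\<lambda>x. v n x - u x)) \<longlonglongrightarrow> m" by simp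
    show "\<exists>N. \<forall>n\<ge>N. J h u \<le> (m + 1 / real (Suc n)) - B h u (\<lambda>x. v n x - u x) + f (\<lambda>x. v n x - u x)"
    proof (intro exI allI impI)
      fix n
      show "J h u \<le> (m + 1 / real (Suc n)) - B h u (\<lambda>x. v n x - u x) + f (\<lambda>x. v n x - u x)"
        using J_tangent[OF h u(1) v(1), of n] v(2)[of n] by linarith
    qed
  qed
  then have "weak_eq \<Omega> k p h f u" using m by (intro minimizer_weak_eq[OF h u(1)]) force
  then show thesis by (rule that)
qed

lemma solution_exists: "h \<in> H \<Longrightarrow> \<exists>u. is_solution \<Omega> k p h f u"
  using weak_solution_exists is_solution_if_weak_eq by metis

section \<open>Convergence of the solutions\<close>

lemma B_weak_star:
  assumes h: "weak_star_Linf lebesgue hs h" and u: "u \<in> V" and v: "v \<in> V"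
  shows "(\<lambda>j. B (hs j) u v) \<longlonglongrightarrow> B h u v"
proof -
  have "integrable lebesgue (\<lambda>z. 1 * (signed_powr p (quot u z) * quot v z))"
    by (rule B_form_integrable[OF u v, where b = 1]) auto
  then show ?thesis using h unfolding B_form_eq weak_star_Linf_def by simp
qed

text \<open>The coefficients \<open>hs\<close> converge weak-star only, and \<open>w\<close> is merely bounded in energy.
  The nonlocal form compensates, because the pairing with a fixed \<open>u\<close> is continuous in the
  \<open>p\<close>-th mean: \<open>w j\<close> may be replaced by \<open>w N\<close> for a fixed large \<open>N\<close>, and for a fixed function the
  weak-star convergence applies.\<close>
lemma form_difference_tendsto_0:
  assumes hs: "\<And>j. hs j \<in> H" and h: "h \<in> H" and weak: "weak_star_Linf lebesgue hs h"
    and u: "u \<in> V" and w: "\<And>j. w j \<in> V" and bd: "\<And>j. En (w j) \<le> M"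
    and Cauchy: "\<And>e. 0 < e \<Longrightarrow> \<exists>N. \<forall>i\<ge>N. \<forall>j\<ge>N. Lpow (\<lambda>x. w i x - w j x) < e"
  shows "(\<lambda>j. B (hs j) u (w j) - B h u (w j)) \<longlonglongrightarrow> 0"
proof (rule LIMSEQ_I)
  fix e :: real assume e: "0 < e"
  define T where "T j v = B (hs j) u v - B h u v" for j v
  define E where "E = 2 powr p * (2 * M)"
  have M: "0 \<le> M" using bd[of 0] En_nonneg[of "w 0"] by simp
  then have E: "0 \<le> E" by (simp add: E_def)
  have En_diff: "En (\<lambda>x. w i x - w j x) \<le> E" for i j
    using En_diff_le[OF w w, of i j] bd[of i] bd[of j]
    unfolding E_def by (smt (verit, best) mult_left_mono powr_ge_zero)
  define e' where "e' = e / (8 * hmax * (1 + E))"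
  have hmax: "0 < hmax" using hmin hmin_hmax by simp
  have "2 * hmax * (e / (8 * hmax * q) * q) = e / 4 \<and> 0 < e / (8 * hmax * q)" if "0 < q" for q
    using that hmax e by (simp add: field_simps)
  from this[of "1 + E"] have e': "0 < e'" "2 * hmax * (e' * (1 + E)) = e / 4"
    using E by (simp_all add: e'_def)
  obtain C where C: "0 \<le> C" "\<And>v. v \<in> V \<Longrightarrow> pairing_bound u v \<le> e' * (1 + En v) + C * Lpow v"
    by (rule pairing_bound_le[OF u e'(1)]) (rule that)
  obtain N where N: "\<And>i j. N \<le> i \<Longrightarrow> N \<le> j \<Longrightarrow> Lpow (\<lambda>x. w i x - w j x) < e / (8 * hmax * (C + 1))"
    using Cauchy[of "e / (8 * hmax * (C + 1))"] e C(1) hmax by auto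
  have "(\<lambda>j. T j (w N)) \<longlonglongrightarrow> B h u (w N) - B h u (w N)"
    unfolding T_def by (intro tendsto_intros B_weak_star weak u w)
  then have "eventually (\<lambda>j. \<bar>T j (w N)\<bar> < e / 2) sequentially"
    using order_tendstoD(2)[OF tendsto_rabs, of "\<lambda>j. T j (w N)" 0 sequentially "e / 2"] e by simp
  then obtain N' where N': "\<And>j. N' \<le> j \<Longrightarrow> \<bar>T j (w N)\<bar> < e / 2" by (auto simp: eventually_sequentially)
  show "\<exists>no. \<forall>j\<ge>no. norm (B (hs j) u (w j) - B h u (w j) - 0) < e"
  proof (intro exI[of _ "max N N'"] allI impI)
    fix j assume j: "max N N' \<le> j"
    let ?d = "\<lambda>x. w j x - w N x"
    have d: "?d \<in> V" by (intro V_diff w)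
    have "T j ?d = T j (w j) - T j (w N)"
      unfolding T_def using B_diff[OF hs u w w] B_diff[OF h u w w] by simp
    moreover have "\<bar>T j ?d\<bar> \<le> 2 * hmax * pairing_bound u ?d"
      using B_form_bound[OF u d H_measurable[OF hs] H_abs[OF hs], of j] B_form_bound[OF u d H_measurable[OF h] H_abs[OF h]]
      unfolding T_def by linarith
    moreover have "2 * hmax * pairing_bound u ?d \<le> e / 2"
    proof -
      have "C * Lpow ?d \<le> C * (e / (8 * hmax * (C + 1)))"
        using N[of j N] j C(1) by (intro mult_left_mono) auto
      also have "\<dots> = C / (C + 1) * (e / (8 * hmax))" by (simp add: mult_ac)
      also have "\<dots> \<le> 1 * (e / (8 * hmax))" using C(1) e hmax by (intro mult_right_mono) auto
      also have "\<dots> = e / (8 * hmax)" by simp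
      finally have "2 * hmax * (C * Lpow ?d) \<le> 2 * hmax * (e / (8 * hmax))" using hmax by (intro mult_left_mono) auto
      also have "\<dots> = e / 4" using hmax by simp
      finally have 1: "2 * hmax * (C * Lpow ?d) \<le> e / 4" .
      have "2 * hmax * (e' * (1 + En ?d)) \<le> 2 * hmax * (e' * (1 + E))"
        using hmax e' En_diff[of j N] by (intro mult_left_mono) auto
      moreover have "2 * hmax * pairing_bound u ?d \<le> 2 * hmax * (e' * (1 + En ?d) + C * Lpow ?d)"
        using hmax by (intro mult_left_mono C(2) d) auto
      ultimately show ?thesis using 1 e'(2) by (simp add: distrib_left)
    qed
    ultimately have "\<bar>T j (w j)\<bar> < e" using N'[of j] j by linarith
    then show "norm (B (hs j) u (w j) - B h u (w j) - 0) < e" by (simp add: T_def)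
  qed
qed

text \<open>By convexity, \<open>J (hs j) (us j)\<close> is at least \<open>J (hs j) u + T j\<close>, where the difference of forms
  \<open>T j\<close> tends to \<open>0\<close>. So \<open>u\<close> almost minimises \<open>J (hs j)\<close>, and uniform convexity brings it close to
  the minimiser \<open>us j\<close>.\<close>
lemma solutions_converge:
  assumes hs: "\<And>j. hs j \<in> H" and h: "h \<in> H" and weak: "weak_star_Linf lebesgue hs h"
    and us: "\<And>j. weak_eq \<Omega> k p (hs j) f (us j)" and u: "weak_eq \<Omega> k p h f u" and bd: "\<And>j. En (us j) \<le> M"
    and Cauchy: "\<And>e. 0 < e \<Longrightarrow> \<exists>N. \<forall>i\<ge>N. \<forall>j\<ge>N. Lpow (\<lambda>x. us i x - us j x) < e"
  shows "(\<lambda>j. En (\<lambda>x. us j x - u x)) \<longlonglongrightarrow> 0"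
proof -
  have uV: "u \<in> V" and usV: "us j \<in> V" for j using u us by (auto simp: weak_eq_def)
  define w where "w j x = us j x - u x" for j x
  have w: "w j \<in> V" for j unfolding w_def[abs_def] by (intro V_diff usV uV)
  define E where "E = 2 powr p * (M + En u)"
  have wE: "En (w j) \<le> E" for j
    using En_diff_le[OF usV uV, of j] bd[of j] unfolding E_def w_def[abs_def]
    by (smt (verit, best) mult_left_mono powr_ge_zero)
  define T where "T j = B (hs j) u (w j) - B h u (w j)" for j
  have T: "T \<longlonglongrightarrow> 0"
    unfolding T_def[abs_def]
  proof (rule form_difference_tendsto_0[OF hs h weak uV w wE])
    show "\<exists>N. \<forall>i\<ge>N. \<forall>j\<ge>N. Lpow (\<lambda>x. w i x - w j x) < e" if "0 < e" for e
      using Cauchy[OF that] by (simp add: w_def)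
  qed
  have J_le: "J (hs j) u + T j \<le> J (hs j) (us j)" for j
  proof -
    have "B h u (w j) = f (w j)" using u w by (auto simp: weak_eq_def)
    then show ?thesis using J_tangent[OF hs uV usV, of j j] by (simp add: T_def w_def[abs_def])
  qed
  show ?thesis
  proof (rule LIMSEQ_I)
    fix e :: real assume e: "0 < e"
    have M: "0 \<le> M" using bd[of 0] En_nonneg[of "us 0"] by simp
    define e' where "e' = e / (2 * (M + En u + 1))"
    have e': "0 < e'" "e' * (M + En u) \<le> e / 2"
      using e M En_nonneg[of u] by (auto simp: e'_def field_simps add_pos_nonneg)
    obtain C where C: "0 \<le> C" "\<And>h u v. h \<in> H \<Longrightarrow> u \<in> V \<Longrightarrow> v \<in> V \<Longrightarrow>
      En (\<lambda>x. u x - v x) \<le> e' * (En u + En v) + C * ((J h u + J h v) / 2 - J h (\<lambda>x. (u x + v x) / 2))"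
      by (rule uniform_convexity[OF e'(1)]) (rule that)
    have "(\<lambda>j. C * \<bar>T j\<bar>) \<longlonglongrightarrow> C * \<bar>0\<bar>" by (intro tendsto_intros T)
    then have "eventually (\<lambda>j. C * \<bar>T j\<bar> < e / 2) sequentially"
      using e by (intro order_tendstoD) auto
    then obtain N where N: "\<And>j. N \<le> j \<Longrightarrow> C * \<bar>T j\<bar> < e / 2" by (auto simp: eventually_sequentially)
    show "\<exists>no. \<forall>j\<ge>no. norm (En (\<lambda>x. us j x - u x) - 0) < e"
    proof (intro exI allI impI)
      fix j assume "N \<le> j"
      have "J (hs j) (us j) \<le> J (hs j) (\<lambda>x. (us j x + u x) / 2)"
        by (rule weak_eq_minimizes[OF hs us V_midpoint[OF usV uV]])
      moreover have "J (hs j) (us j) \<le> J (hs j) u" by (rule weak_eq_minimizes[OF hs us uV])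
      ultimately have half: "(J (hs j) (us j) + J (hs j) u) / 2 - J (hs j) (\<lambda>x. (us j x + u x) / 2) \<le> \<bar>T j\<bar>"
      proof -
        have "(a + b) / 2 - c \<le> \<bar>t\<bar>" if "a \<le> c" "a \<le> b" "b + t \<le> a" for a b c t :: real
          using that unfolding add_divide_distrib by linarith
        then show ?thesis using \<open>J (hs j) (us j) \<le> J (hs j) (\<lambda>x. (us j x + u x) / 2)\<close>
            \<open>J (hs j) (us j) \<le> J (hs j) u\<close> J_le .
      qed
      from half have "C * ((J (hs j) (us j) + J (hs j) u) / 2 - J (hs j) (\<lambda>x. (us j x + u x) / 2)) \<le> C * \<bar>T j\<bar>"
        using C(1) by (rule mult_left_mono)
      moreover have "e' * (En (us j) + En u) \<le> e' * (M + En u)"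
        using bd[of j] e' by (intro mult_left_mono) auto
      ultimately have "En (\<lambda>x. us j x - u x) < e"
        using C(2)[OF hs usV uV, of j j] e'(2) N[OF \<open>N \<le> j\<close>] by linarith
      then show "norm (En (\<lambda>x. us j x - u x) - 0) < e" using En_nonneg by simp
    qed
  qed
qed

text \<open>A minimiser \<open>u\<close> satisfies \<open>J h u \<le> J h (\<lambda>x. 0) = 0\<close>, so coercivity applies.\<close>
lemma solutions_bounded:
  obtains M where "\<And>h u. h \<in> H \<Longrightarrow> weak_eq \<Omega> k p h f u \<Longrightarrow> En u \<le> M"
proof -
  obtain K where K: "\<And>h u. h \<in> H \<Longrightarrow> u \<in> V \<Longrightarrow> En u \<le> 2 * p / hmin * J h u + K"
    by (rule En_le_J) (rule that)
  show thesis
  proof (rule that[of K])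
    fix h u assume h: "h \<in> H" and u: "weak_eq \<Omega> k p h f u"
    have "J h u \<le> J h (\<lambda>x. 0)" by (rule weak_eq_minimizes[OF h u V_0])
    also have "\<dots> = 0" using f_cmult[OF V_0, of 0] by (simp add: J_def Eh_def quot_def)
    finally have "2 * p / hmin * J h u \<le> 0" using p hmin by (intro mult_nonneg_nonpos) auto
    then show "En u \<le> K" using K[OF h, of u] u by (simp add: weak_eq_def)
  qed
qed

end

theorem theorem3:
  fixes \<Omega> :: "'a::euclidean_space set" and k :: "'a \<Rightarrow> real"
    and p s c0 hmin hmax :: real
    and f :: "('a \<Rightarrow> real) \<Rightarrow> real" and hs :: "nat \<Rightarrow> 'a \<times> 'a \<Rightarrow> real"
  assumes "smooth_bounded_domain \<Omega>"
    and "1 < p" and "0 < s" and "s < 1" and "0 < c0"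
    and "admissible_kernel p s c0 k"
    and "0 < hmin" and "hmin < hmax"
    and "f \<in> X0_dual \<Omega> k p"
    and "\<And>j. hs j \<in> coeffs_H hmin hmax"
  shows "\<exists>r h us u. strict_mono (r :: nat \<Rightarrow> nat) \<and> h \<in> coeffs_H hmin hmax \<and>
           weak_star_Linf lebesgue (\<lambda>j. hs (r j)) h \<and>
           (\<forall>j. is_solution \<Omega> k p (hs (r j)) f (us j)) \<and>
           is_solution \<Omega> k p h f u \<and>
           (\<lambda>j. X0_norm k p (\<lambda>x. us j x - u x)) \<longlonglongrightarrow> 0"
proof -
  interpret nonlocal_problem \<Omega> k p s c0 f hmin hmax
    using assms by unfold_locales (auto simp: smooth_bounded_domain_def)
  obtain r0 h where r0: "strict_mono (r0 :: nat \<Rightarrow> nat)" and h: "h \<in> H"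
    and weak: "weak_star_Linf lebesgue (\<lambda>j. hs (r0 j)) h"
    by (rule coeffs_H_weak_star_compact[OF assms(10,7,8)])
  have "\<exists>u. is_solution \<Omega> k p (hs j) f u" for j by (rule solution_exists[OF assms(10)])
  then obtain us0 where us0: "\<And>j. is_solution \<Omega> k p (hs j) f (us0 j)" by metis
  then have us0_weak: "weak_eq \<Omega> k p (hs j) f (us0 j)" for j by (simp add: is_solution_def)
  then have us0_V: "us0 j \<in> V" for j by (simp add: weak_eq_def)
  obtain M where "\<And>h u. h \<in> H \<Longrightarrow> weak_eq \<Omega> k p h f u \<Longrightarrow> En u \<le> M"
    by (rule solutions_bounded) (rule that)
  then have M: "En (us0 j) \<le> M" for j using assms(10) us0_weak by blast
  obtain r1 where r1: "strict_mono (r1 :: nat \<Rightarrow> nat)"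
    and Cauchy: "\<And>e. 0 < e \<Longrightarrow> \<exists>N. \<forall>i\<ge>N. \<forall>j\<ge>N. Lpow (\<lambda>x. us0 (r0 (r1 i)) x - us0 (r0 (r1 j)) x) < e"
    by (rule compact_embedding[of "\<lambda>j. us0 (r0 j)" M]) (rule us0_V, rule M, rule that)
  obtain u where u: "is_solution \<Omega> k p h f u" using solution_exists[OF h] by blast
  then have u_weak: "weak_eq \<Omega> k p h f u" by (simp add: is_solution_def)
  then have uV: "u \<in> V" by (simp add: weak_eq_def)
  define r where "r = r0 \<circ> r1"
  have r: "strict_mono r" unfolding r_def by (rule strict_mono_o[OF r0 r1])
  have weak': "weak_star_Linf lebesgue (\<lambda>j. hs (r j)) h"
    unfolding weak_star_Linf_def
  proof (intro allI impI)
    fix g :: "'a \<times> 'a \<Rightarrow> real" assume "integrable lebesgue g"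
    then have "(\<lambda>j. \<integral>z. hs (r0 j) z * g z \<partial>lebesgue) \<longlonglongrightarrow> (\<integral>z. h z * g z \<partial>lebesgue)"
      using weak by (simp add: weak_star_Linf_def)
    from LIMSEQ_subseq_LIMSEQ[OF this r1]
    show "(\<lambda>j. \<integral>z. hs (r j) z * g z \<partial>lebesgue) \<longlonglongrightarrow> (\<integral>z. h z * g z \<partial>lebesgue)"
      by (simp add: o_def r_def)
  qed
  have "(\<lambda>j. En (\<lambda>x. us0 (r j) x - u x)) \<longlonglongrightarrow> 0"
    by (rule solutions_converge[OF assms(10) h weak' us0_weak u_weak M])
      (use Cauchy in \<open>simp add: r_def\<close>)
  then have "(\<lambda>j. En (\<lambda>x. us0 (r j) x - u x) powr (1 / p)) \<longlonglongrightarrow> 0 powr (1 / p)"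
    using p by (intro tendsto_powr2 tendsto_intros) (auto simp: En_nonneg)
  then have "(\<lambda>j. X0_norm k p (\<lambda>x. us0 (r j) x - u x)) \<longlonglongrightarrow> 0"
    using X0_norm_eq[OF V_diff[OF us0_V uV]] by simp
  then show ?thesis
    using r h weak' us0 u by (intro exI[of _ r] exI[of _ h] exI[of _ "\<lambda>j. us0 (r j)"] exI[of _ u]) auto
qed

end
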